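(* Let $P(t)=(-1)^mt^m+\sum_{i=0}^{m-1}a_it^i\in\mathbb Z[t]$ be a polynomial with the following properties: (i) all (complex) roots of $P(t)$ are roots of unity; (ii) if $\zeta$ is a primitive $p^k$-th root of unity, where $p$ is a prime number, then the multiplicity of $t=\zeta$ as a root of $P(t)$ is not greater than the multiplicity of $t=1$ as a root of $P(t)$ (the multiplicity being $0$ for a non-root). Then $P(t)$ is the Alexander polynomial of some Hurwitz $C$-group $G$.
   Context: **$C$-groups.** A $C$-group is a group $G$ together with a finite presentation (a $C$-presentation) on generators $x_1,\dots,x_m$ ($m\geq 1$) all of whose relations are conjugations between generators: $$G=G_W=\langle x_1,\dots,x_m \mid x_i=w_{i,j,k}^{-1}x_jw_{i,j,k},\ w_{i,j,k}\in W\rangle ,$$ where $W=\{w_{i,j,k}\in\mathbb F_m \mid 1\leq i,j\leq m,\ 1\leq k\leq \ell(i,j)\}$ is a finite family of elements (repetitions allowed) of the free group $\mathbb F_m$ on $x_1,\dots,x_m$, and $\ell(i,j)\ge 0$ are integers (if $\ell(i,j)=0$ there is no relation for the pair $(i,j)$). The images of $x_1,\dots,x_m$ in $G$ and all their conjugates are called the $C$-generators of $G$. A homomorphism of $C$-groups is a $C$-homomorphism if it sends $C$-generators to $C$-generators; $C$-groups are considered up to $C$-isomorphism. **Hurwitz $C$-groups.** A $C$-presentation $\langle x_1,\dots,x_m \mid x_i=w_{i,j,k}^{-1}x_jw_{i,j,k},\ w_{i,j,k}\in W\rangle$ is a Hurwitz $C$-presentation of degree $m$ if for each $i=1,\dots,m$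 the word $w_{i,i,1}$ is the product $x_1x_2\cdots x_m$ (so the relations include that each $x_i$ commutes with $x_1\cdots x_m$). A $C$-group is a Hurwitz $C$-group if, for some $m$, it possesses a Hurwitz $C$-presentation of degree $m$. Equivalently, there are $C$-generators $x_1,\dots,x_m$ generating $G$ (for some $m$) whose product $x_1\cdots x_m$ lies in the center of $G$. (The number $m$ of generators here is unrelated to the degree $m$ of the polynomial $P$.) **Alexander polynomial.** For a $C$-group $G$ let $\nu:G\to\mathbb F_1\simeq \mathbb Z$ be the epimorphism sending every $C$-generator of $G$ to the fixed generator of the infinite cyclic group $\mathbb F_1$, and let $N=\ker\nu$, with commutator subgroup $N'$. Let $h$ be the automorphism of $N/N'$ induced by $g\mapsto \widetilde x^{-1}g\widetilde x$, $g\in N$, where $\widetilde x$ is any $C$-generator of $G$ (the result does not depend on $\widetilde x$), and let $h_{\mathbb C}$ be the induced automorphism of $(N/N')\otimes_{\mathbb Z}\mathbb C$. The Alexander polynomial of $G$ is $\Delta(t)=\det(h_{\mathbb C}-t\,\mathrm{Id})$ if $(N/N')\otimes\mathbb C$ is finite dimensional (equal to $1$ if this space is zero), and $\Delta(t)\equiv 0$ if it is infinite dimensional. *)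

theory Defs
  imports
    "HOL-Computational_Algebra.Polynomial"
    "HOL-Algebra.Generated_Groups"
    "HOL-Algebra.Free_Abelian_Groups"
    "Jordan_Normal_Form.VS_Connect"
begin

text \<open>A letter \<open>(a, True)\<close> stands for the generator \<open>a\<close>, and \<open>(a, False)\<close> for its inverse.\<close>

type_synonym 'a word = "('a \<times> bool) list"

inductive free_equiv :: "'a set \<Rightarrow> 'a word \<Rightarrow> 'a word \<Rightarrow> bool" for S where
  refl: "u \<in> lists (S \<times> UNIV) \<Longrightarrow> free_equiv S u u"
| sym: "free_equiv S u v \<Longrightarrow> free_equiv S v u"
| trans: "free_equiv S u v \<Longrightarrow> free_equiv S v w \<Longrightarrow> free_equiv S u w"
| cancel: "u \<in> lists (S \<times> UNIV) \<Longrightarrow> v \<in> lists (S \<times> UNIV) \<Longrightarrow> a \<in> S \<Longrightarrow>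
    free_equiv S (u @ [(a, e), (a, \<not> e)] @ v) (u @ v)"

definition free_class :: "'a set \<Rightarrow> 'a word \<Rightarrow> 'a word set" where
  "free_class S u = {v. free_equiv S u v}"

definition free_group :: "'a set \<Rightarrow> 'a word set monoid" where
  "free_group S =
    \<lparr>carrier = free_class S ` lists (S \<times> UNIV),
     monoid.mult = (\<lambda>U V. \<Union>u\<in>U. \<Union>v\<in>V. free_class S (u @ v)),
     one = free_class S []\<rparr>"

definition normal_closure :: "('a, 'b) monoid_scheme \<Rightarrow> 'a set \<Rightarrow> 'a set" where
  "normal_closure G R = \<Inter>{N. N \<lhd> G \<and> R \<subseteq> N}"

abbreviation F :: "nat \<Rightarrow> nat word set monoid" where
  "F n \<equiv> free_group {1..n}"

definition F_gen :: "nat \<Rightarrow> nat \<Rightarrow> nat word set" where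
  "F_gen n i = free_class {1..n} [(i, True)]"

text \<open>A C-presentation is given by the number \<open>n\<close> of generators, the numbers \<open>l i j\<close> of relations
  \<open>x\<^sub>i = w\<^sub>i\<^sub>j\<^sub>k\<inverse> x\<^sub>j w\<^sub>i\<^sub>j\<^sub>k\<close>, and the conjugating elements \<open>w i j k\<close>.
  Only the values at indices \<open>1 \<le> i, j \<le> n\<close> and \<open>1 \<le> k \<le> l i j\<close> matter.\<close>

definition C_presentation ::
    "nat \<Rightarrow> (nat \<Rightarrow> nat \<Rightarrow> nat) \<Rightarrow> (nat \<Rightarrow> nat \<Rightarrow> nat \<Rightarrow> nat word set) \<Rightarrow> bool" where
  "C_presentation n l w \<longleftrightarrow>
    1 \<le> n \<and> (\<forall>i\<in>{1..n}. \<forall>j\<in>{1..n}. \<forall>k\<in>{1..l i j}. w i j k \<in> carrier (F n))"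

definition C_relators ::
    "nat \<Rightarrow> (nat \<Rightarrow> nat \<Rightarrow> nat) \<Rightarrow> (nat \<Rightarrow> nat \<Rightarrow> nat \<Rightarrow> nat word set) \<Rightarrow> nat word set set" where
  "C_relators n l w =
    {inv\<^bsub>F n\<^esub> F_gen n i \<otimes>\<^bsub>F n\<^esub> (inv\<^bsub>F n\<^esub> w i j k \<otimes>\<^bsub>F n\<^esub> F_gen n j \<otimes>\<^bsub>F n\<^esub> w i j k) | i j k.
      i \<in> {1..n} \<and> j \<in> {1..n} \<and> k \<in> {1..l i j}}"

definition C_group ::
    "nat \<Rightarrow> (nat \<Rightarrow> nat \<Rightarrow> nat) \<Rightarrow> (nat \<Rightarrow> nat \<Rightarrow> nat \<Rightarrow> nat word set) \<Rightarrow> nat word set set monoid" where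
  "C_group n l w = F n Mod normal_closure (F n) (C_relators n l w)"

definition C_generators ::
    "nat \<Rightarrow> (nat \<Rightarrow> nat \<Rightarrow> nat) \<Rightarrow> (nat \<Rightarrow> nat \<Rightarrow> nat \<Rightarrow> nat word set) \<Rightarrow> nat word set set set" where
  "C_generators n l w =
    {inv\<^bsub>C_group n l w\<^esub> g \<otimes>\<^bsub>C_group n l w\<^esub>
        (normal_closure (F n) (C_relators n l w) #>\<^bsub>F n\<^esub> F_gen n i) \<otimes>\<^bsub>C_group n l w\<^esub> g | g i.
      g \<in> carrier (C_group n l w) \<and> i \<in> {1..n}}"

definition hurwitz_C_presentation ::
    "nat \<Rightarrow> (nat \<Rightarrow> nat \<Rightarrow> nat) \<Rightarrow> (nat \<Rightarrow> nat \<Rightarrow> nat \<Rightarrow> nat word set) \<Rightarrow> bool" where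
  "hurwitz_C_presentation n l w \<longleftrightarrow>
    C_presentation n l w \<and>
    (\<forall>i\<in>{1..n}. 1 \<le> l i i \<and>
      w i i 1 = free_class {1..n} (map (\<lambda>j. (j, True)) [1..<n + 1]))"

text \<open>A C-group is a group \<open>G\<close> together with its set \<open>C\<close> of C-generators, up to C-isomorphism.\<close>

definition hurwitz_C_group :: "('a, 'b) monoid_scheme \<Rightarrow> 'a set \<Rightarrow> bool" where
  "hurwitz_C_group G C \<longleftrightarrow>
    group G \<and>
    (\<exists>n l w f. hurwitz_C_presentation n l w \<and>
       f \<in> iso (C_group n l w) G \<and> f ` C_generators n l w = C)"

abbreviation tensor_free :: "('a, 'b) monoid_scheme \<Rightarrow> ('a \<times> complex \<Rightarrow>\<^sub>0 int) monoid" where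
  "tensor_free A \<equiv> free_Abelian_group (carrier A \<times> (UNIV :: complex set))"

definition tensor_relations :: "('a, 'b) monoid_scheme \<Rightarrow> ('a \<times> complex \<Rightarrow>\<^sub>0 int) set" where
  "tensor_relations A = generate (tensor_free A)
    ({frag_of (a \<otimes>\<^bsub>A\<^esub> b, z) - frag_of (a, z) - frag_of (b, z) | a b z.
        a \<in> carrier A \<and> b \<in> carrier A} \<union>
     {frag_of (a, y + z) - frag_of (a, y) - frag_of (a, z) | a y z. a \<in> carrier A})"

text \<open>The map induced on the tensor product by a map \<open>f\<close> of pure tensors compatible with the
  relations.  Adding the relations to the image turns it into a full coset, which matters
  when \<open>f\<close> is not surjective (for instance for scalar multiplication by 0).\<close>

definition tensor_map ::
    "('a, 'b) monoid_scheme \<Rightarrow> ('a \<times> complex \<Rightarrow> 'a \<times> complex) \<Rightarrow>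
     ('a \<times> complex \<Rightarrow>\<^sub>0 int) set \<Rightarrow> ('a \<times> complex \<Rightarrow>\<^sub>0 int) set" where
  "tensor_map A f T =
    tensor_relations A <#>\<^bsub>tensor_free A\<^esub> (frag_extend (\<lambda>p. frag_of (f p)) ` T)"

text \<open>The fields \<open>mult\<close> and \<open>one\<close> exist because modules extend the record of rings; they carry no
  meaning here.\<close>

definition tensor_complex ::
    "('a, 'b) monoid_scheme \<Rightarrow> (complex, ('a \<times> complex \<Rightarrow>\<^sub>0 int) set) module" where
  "tensor_complex A =
    \<lparr>carrier = carrier (tensor_free A Mod tensor_relations A),
     monoid.mult = undefined,
     one = undefined,
     zero = one (tensor_free A Mod tensor_relations A),
     add = monoid.mult (tensor_free A Mod tensor_relations A),
     smult = (\<lambda>c. tensor_map A (\<lambda>(a, z). (a, c * z)))\<rparr>"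

text \<open>\<open>det (f - t Id)\<close> for an endomorphism \<open>f\<close> of a finite-dimensional complex vector space;
  the column \<open>j\<close> of \<open>A\<close> holds the coordinates of the image of the \<open>j\<close>-th basis vector.
  This is \<open>(-1)^dim\<close> times the monic characteristic polynomial.\<close>

definition endo_det_poly ::
    "(complex, 'v, 'c) module_scheme \<Rightarrow> ('v \<Rightarrow> 'v) \<Rightarrow> complex poly" where
  "endo_det_poly V f = (THE p. \<exists>bs A.
     distinct bs \<and> vectorspace.basis class_ring V (set bs) \<and>
     A \<in> carrier_mat (length bs) (length bs) \<and>
     (\<forall>j<length bs. f (bs ! j) = (\<Oplus>\<^bsub>V\<^esub>i\<in>{..<length bs}. A $$ (i, j) \<odot>\<^bsub>V\<^esub> bs ! i)) \<and>
     p = det (map_mat (\<lambda>a. [:a:]) A - [:0, 1:] \<cdot>\<^sub>m 1\<^sub>m (length bs)))"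

text \<open>Since the C-generators generate \<open>G\<close>, the homomorphism \<open>\<nu>\<close> is uniquely determined on the
  carrier.\<close>

definition C_kernel :: "('a, 'b) monoid_scheme \<Rightarrow> 'a set \<Rightarrow> 'a set" where
  "C_kernel G C =
    kernel G integer_group (SOME \<nu>. \<nu> \<in> hom G integer_group \<and> (\<forall>x\<in>C. \<nu> x = 1))"

definition C_kernel_ab :: "('a, 'b) monoid_scheme \<Rightarrow> 'a set \<Rightarrow> 'a set monoid" where
  "C_kernel_ab G C = G\<lparr>carrier := C_kernel G C\<rparr> Mod derived G (C_kernel G C)"

text \<open>Elements of \<open>N/N'\<close> are cosets in \<open>G\<close>, and \<open>h\<close> conjugates them elementwise; it does not
  depend on the chosen C-generator.\<close>

definition C_monodromy :: "('a, 'b) monoid_scheme \<Rightarrow> 'a set \<Rightarrow> 'a set \<Rightarrow> 'a set" where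
  "C_monodromy G C K =
    (let x = SOME x. x \<in> C in (\<lambda>g. inv\<^bsub>G\<^esub> x \<otimes>\<^bsub>G\<^esub> g \<otimes>\<^bsub>G\<^esub> x) ` K)"

definition alexander_polynomial :: "('a, 'b) monoid_scheme \<Rightarrow> 'a set \<Rightarrow> complex poly" where
  "alexander_polynomial G C =
    (let A = C_kernel_ab G C in
     if vectorspace.fin_dim class_ring (tensor_complex A)
     then endo_det_poly (tensor_complex A) (tensor_map A (\<lambda>(a, z). (C_monodromy G C a, z)))
     else 0)"

definition primitive_root_of_unity :: "nat \<Rightarrow> complex \<Rightarrow> bool" where
  "primitive_root_of_unity n z \<longleftrightarrow> 0 < n \<and> z ^ n = 1 \<and> (\<forall>d. 0 < d \<and> d < n \<longrightarrow> z ^ d \<noteq> 1)"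

end

theory Submission
  imports
    Defs
    "HOL-Computational_Algebra.Fundamental_Theorem_Algebra"
    "Jordan_Normal_Form.Char_Poly"
begin

text \<open>Up to sign, \<open>P\<close> is a product of separable integer polynomials \<open>P\<^sub>j\<close>, the successive radicals,
  all dividing \<open>t\<^sup>d - 1\<close> for one \<open>d\<close>. As long as \<open>t = 1\<close> is a root, \<open>P\<^sub>j(1) = 0\<close>; after that (ii)
  excludes roots of prime power order, so that \<open>P\<^sub>j(1) = \<plusminus>1\<close>. Hence, up to sign,
  \<open>P\<^sub>j = b\<^sub>j + (1 - t) q\<^sub>j\<close> with \<open>b\<^sub>j \<in> {0, 1}\<close>. Modulo \<open>N'\<close>, let \<open>e\<^sub>j = x\<inverse> y\<^sub>j\<close> and let \<open>W\<^sub>j\<close> be a word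
  representing \<open>q\<^sub>j(h) e\<^sub>j\<close>: the relations \<open>y\<^sub>j = W\<^sub>j\<inverse> y\<^sub>j W\<^sub>j\<close> (if \<open>b\<^sub>j = 0\<close>) and \<open>x = W\<^sub>j\<inverse> y\<^sub>j W\<^sub>j\<close>
  (if \<open>b\<^sub>j = 1\<close>) both say \<open>P\<^sub>j(h) e\<^sub>j = 0\<close>, so that \<open>N/N'\<close> is the direct sum of the \<open>\<int>[t]/(P\<^sub>j)\<close>.
  Repeating every generator \<open>d\<close> times makes the product of all generators central without
  imposing anything new, since \<open>h\<^sup>d = 1\<close>. That nothing else collapses is seen from the
  representations \<open>x \<mapsto> (z \<mapsto> \<zeta> z)\<close>, \<open>y\<^sub>i \<mapsto> (z \<mapsto> \<zeta> z + \<delta>\<^sub>i\<^sub>j)\<close> by affine maps of \<open>\<complex>\<close>, one for each root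
  \<open>\<zeta>\<close> of each \<open>P\<^sub>j\<close>: restricted to \<open>N\<close> they are linear functionals that diagonalise \<open>h\<close>.\<close>

section \<open>Coordinates and the determinant of a diagonalisable endomorphism\<close>

text \<open>A central element of positive degree forces \<open>h\<close> to have finite order on
  \<open>N/N'\<close>, hence to be diagonalisable over the complex numbers. A repeated root of
  \<open>P\<close> can therefore not come from one cyclic module and needs several separable
  summands; this is why \<open>P\<close> is cut into radicals. The second obstacle is the value at
  \<open>t = 1\<close>: the relations used here realise only the values 0 and 1. The cyclotomic
  polynomial of order \<open>n\<close> has the value 0 there for \<open>n = 1\<close>, the prime
  \<open>p\<close> if \<open>n > 1\<close> is a power of \<open>p\<close>, and 1 otherwise, so (ii)
  ensures that a radical with a root of prime power order also has the root 1. Only the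
  complexification of \<open>N/N'\<close> is computed. The relations bound it from above by the sum
  of the \<open>\<complex>[t]/(P\<^sub>j)\<close>; the affine representations bound it from below by
  evaluation at the roots. Both bounds agree because a polynomial vanishing at all roots of a
  separable \<open>P\<^sub>j\<close> is a multiple of it. No word problem in the presented group has
  to be solved.\<close>

locale coordinate_space =
  fixes V :: "(complex, 'v, 'c) module_scheme" and \<phi> :: "'v \<Rightarrow> nat \<Rightarrow> complex" and m :: nat
  assumes add_closed: "X \<in> carrier V \<Longrightarrow> Y \<in> carrier V \<Longrightarrow> X \<oplus>\<^bsub>V\<^esub> Y \<in> carrier V"
    and zero_closed: "\<zero>\<^bsub>V\<^esub> \<in> carrier V"
    and smult_closed: "X \<in> carrier V \<Longrightarrow> c \<odot>\<^bsub>V\<^esub> X \<in> carrier V"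
    and coord_add: "X \<in> carrier V \<Longrightarrow> Y \<in> carrier V \<Longrightarrow> i < m \<Longrightarrow> \<phi> (X \<oplus>\<^bsub>V\<^esub> Y) i = \<phi> X i + \<phi> Y i"
    and coord_zero: "i < m \<Longrightarrow> \<phi> \<zero>\<^bsub>V\<^esub> i = 0"
    and coord_smult: "X \<in> carrier V \<Longrightarrow> i < m \<Longrightarrow> \<phi> (c \<odot>\<^bsub>V\<^esub> X) i = c * \<phi> X i"
    and coord_eqI: "X \<in> carrier V \<Longrightarrow> Y \<in> carrier V \<Longrightarrow> (\<And>i. i < m \<Longrightarrow> \<phi> X i = \<phi> Y i) \<Longrightarrow> X = Y"
    and coord_surj: "\<exists>X\<in>carrier V. \<forall>i<m. \<phi> X i = g i"
begin

text \<open>The coordinates separate points and take all values, so every vector space law, and the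
  existence of negatives, is pulled back from complex \<open>m\<close>-tuples.\<close>

sublocale vectorspace class_ring V
proof -
  have "abelian_group V"
  proof (rule abelian_groupI)
    fix X assume X: "X \<in> carrier V"
    obtain Y where "Y \<in> carrier V" "\<forall>i<m. \<phi> Y i = - \<phi> X i"
      using coord_surj[of "\<lambda>i. - \<phi> X i"] by auto
    then show "\<exists>Y\<in>carrier V. Y \<oplus>\<^bsub>V\<^esub> X = \<zero>\<^bsub>V\<^esub>"
      using X by (intro bexI[of _ Y] coord_eqI) (auto simp: coord_add coord_zero add_closed zero_closed)
  qed (auto intro!: coord_eqI simp: coord_add coord_zero add_closed zero_closed add_ac)
  then interpret abelian_group V .
  show "vectorspace class_ring V"
    by unfold_locales
      (auto intro!: coord_eqI
        simp: coord_add coord_smult add_closed smult_closed algebra_simps)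
qed

lemma coord_finsum:
  assumes "finite S" "g \<in> S \<rightarrow> carrier V" "i < m"
  shows "\<phi> (finsum V g S) i = (\<Sum>s\<in>S. \<phi> (g s) i)"
  using assms(1,2) by (induction S) (auto simp: coord_zero coord_add assms(3))

lemma coord_lincomb:
  assumes "finite S" "S \<subseteq> carrier V" "i < m"
  shows "\<phi> (lincomb a S) i = (\<Sum>s\<in>S. a s * \<phi> s i)"
proof -
  have "\<phi> (lincomb a S) i = (\<Sum>s\<in>S. \<phi> (a s \<odot>\<^bsub>V\<^esub> s) i)"
    unfolding lincomb_def using assms by (intro coord_finsum) (auto simp: smult_closed)
  also have "\<dots> = (\<Sum>s\<in>S. a s * \<phi> s i)"
    using assms by (intro sum.cong) (auto simp: coord_smult)
  finally show ?thesis .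
qed

definition unit_vector :: "nat \<Rightarrow> 'v" where
  "unit_vector k = (SOME X. X \<in> carrier V \<and> (\<forall>i<m. \<phi> X i = (if i = k then 1 else 0)))"

lemma unit_vector:
  "unit_vector k \<in> carrier V" "i < m \<Longrightarrow> \<phi> (unit_vector k) i = (if i = k then 1 else 0)"
proof -
  have "\<exists>X. X \<in> carrier V \<and> (\<forall>i<m. \<phi> X i = (if i = k then 1 else 0))"
    using coord_surj[of "\<lambda>i. if i = k then 1 else 0"] by auto
  from someI_ex[OF this]
  show "unit_vector k \<in> carrier V" "i < m \<Longrightarrow> \<phi> (unit_vector k) i = (if i = k then 1 else 0)"
    unfolding unit_vector_def by auto
qed

lemma inj_unit_vector: "inj_on unit_vector {..<m}"
proof (rule inj_onI)
  fix i k assume "i \<in> {..<m}" "k \<in> {..<m}" "unit_vector i = unit_vector k"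
  then show "i = k"
    using unit_vector(2)[of i i] unit_vector(2)[of i k] by (auto split: if_splits)
qed

lemma basis_unit_vectors: "basis (unit_vector ` {..<m})"
proof -
  let ?S = "unit_vector ` {..<m}"
  have S: "finite ?S" "?S \<subseteq> carrier V" by (auto simp: unit_vector)
  have co: "\<phi> (lincomb a ?S) i = a (unit_vector i)" if "i < m" for a i
  proof -
    have "\<phi> (lincomb a ?S) i = (\<Sum>k<m. a (unit_vector k) * \<phi> (unit_vector k) i)"
      using that by (simp add: coord_lincomb[OF S] sum.reindex[OF inj_unit_vector])
    also have "\<dots> = (\<Sum>k<m. if k = i then a (unit_vector i) else 0)"
      using that by (intro sum.cong) (auto simp: unit_vector(2))
    finally show ?thesis using that by simp
  qed
  have "lin_indpt ?S"
  proof (rule finite_lin_indpt2[OF S])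
    fix a assume "lincomb a ?S = \<zero>\<^bsub>V\<^esub>"
    then have "a (unit_vector i) = 0" if "i < m" for i
      using co[OF that, of a] coord_zero[OF that] by simp
    then show "\<forall>v\<in>?S. a v = \<zero>\<^bsub>class_ring\<^esub>" by auto
  qed
  moreover have "span ?S = carrier V"
  proof
    show "span ?S \<subseteq> carrier V" using S(2) by (rule span_is_subset2)
    show "carrier V \<subseteq> span ?S"
    proof
      fix X assume X: "X \<in> carrier V"
      define a where "a v = \<phi> X (the_inv_into {..<m} unit_vector v)" for v
      have "lincomb a ?S = X"
      proof (rule coord_eqI[OF _ X])
        show "lincomb a ?S \<in> carrier V" using S by (intro lincomb_closed) auto
      qed (simp add: co a_def the_inv_into_f_f[OF inj_unit_vector])
      then show "X \<in> span ?S"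
        using S by (auto simp: finite_span)
    qed
  qed
  ultimately show ?thesis using S by (simp add: basis_def)
qed

lemma fin_dim: fin_dim
  using basis_unit_vectors unfolding fin_dim_def basis_def by (intro exI[of _ "unit_vector ` {..<m}"]) auto

lemma dim_eq: "dim = m"
  using dim_basis[OF _ basis_unit_vectors] by (simp add: card_image inj_unit_vector)

text \<open>\<open>endo_det_poly\<close> is a definite description ranging over all bases. The unit
  vectors show that the value is attained; uniqueness is the invariance of the determinant under a
  change of basis.\<close>

lemma endo_det_poly_diagonal:
  fixes f :: "'v \<Rightarrow> 'v"
  assumes f: "\<And>X. X \<in> carrier V \<Longrightarrow> f X \<in> carrier V"
    and ev: "\<And>X i. X \<in> carrier V \<Longrightarrow> i < m \<Longrightarrow> \<phi> (f X) i = \<zeta> i * \<phi> X i"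
  shows "endo_det_poly V f = (\<Prod>i<m. [:\<zeta> i, -1:])"
proof -
  let ?chi = "\<lambda>A n. det (map_mat (\<lambda>a. [:a:]) A - [:0, 1:] \<cdot>\<^sub>m 1\<^sub>m n) :: complex poly"
  let ?Q = "\<lambda>bs A p. distinct bs \<and> basis (set bs) \<and>
     A \<in> carrier_mat (length bs) (length bs) \<and>
     (\<forall>j<length bs. f (bs ! j) = (\<Oplus>\<^bsub>V\<^esub>i\<in>{..<length bs}. A $$ (i, j) \<odot>\<^bsub>V\<^esub> bs ! i)) \<and>
     p = ?chi A (length bs)"
  define D where "D = mat m m (\<lambda>(i, j). if i = j then \<zeta> i else 0)"
  have D: "D \<in> carrier_mat m m" by (simp add: D_def)
  have chiD: "?chi D m = (\<Prod>i<m. [:\<zeta> i, -1:])"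
  proof -
    have "?chi D m = prod_list (diag_mat (map_mat (\<lambda>a. [:a:]) D - [:0, 1:] \<cdot>\<^sub>m 1\<^sub>m m))"
      by (rule det_upper_triangular[of _ m]) (auto simp: D_def upper_triangular_def)
    also have "\<dots> = (\<Prod>i<m. [:\<zeta> i, -1:])"
      by (auto simp: diag_mat_def D_def prod.list_conv_set_nth atLeast0LessThan intro!: prod.cong)
    finally show ?thesis .
  qed
  show ?thesis
    unfolding endo_det_poly_def
  proof (rule the_equality)
    have "?Q (map unit_vector [0..<m]) D (\<Prod>i<m. [:\<zeta> i, -1:])"
    proof (intro conjI allI impI)
      show "distinct (map unit_vector [0..<m])"
        using inj_unit_vector by (simp add: distinct_map atLeast0LessThan)
      show "basis (set (map unit_vector [0..<m]))"
        using basis_unit_vectors by (simp add: atLeast0LessThan)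
      fix j assume "j < length (map unit_vector [0..<m])"
      then have j: "j < m" by simp
      show "f (map unit_vector [0..<m] ! j) = (\<Oplus>\<^bsub>V\<^esub>i\<in>{..<length (map unit_vector [0..<m])}.
          D $$ (i, j) \<odot>\<^bsub>V\<^esub> map unit_vector [0..<m] ! i)" (is "_ = ?rhs")
      proof (rule coord_eqI)
        show "?rhs \<in> carrier V" by (auto simp: unit_vector smult_closed)
        fix i assume i: "i < m"
        have "\<phi> ?rhs i = (\<Sum>k<m. \<phi> (D $$ (k, j) \<odot>\<^bsub>V\<^esub> map unit_vector [0..<m] ! k) i)"
          using i by (subst coord_finsum) (auto simp: unit_vector smult_closed)
        also have "\<dots> = (\<Sum>k<m. if k = i then D $$ (i, j) else 0)"
          using i by (intro sum.cong) (auto simp: unit_vector coord_smult)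
        finally show "\<phi> (f (map unit_vector [0..<m] ! j)) i = \<phi> ?rhs i"
          using i j by (simp add: ev unit_vector D_def)
      qed (use j in \<open>simp add: f unit_vector\<close>)
    qed (use D chiD in auto)
    then show "\<exists>bs A. ?Q bs A (\<Prod>i<m. [:\<zeta> i, -1:])" by blast
  next
    fix p assume "\<exists>bs A. ?Q bs A p"
    then obtain bs A where dist: "distinct bs" and bas: "basis (set bs)"
      and A': "A \<in> carrier_mat (length bs) (length bs)"
      and fA: "\<And>j. j < length bs \<Longrightarrow>
        f (bs ! j) = (\<Oplus>\<^bsub>V\<^esub>i\<in>{..<length bs}. A $$ (i, j) \<odot>\<^bsub>V\<^esub> bs ! i)"
      and p: "p = ?chi A (length bs)" by blast
    have len: "length bs = m"
      using dim_basis[OF _ bas] dim_eq distinct_card[OF dist] by simp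
    have A: "A \<in> carrier_mat m m" using A' len by simp
    have bsV: "set bs \<subseteq> carrier V" and sp: "span (set bs) = carrier V"
      using bas by (auto simp: basis_def)
    have bsV': "bs ! i \<in> carrier V" if "i < m" for i using bsV that len by auto
    \<comment> \<open>Column \<open>k\<close> of \<open>B\<close> holds the coordinates of
      \<open>bs ! k\<close>. Expanding the unit vectors in \<open>bs\<close> gives a right inverse
      \<open>C\<close>, which is enough because only determinants are cancelled.\<close>
    define B where "B = mat m m (\<lambda>(i, k). \<phi> (bs ! k) i)"
    have B: "B \<in> carrier_mat m m" by (simp add: B_def)
    have "\<exists>a. \<forall>i<m. (if i = k then 1 else 0) = (\<Sum>l<m. a l * \<phi> (bs ! l) i)" for k
    proof -
      have "unit_vector k \<in> span (set bs)" using sp unit_vector by simp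
      then obtain a where a: "unit_vector k = lincomb a (set bs)"
        using bsV by (auto simp: finite_span)
      have "(if i = k then 1 else 0) = (\<Sum>l<m. a (bs ! l) * \<phi> (bs ! l) i)" if "i < m" for i
      proof -
        have "(if i = k then 1 else 0) = (\<Sum>s\<in>set bs. a s * \<phi> s i)"
          using unit_vector(2)[OF that, of k] coord_lincomb[of "set bs" i a] a that bsV by simp
        also have "\<dots> = (\<Sum>l<m. a (bs ! l) * \<phi> (bs ! l) i)"
          using bij_betw_nth[OF dist, of "{..<m}" "set bs"] len
          by (intro sum.reindex_bij_betw[symmetric]) auto
        finally show ?thesis .
      qed
      then show ?thesis by (intro exI[of _ "\<lambda>l. a (bs ! l)"]) simp
    qed
    then obtain a where a: "\<And>k i. i < m \<Longrightarrow>
        (if i = k then 1 else 0) = (\<Sum>l<m. a k l * \<phi> (bs ! l) i)" by metis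
    define C where "C = mat m m (\<lambda>(l, k). a k l)"
    have C: "C \<in> carrier_mat m m" by (simp add: C_def)
    have BC: "B * C = 1\<^sub>m m"
      by (rule eq_matI) (auto simp: B_def C_def scalar_prod_def a atLeast0LessThan mult.commute)
    \<comment> \<open>Both sides list the coordinates of \<open>f (bs ! j)\<close>, computed once
      from the eigenvalues and once from the matrix \<open>A\<close>.\<close>
    have DB: "D * B = B * A"
    proof (rule eq_matI)
      fix i j assume "i < dim_row (B * A)" "j < dim_col (B * A)"
      then have ij: "i < m" "j < m" using A B by auto
      have "(D * B) $$ (i, j) = (\<Sum>k<m. (if i = k then \<zeta> i else 0) * \<phi> (bs ! j) k)"
        using ij unfolding D_def B_def by (simp add: scalar_prod_def atLeast0LessThan)
      also have "\<dots> = (\<Sum>k<m. if k = i then \<zeta> i * \<phi> (bs ! j) i else 0)"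
        by (intro sum.cong) auto
      also have "\<dots> = \<phi> (f (bs ! j)) i" using ij bsV' by (simp add: ev)
      also have "\<dots> = (\<Sum>k<m. \<phi> (A $$ (k, j) \<odot>\<^bsub>V\<^esub> bs ! k) i)"
        using ij bsV' len by (subst fA, simp, subst coord_finsum) (auto simp: smult_closed)
      also have "\<dots> = (\<Sum>k<m. A $$ (k, j) * \<phi> (bs ! k) i)"
        using ij bsV' by (intro sum.cong) (auto simp: coord_smult)
      also have "\<dots> = (B * A) $$ (i, j)"
        using ij A by (auto simp: B_def scalar_prod_def atLeast0LessThan mult.commute intro!: sum.cong)
      finally show "(D * B) $$ (i, j) = (B * A) $$ (i, j)" .
    qed (use A B D in auto)
    let ?h = "map_mat (\<lambda>a. [:a:]) :: complex mat \<Rightarrow> complex poly mat"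
    interpret h: comm_ring_hom "\<lambda>a::complex. [:a:]"
      by unfold_locales (auto simp: one_pCons)
    let ?X = "[:0, 1:] \<cdot>\<^sub>m 1\<^sub>m m :: complex poly mat"
    have X: "?X \<in> carrier_mat m m" by simp
    have hm: "?h A \<in> carrier_mat m m" "?h B \<in> carrier_mat m m" "?h C \<in> carrier_mat m m"
      "?h D \<in> carrier_mat m m" using A B C D by auto
    have "(?h D - ?X) * ?h B = ?h D * ?h B - ?X * ?h B"
      by (rule minus_mult_distrib_mat[OF hm(4) X hm(2)])
    also have "?X * ?h B = ?h B * ?X"
      using hm by (simp add: mult_smult_distrib[of _ m m _ m] mult_smult_assoc_mat[of _ m m _ m])
    also have "?h D * ?h B = ?h B * ?h A"
      using DB h.mat_hom_mult[OF D B] h.mat_hom_mult[OF B A] by simp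
    also have "?h B * ?h A - ?h B * ?X = ?h B * (?h A - ?X)"
      by (rule mult_minus_distrib_mat[symmetric, OF hm(2,1) X])
    finally have "det ((?h D - ?X) * ?h B) = det (?h B * (?h A - ?X))" by simp
    then have "det (?h D - ?X) * det (?h B) = det (?h B) * det (?h A - ?X)"
      using hm X by (simp add: det_mult[of _ m] minus_carrier_mat)
    moreover have "det (?h B) * det (?h C) = 1"
      using det_mult[OF hm(2,3)] det_one h.mat_hom_mult[OF B C, symmetric]
      unfolding BC h.mat_hom_one by metis
    ultimately have "det (?h A - ?X) = det (?h D - ?X)"
      by (metis mult.commute mult_left_cancel mult_zero_left zero_neq_one)
    then show "p = (\<Prod>i<m. [:\<zeta> i, -1:])"
      using chiD unfolding p len by simp
  qed
qed

end

section \<open>Tensor products with the complex numbers\<close>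

definition frag_eval :: "('p \<Rightarrow> complex) \<Rightarrow> ('p \<Rightarrow>\<^sub>0 int) \<Rightarrow> complex" where
  "frag_eval g c = (\<Sum>p\<in>Poly_Mapping.keys c. of_int (Poly_Mapping.lookup c p) * g p)"

lemma frag_eval_superset:
  assumes "finite S" "Poly_Mapping.keys c \<subseteq> S"
  shows "frag_eval g c = (\<Sum>p\<in>S. of_int (Poly_Mapping.lookup c p) * g p)"
  unfolding frag_eval_def using assms by (intro sum.mono_neutral_left) (auto simp: in_keys_iff)

lemma frag_eval_0 [simp]: "frag_eval g 0 = 0"
  by (simp add: frag_eval_def)

lemma frag_eval_frag_of [simp]: "frag_eval g (frag_of p) = g p"
  by (simp add: frag_eval_def)

lemma frag_eval_add [simp]: "frag_eval g (c + d) = frag_eval g c + frag_eval g d"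
proof -
  let ?S = "Poly_Mapping.keys c \<union> Poly_Mapping.keys d"
  show ?thesis
    using keys_add[of c d]
    by (simp add: frag_eval_superset[of ?S] lookup_add algebra_simps sum.distrib)
qed

lemma frag_eval_uminus [simp]: "frag_eval g (- c) = - frag_eval g c"
  using frag_eval_add[of g c "- c"] by (simp add: eq_neg_iff_add_eq_0 add.commute)

lemma frag_eval_diff [simp]: "frag_eval g (c - d) = frag_eval g c - frag_eval g d"
  using frag_eval_add[of g c "- d"] by simp

lemma frag_eval_sum: "frag_eval g (sum f S) = (\<Sum>s\<in>S. frag_eval g (f s))"
  by (induction S rule: infinite_finite_induct) auto

lemma frag_eval_frag_extend:
  "frag_eval g (frag_extend (\<lambda>p. frag_of (f p)) c) = frag_eval (\<lambda>p. g (f p)) c"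
proof -
  have "Poly_Mapping.keys c \<subseteq> UNIV" by simp
  then show ?thesis
    by (induction c rule: frag_induction) (simp_all add: frag_extend_diff)
qed

lemma frag_eval_cong:
  assumes "\<And>p. p \<in> Poly_Mapping.keys c \<Longrightarrow> g p = h p"
  shows "frag_eval g c = frag_eval h c"
  using assms by (simp add: frag_eval_def)

lemma frag_eval_mult: "frag_eval (\<lambda>p. k * g p) c = k * frag_eval g c"
  by (simp add: frag_eval_def sum_distrib_left mult_ac)

lemma keys_frag_extend_frag_of:
  "Poly_Mapping.keys (frag_extend (\<lambda>p. frag_of (f p)) c) \<subseteq> f ` Poly_Mapping.keys c"
  using keys_frag_extend[of "\<lambda>p. frag_of (f p)" c] by auto

text \<open>For additive \<open>l\<close> this is the linear functional induced by \<open>l\<close>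
  on the tensor product, evaluated on representatives.\<close>

abbreviation tensor_eval :: "('a \<Rightarrow> complex) \<Rightarrow> ('a \<times> complex \<Rightarrow>\<^sub>0 int) \<Rightarrow> complex" where
  "tensor_eval l \<equiv> frag_eval (\<lambda>p. l (fst p) * snd p)"

text \<open>Both properties pass to sums and negatives, so the bilinearity relations that generate
  the subgroup are all that must be checked.\<close>

lemma tensor_relations_eval_0:
  assumes "group A" and l: "\<And>a b. a \<in> carrier A \<Longrightarrow> b \<in> carrier A \<Longrightarrow> l (a \<otimes>\<^bsub>A\<^esub> b) = l a + l b"
    and "c \<in> tensor_relations A"
  shows "Poly_Mapping.keys c \<subseteq> carrier A \<times> UNIV \<and> tensor_eval l c = 0"
proof -
  interpret A: group A by fact
  have sub: "Poly_Mapping.keys (x - y) \<subseteq> carrier A \<times> UNIV"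
    if "Poly_Mapping.keys x \<subseteq> carrier A \<times> UNIV" "Poly_Mapping.keys y \<subseteq> carrier A \<times> UNIV"
    for x y :: "'a \<times> complex \<Rightarrow>\<^sub>0 int"
    using that keys_diff[of x y] by blast
  have gen: "Poly_Mapping.keys c \<subseteq> carrier A \<times> UNIV \<and> tensor_eval l c = 0"
    if "c \<in> {frag_of (a \<otimes>\<^bsub>A\<^esub> b, z) - frag_of (a, z) - frag_of (b, z) | a b z.
        a \<in> carrier A \<and> b \<in> carrier A} \<union>
      {frag_of (a, y + z) - frag_of (a, y) - frag_of (a, z) | a y z. a \<in> carrier A}" for c
    using that
  proof
    assume "c \<in> {frag_of (a \<otimes>\<^bsub>A\<^esub> b, z) - frag_of (a, z) - frag_of (b, z) | a b z.
        a \<in> carrier A \<and> b \<in> carrier A}"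
    then obtain a b z where c: "c = frag_of (a \<otimes>\<^bsub>A\<^esub> b, z) - frag_of (a, z) - frag_of (b, z)"
      and ab: "a \<in> carrier A" "b \<in> carrier A" by blast
    show ?thesis
      unfolding c using ab by (intro conjI sub) (auto simp: l algebra_simps)
  next
    assume "c \<in> {frag_of (a, y + z) - frag_of (a, y) - frag_of (a, z) | a y z. a \<in> carrier A}"
    then obtain a y z where c: "c = frag_of (a, y + z) - frag_of (a, y) - frag_of (a, z)"
      and a: "a \<in> carrier A" by blast
    show ?thesis
      unfolding c using a by (intro conjI sub) (auto simp: algebra_simps)
  qed
  from assms(3) show ?thesis
    unfolding tensor_relations_def
  proof (induction rule: generate.induct)
    case (eng x y)
    then show ?case using keys_add[of x y] by auto
  next
    case (incl c)
    then show ?case by (rule gen)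
  next
    case (inv c)
    from gen[OF inv] show ?case by simp
  qed simp
qed

lemma set_multI: "x \<in> H \<Longrightarrow> y \<in> K \<Longrightarrow> x \<otimes>\<^bsub>G\<^esub> y \<in> H <#>\<^bsub>G\<^esub> K"
  by (auto simp: set_mult_def)

text \<open>The last two assumptions say that the \<open>m\<close> functionals identify the tensor
  product with complex \<open>m\<close>-space: jointly injective modulo the relations, and jointly
  surjective.\<close>

locale tensor_coordinates = comm_group A
  for A :: "('a, 'b) monoid_scheme" (structure) +
  fixes l :: "nat \<Rightarrow> 'a \<Rightarrow> complex" and m :: nat
  assumes l_mult: "\<And>i a b. i < m \<Longrightarrow> a \<in> carrier A \<Longrightarrow> b \<in> carrier A \<Longrightarrow> l i (a \<otimes> b) = l i a + l i b"
    and eval_eq_0D: "\<And>c. Poly_Mapping.keys c \<subseteq> carrier A \<times> UNIV \<Longrightarrow>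
      (\<And>i. i < m \<Longrightarrow> tensor_eval (l i) c = 0) \<Longrightarrow> c \<in> tensor_relations A"
    and eval_surj: "\<And>g. \<exists>c. Poly_Mapping.keys c \<subseteq> carrier A \<times> UNIV \<and> (\<forall>i<m. tensor_eval (l i) c = g i)"
begin

text \<open>These level sets turn out to be exactly the cosets of the relations. Elements of the
  tensor product can thus be named by their coordinates, without choosing representatives.\<close>

definition fibre :: "(nat \<Rightarrow> complex) \<Rightarrow> ('a \<times> complex \<Rightarrow>\<^sub>0 int) set" where
  "fibre g = {c. Poly_Mapping.keys c \<subseteq> carrier A \<times> UNIV \<and> (\<forall>i<m. tensor_eval (l i) c = g i)}"

lemma fibre_nonempty: "\<exists>c. c \<in> fibre g"
  using eval_surj by (auto simp: fibre_def)

lemma fibre_0: "fibre (\<lambda>_. 0) = tensor_relations A"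
proof
  show "fibre (\<lambda>_. 0) \<subseteq> tensor_relations A"
    using eval_eq_0D by (simp add: fibre_def subset_iff)
  show "tensor_relations A \<subseteq> fibre (\<lambda>_. 0)"
  proof
    fix c assume c: "c \<in> tensor_relations A"
    have "Poly_Mapping.keys c \<subseteq> carrier A \<times> UNIV"
      using tensor_relations_eval_0[OF is_group _ c, of "\<lambda>_. 0"] by simp
    moreover have "tensor_eval (l i) c = 0" if "i < m" for i
      using tensor_relations_eval_0[OF is_group l_mult[OF that] c] by simp
    ultimately show "c \<in> fibre (\<lambda>_. 0)" by (simp add: fibre_def)
  qed
qed

lemma fibre_add: "fibre g <#>\<^bsub>tensor_free A\<^esub> fibre h = fibre (\<lambda>i. g i + h i)"
proof
  show "fibre g <#>\<^bsub>tensor_free A\<^esub> fibre h \<subseteq> fibre (\<lambda>i. g i + h i)"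
    by (auto simp: set_mult_def fibre_def dest: keys_add[THEN subsetD])
  show "fibre (\<lambda>i. g i + h i) \<subseteq> fibre g <#>\<^bsub>tensor_free A\<^esub> fibre h"
  proof
    fix c assume c: "c \<in> fibre (\<lambda>i. g i + h i)"
    obtain d where d: "d \<in> fibre g" using fibre_nonempty by blast
    have "c - d \<in> fibre h"
      using c d keys_diff[of c d] by (auto simp: fibre_def)
    moreover have "c = d + (c - d)" by simp
    ultimately show "c \<in> fibre g <#>\<^bsub>tensor_free A\<^esub> fibre h"
      using set_multI[OF d, of "c - d" _ "tensor_free A"] by simp
  qed
qed

lemma coset_eq_fibre:
  assumes "Poly_Mapping.keys c \<subseteq> carrier A \<times> UNIV"
  shows "tensor_relations A #>\<^bsub>tensor_free A\<^esub> c = fibre (\<lambda>i. tensor_eval (l i) c)"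
proof
  show "tensor_relations A #>\<^bsub>tensor_free A\<^esub> c \<subseteq> fibre (\<lambda>i. tensor_eval (l i) c)"
  proof
    fix d assume "d \<in> tensor_relations A #>\<^bsub>tensor_free A\<^esub> c"
    then obtain r where r: "r \<in> fibre (\<lambda>_. 0)" and d: "d = r + c"
      by (auto simp: r_coset_def fibre_0)
    show "d \<in> fibre (\<lambda>i. tensor_eval (l i) c)"
      using r assms keys_add[of r c] by (auto simp: fibre_def d)
  qed
  show "fibre (\<lambda>i. tensor_eval (l i) c) \<subseteq> tensor_relations A #>\<^bsub>tensor_free A\<^esub> c"
  proof
    fix d assume d: "d \<in> fibre (\<lambda>i. tensor_eval (l i) c)"
    have "d - c \<in> tensor_relations A"
      using d assms keys_diff[of d c] by (auto simp: fibre_def fibre_0[symmetric])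
    moreover have "d = d - c + c" by simp
    ultimately show "d \<in> tensor_relations A #>\<^bsub>tensor_free A\<^esub> c"
      unfolding r_coset_def by (metis UN_I insertI1 mult_free_Abelian_group)
  qed
qed

lemma carrier_tensor_complex: "carrier (tensor_complex A) = range fibre"
proof
  show "carrier (tensor_complex A) \<subseteq> range fibre"
    by (auto simp: tensor_complex_def carrier_FactGroup coset_eq_fibre)
  show "range fibre \<subseteq> carrier (tensor_complex A)"
  proof
    fix X assume "X \<in> range fibre"
    then obtain g c where X: "X = fibre g" and c: "c \<in> fibre g"
      using fibre_nonempty by blast
    then have "X = tensor_relations A #>\<^bsub>tensor_free A\<^esub> c"
      by (simp add: coset_eq_fibre fibre_def)
    with c show "X \<in> carrier (tensor_complex A)"
      by (auto simp: tensor_complex_def carrier_FactGroup fibre_def)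
  qed
qed

definition coords :: "('a \<times> complex \<Rightarrow>\<^sub>0 int) set \<Rightarrow> nat \<Rightarrow> complex" where
  "coords X i = tensor_eval (l i) (SOME c. c \<in> X)"

lemma coords_fibre: "i < m \<Longrightarrow> coords (fibre g) i = g i"
  using someI_ex[OF fibre_nonempty[of g]] by (simp add: coords_def fibre_def)

lemma fibre_cong: "(\<And>i. i < m \<Longrightarrow> g i = h i) \<Longrightarrow> fibre g = fibre h"
  by (simp add: fibre_def)

text \<open>The image of a level set may be only a part of a level set. The relations added in
  \<open>tensor_map\<close> fill it up, since elements with equal coordinates differ by a relation.
  Scalar multiplication and the monodromy are both instances.\<close>

lemma tensor_map_fibre:
  assumes f: "\<And>p. p \<in> carrier A \<times> UNIV \<Longrightarrow> f p \<in> carrier A \<times> UNIV"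
    and ev: "\<And>i p. i < m \<Longrightarrow> p \<in> carrier A \<times> UNIV \<Longrightarrow>
      l i (fst (f p)) * snd (f p) = \<mu> i * (l i (fst p) * snd p)"
  shows "tensor_map A f (fibre g) = fibre (\<lambda>i. \<mu> i * g i)"
proof -
  let ?F = "frag_extend (\<lambda>p. frag_of (f p))"
  have F: "?F c \<in> fibre (\<lambda>i. \<mu> i * g i)" if "c \<in> fibre g" for c
  proof -
    have c: "Poly_Mapping.keys c \<subseteq> carrier A \<times> UNIV" using that by (simp add: fibre_def)
    have "Poly_Mapping.keys (?F c) \<subseteq> carrier A \<times> UNIV"
      using keys_frag_extend_frag_of[of f c] c f by blast
    moreover have "tensor_eval (l i) (?F c) = \<mu> i * g i" if "i < m" for i
    proof -
      have "tensor_eval (l i) (?F c) = frag_eval (\<lambda>p. \<mu> i * (l i (fst p) * snd p)) c"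
        unfolding frag_eval_frag_extend using c that ev by (intro frag_eval_cong) blast
      then show ?thesis
        using \<open>c \<in> fibre g\<close> that by (simp add: frag_eval_mult fibre_def)
    qed
    ultimately show ?thesis by (simp add: fibre_def)
  qed
  have "tensor_relations A <#>\<^bsub>tensor_free A\<^esub> (?F ` fibre g)
      \<subseteq> fibre (\<lambda>_. 0) <#>\<^bsub>tensor_free A\<^esub> fibre (\<lambda>i. \<mu> i * g i)"
    unfolding fibre_0 using F by (intro mono_set_mult) auto
  moreover have "fibre (\<lambda>i. \<mu> i * g i) \<subseteq> tensor_relations A <#>\<^bsub>tensor_free A\<^esub> (?F ` fibre g)"
  proof
    fix d assume d: "d \<in> fibre (\<lambda>i. \<mu> i * g i)"
    obtain c where c: "c \<in> fibre g" using fibre_nonempty by blast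
    have "d - ?F c \<in> tensor_relations A"
      using d F[OF c] keys_diff[of d "?F c"] by (auto simp: fibre_def fibre_0[symmetric])
    moreover have "d = d - ?F c + ?F c" by simp
    ultimately show "d \<in> tensor_relations A <#>\<^bsub>tensor_free A\<^esub> (?F ` fibre g)"
      using set_multI[OF _ imageI[OF c, of ?F], of "d - ?F c" _ "tensor_free A"] by simp
  qed
  ultimately show ?thesis
    unfolding tensor_map_def fibre_add by auto
qed

lemma tensor_smult: "c \<odot>\<^bsub>tensor_complex A\<^esub> fibre g = fibre (\<lambda>i. c * g i)"
  unfolding tensor_complex_def by (auto intro!: tensor_map_fibre)

lemma tensor_add: "fibre g \<oplus>\<^bsub>tensor_complex A\<^esub> fibre h = fibre (\<lambda>i. g i + h i)"
  unfolding tensor_complex_def by (simp add: fibre_add)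

lemma tensor_zero: "\<zero>\<^bsub>tensor_complex A\<^esub> = fibre (\<lambda>_. 0)"
  unfolding tensor_complex_def by (simp add: fibre_0)

sublocale tensor: coordinate_space "tensor_complex A" coords m
proof
  fix X Y assume "X \<in> carrier (tensor_complex A)" "Y \<in> carrier (tensor_complex A)"
    "\<And>i. i < m \<Longrightarrow> coords X i = coords Y i"
  then show "X = Y"
    unfolding carrier_tensor_complex image_iff by (metis coords_fibre fibre_cong)
next
  fix g
  show "\<exists>X\<in>carrier (tensor_complex A). \<forall>i<m. coords X i = g i"
    by (intro bexI[of _ "fibre g"]) (auto simp: carrier_tensor_complex coords_fibre)
qed (auto simp: carrier_tensor_complex tensor_add tensor_zero tensor_smult coords_fibre)

lemma endo_det_poly_tensor_map:
  assumes "\<And>a. a \<in> carrier A \<Longrightarrow> f a \<in> carrier A"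
    and "\<And>i a. i < m \<Longrightarrow> a \<in> carrier A \<Longrightarrow> l i (f a) = \<zeta> i * l i a"
  shows "endo_det_poly (tensor_complex A) (tensor_map A (\<lambda>(a, z). (f a, z))) = (\<Prod>i<m. [:\<zeta> i, -1:])"
proof -
  have *: "tensor_map A (\<lambda>(a, z). (f a, z)) (fibre g) = fibre (\<lambda>i. \<zeta> i * g i)" for g
    by (rule tensor_map_fibre) (auto simp: assms)
  show ?thesis
    by (rule tensor.endo_det_poly_diagonal)
      (auto simp: carrier_tensor_complex * coords_fibre)
qed

end

section \<open>Complex polynomials on finite sets of points: divisibility and interpolation\<close>

lemma prod_roots_dvd:
  fixes z :: "complex poly"
  assumes "finite S" "\<And>x. x \<in> S \<Longrightarrow> poly z x = 0"
  shows "(\<Prod>x\<in>S. [:-x, 1:]) dvd z"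
  using assms
proof (induction S arbitrary: z)
  case (insert x S)
  then have "[:-x, 1:] dvd z" by (simp add: poly_eq_0_iff_dvd)
  then obtain w where w: "z = [:-x, 1:] * w" by (rule dvdE)
  have "poly w y = 0" if "y \<in> S" for y
    using insert that by (auto simp: w)
  with insert have "(\<Prod>x\<in>S. [:-x, 1:]) dvd w" by blast
  then show ?case
    using insert by (simp add: w mult_dvd_mono del: mult_pCons_left)
qed simp

lemma rsquarefree_dvdI:
  fixes p z :: "complex poly"
  assumes "rsquarefree p" "\<And>x. poly p x = 0 \<Longrightarrow> poly z x = 0"
  shows "p dvd z"
proof -
  have p: "smult (lead_coeff p) (\<Prod>x | poly p x = 0. [:-x, 1:]) = p"
    using assms(1) by (rule complex_poly_decompose_rsquarefree)
  have "p \<noteq> 0" using assms(1) by (auto simp: rsquarefree_def)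
  then have "(\<Prod>x | poly p x = 0. [:-x, 1:]) dvd z"
    using assms(2) by (intro prod_roots_dvd) (auto simp: poly_roots_finite)
  then show ?thesis
    using \<open>p \<noteq> 0\<close> by (subst p[symmetric]) (simp add: smult_dvd_iff)
qed

lemma interpolation_exists:
  fixes g :: "'a::field \<Rightarrow> 'a"
  assumes "finite S"
  shows "\<exists>z. \<forall>x\<in>S. poly z x = g x"
  using assms
proof (induction S)
  case (insert x S)
  then obtain z where z: "\<forall>y\<in>S. poly z y = g y" by blast
  define w where "w = (\<Prod>y\<in>S. [:-y, 1:])"
  have w0: "poly w y = 0" if "y \<in> S" for y
    using that insert by (auto simp: w_def poly_prod)
  have "poly w x \<noteq> 0"
    using insert by (auto simp: w_def poly_prod)
  then show ?case
    using z w0 by (intro exI[of _ "z + smult ((g x - poly z x) / poly w x) w"]) auto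
qed simp

section \<open>Congruences in the tensor product and the images of polynomials\<close>

context comm_group
begin

lemma tensor_relations_subgroup: "subgroup (tensor_relations G) (tensor_free G)"
  unfolding tensor_relations_def
proof (rule group.generate_is_subgroup[OF group_free_Abelian_group], rule subsetI, elim UnE CollectE exE conjE)
  fix c a b and z :: complex assume "c = frag_of (a \<otimes> b, z) - frag_of (a, z) - frag_of (b, z)"
    "a \<in> carrier G" "b \<in> carrier G"
  then show "c \<in> carrier (tensor_free G)"
    using keys_diff[of "frag_of (a \<otimes> b, z) - frag_of (a, z)" "frag_of (b, z)"]
      keys_diff[of "frag_of (a \<otimes> b, z)" "frag_of (a, z)"] by auto
next
  fix c a and y z :: complex assume "c = frag_of (a, y + z) - frag_of (a, y) - frag_of (a, z)"
    "a \<in> carrier G"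
  then show "c \<in> carrier (tensor_free G)"
    using keys_diff[of "frag_of (a, y + z) - frag_of (a, y)" "frag_of (a, z)"]
      keys_diff[of "frag_of (a, y + z)" "frag_of (a, y)"] by auto
qed

lemma tensor_relations_keys: "c \<in> tensor_relations G \<Longrightarrow> Poly_Mapping.keys c \<subseteq> carrier G \<times> UNIV"
  using subgroup.mem_carrier[OF tensor_relations_subgroup, of c] by simp

definition tensor_cong :: "('a \<times> complex \<Rightarrow>\<^sub>0 int) \<Rightarrow> ('a \<times> complex \<Rightarrow>\<^sub>0 int) \<Rightarrow> bool" (infix "\<doteq>" 50) where
  "c \<doteq> d \<longleftrightarrow> c - d \<in> tensor_relations G"

lemma tensor_relations_closed:
  "0 \<in> tensor_relations G"
  "c \<in> tensor_relations G \<Longrightarrow> d \<in> tensor_relations G \<Longrightarrow> c + d \<in> tensor_relations G"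
  "c \<in> tensor_relations G \<Longrightarrow> - c \<in> tensor_relations G"
  using subgroup.one_closed[OF tensor_relations_subgroup]
    subgroup.m_closed[OF tensor_relations_subgroup, of c d]
    subgroup.m_inv_closed[OF tensor_relations_subgroup, of c] tensor_relations_keys[of c]
  by auto

lemma tensor_cong_refl [simp]: "c \<doteq> c"
  by (simp add: tensor_cong_def tensor_relations_closed)

lemma tensor_cong_sym: "c \<doteq> d \<Longrightarrow> d \<doteq> c"
  using tensor_relations_closed(3)[of "c - d"] by (simp add: tensor_cong_def)

lemma tensor_cong_trans [trans]: "c \<doteq> d \<Longrightarrow> d \<doteq> e \<Longrightarrow> c \<doteq> e"
  using tensor_relations_closed(2)[of "c - d" "d - e"] by (simp add: tensor_cong_def)

lemma tensor_cong_add: "c \<doteq> c' \<Longrightarrow> d \<doteq> d' \<Longrightarrow> c + d \<doteq> c' + d'"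
  using tensor_relations_closed(2)[of "c - c'" "d - d'"] by (simp add: tensor_cong_def algebra_simps)

lemma tensor_cong_uminus: "c \<doteq> d \<Longrightarrow> - c \<doteq> - d"
  using tensor_relations_closed(3)[of "c - d"] by (simp add: tensor_cong_def)

lemma tensor_cong_diff: "c \<doteq> c' \<Longrightarrow> d \<doteq> d' \<Longrightarrow> c - d \<doteq> c' - d'"
  using tensor_cong_add[OF _ tensor_cong_uminus, of c c' d d'] by simp

lemma tensor_cong_sum: "(\<And>i. i \<in> S \<Longrightarrow> f i \<doteq> g i) \<Longrightarrow> sum f S \<doteq> sum g S"
  by (induction S rule: infinite_finite_induct) (auto intro: tensor_cong_add)

lemma tensor_mult:
  assumes "a \<in> carrier G" "b \<in> carrier G"
  shows "frag_of (a \<otimes> b, z) \<doteq> frag_of (a, z) + frag_of (b, z)"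
proof -
  have "frag_of (a \<otimes> b, z) - frag_of (a, z) - frag_of (b, z) \<in> tensor_relations G"
    unfolding tensor_relations_def using assms by (blast intro: generate.incl)
  then show ?thesis by (simp add: tensor_cong_def diff_diff_eq)
qed

lemma tensor_add:
  assumes "a \<in> carrier G"
  shows "frag_of (a, y + z) \<doteq> frag_of (a, y) + frag_of (a, z)"
proof -
  have "frag_of (a, y + z) - frag_of (a, y) - frag_of (a, z) \<in> tensor_relations G"
    unfolding tensor_relations_def using assms by (blast intro: generate.incl)
  then show ?thesis by (simp add: tensor_cong_def diff_diff_eq)
qed

lemma tensor_cong_double: "c \<doteq> c + c \<Longrightarrow> c \<doteq> 0"
  using tensor_cong_diff[of c "c + c" c c] by (auto intro: tensor_cong_sym)

lemma tensor_one: "frag_of (\<one>, z) \<doteq> 0"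
  using tensor_mult[of \<one> \<one> z] by (intro tensor_cong_double) simp

lemma tensor_zero: "a \<in> carrier G \<Longrightarrow> frag_of (a, 0) \<doteq> 0"
  using tensor_add[of a 0 0] by (intro tensor_cong_double) simp

lemma tensor_inv:
  assumes "a \<in> carrier G"
  shows "frag_of (inv a, z) \<doteq> - frag_of (a, z)"
proof -
  have "frag_of (inv a, z) + frag_of (a, z) \<doteq> frag_of (\<one>, z)"
    using tensor_mult[of "inv a" a z] assms by (auto intro: tensor_cong_sym)
  also note tensor_one
  finally show ?thesis by (simp add: tensor_cong_def)
qed

lemma tensor_uminus:
  assumes "a \<in> carrier G"
  shows "frag_of (a, - z) \<doteq> - frag_of (a, z)"
proof -
  have "frag_of (a, - z) + frag_of (a, z) \<doteq> frag_of (a, 0)"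
    using tensor_add[of a "- z" z] assms by (auto intro: tensor_cong_sym)
  also note tensor_zero[OF assms]
  finally show ?thesis by (simp add: tensor_cong_def)
qed

lemma tensor_nat_pow:
  assumes "a \<in> carrier G"
  shows "frag_of (a [^] (k::nat), z) \<doteq> frag_of (a, of_nat k * z)"
proof (induction k)
  case 0
  show ?case
    using tensor_cong_trans[OF tensor_one tensor_cong_sym[OF tensor_zero[OF assms]]] by simp
next
  case (Suc k)
  have "frag_of (a [^] Suc k, z) \<doteq> frag_of (a [^] k, z) + frag_of (a, z)"
    using assms by (simp add: tensor_mult)
  also have "\<dots> \<doteq> frag_of (a, of_nat k * z) + frag_of (a, z)"
    by (intro tensor_cong_add Suc.IH tensor_cong_refl)
  also have "\<dots> \<doteq> frag_of (a, of_nat (Suc k) * z)"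
    using tensor_cong_sym[OF tensor_add[OF assms, of "of_nat k * z" z]] by (simp add: algebra_simps)
  finally show ?case .
qed

lemma tensor_int_pow:
  assumes "a \<in> carrier G"
  shows "frag_of (a [^] (k::int), z) \<doteq> frag_of (a, of_int k * z)"
proof (cases k rule: int_cases2)
  case (nonneg n)
  then show ?thesis using tensor_nat_pow[OF assms, of n z] by (simp add: int_pow_int)
next
  case (nonpos n)
  have "frag_of (a [^] k, z) \<doteq> - frag_of (a [^] n, z)"
    using tensor_inv[of "a [^] n" z] assms by (simp add: nonpos int_pow_neg int_pow_int)
  also have "\<dots> \<doteq> - frag_of (a, of_nat n * z)"
    by (intro tensor_cong_uminus tensor_nat_pow assms)
  also have "\<dots> \<doteq> frag_of (a, of_int k * z)"
    using tensor_cong_sym[OF tensor_uminus[OF assms, of "of_nat n * z"]] by (simp add: nonpos)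
  finally show ?thesis .
qed

text \<open>If \<open>E k\<close> is \<open>h^k e\<close>, this is \<open>q(h)\<close> applied to
  \<open>E k\<close>, written multiplicatively, where \<open>cs\<close> lists the coefficients of
  \<open>q\<close> from the constant term upwards.\<close>

primrec lincomb :: "(nat \<Rightarrow> 'a) \<Rightarrow> nat \<Rightarrow> int list \<Rightarrow> 'a" where
  "lincomb E k [] = \<one>"
| "lincomb E k (c # cs) = E k [^] c \<otimes> lincomb E (Suc k) cs"

lemma lincomb_closed: "(\<And>k. E k \<in> carrier G) \<Longrightarrow> lincomb E k cs \<in> carrier G"
  by (induction cs arbitrary: k) auto

text \<open>The linear map that sends \<open>t^i\<close> to \<open>E i\<close> tensor 1. It is
  additive only modulo the relations, because pure tensors with complex factor 0 are nonzero formal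
  sums.\<close>

definition tensor_poly :: "(nat \<Rightarrow> 'a) \<Rightarrow> complex poly \<Rightarrow> ('a \<times> complex \<Rightarrow>\<^sub>0 int)" where
  "tensor_poly E z = (\<Sum>i\<le>degree z. frag_of (E i, coeff z i))"

context
  fixes E :: "nat \<Rightarrow> 'a"
  assumes E: "\<And>k. E k \<in> carrier G"
begin

lemma tensor_poly_keys: "Poly_Mapping.keys (tensor_poly E z) \<subseteq> carrier G \<times> UNIV"
  unfolding tensor_poly_def using keys_sum[of "\<lambda>i. frag_of (E i, coeff z i)" "{..degree z}"] E by fastforce

lemma tensor_poly_bound:
  assumes "degree z \<le> n"
  shows "tensor_poly E z \<doteq> (\<Sum>i\<le>n. frag_of (E i, coeff z i))"
proof -
  have "(\<Sum>i\<le>n. frag_of (E i, coeff z i))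
      = tensor_poly E z + (\<Sum>i\<in>{Suc (degree z)..n}. frag_of (E i, coeff z i))"
    unfolding tensor_poly_def using assms
    by (subst sum.union_disjoint[symmetric]) (auto intro!: sum.cong)
  also have "\<dots> \<doteq> tensor_poly E z + (\<Sum>i\<in>{Suc (degree z)..n}. 0)"
    by (intro tensor_cong_add tensor_cong_refl tensor_cong_sum)
      (auto simp: coeff_eq_0 tensor_zero E)
  finally show ?thesis by (simp add: tensor_cong_sym)
qed

lemma tensor_poly_add: "tensor_poly E (y + z) \<doteq> tensor_poly E y + tensor_poly E z"
proof -
  define n where "n = max (degree y) (degree z)"
  have "tensor_poly E (y + z) \<doteq> (\<Sum>i\<le>n. frag_of (E i, coeff (y + z) i))"
    by (intro tensor_poly_bound) (simp add: n_def degree_add_le_max)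
  also have "\<dots> \<doteq> (\<Sum>i\<le>n. frag_of (E i, coeff y i) + frag_of (E i, coeff z i))"
    by (intro tensor_cong_sum) (simp add: tensor_add E)
  also have "\<dots> = (\<Sum>i\<le>n. frag_of (E i, coeff y i)) + (\<Sum>i\<le>n. frag_of (E i, coeff z i))"
    by (rule sum.distrib)
  also have "\<dots> \<doteq> tensor_poly E y + tensor_poly E z"
    by (intro tensor_cong_add tensor_cong_sym[OF tensor_poly_bound]) (auto simp: n_def)
  finally show ?thesis .
qed

lemma tensor_poly_0: "tensor_poly E 0 \<doteq> 0"
  by (simp add: tensor_poly_def tensor_zero E)

lemma tensor_poly_sum: "tensor_poly E (sum f S) \<doteq> (\<Sum>i\<in>S. tensor_poly E (f i))"
proof (induction S rule: infinite_finite_induct)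
  case (insert x S)
  then show ?case
    using tensor_cong_trans[OF tensor_poly_add tensor_cong_add[OF tensor_cong_refl insert.IH]] by simp
qed (auto simp: tensor_poly_0)

lemma tensor_poly_uminus: "tensor_poly E (- z) \<doteq> - tensor_poly E z"
proof -
  have "tensor_poly E (- z) + tensor_poly E z \<doteq> tensor_poly E 0"
    using tensor_cong_sym[OF tensor_poly_add[of "- z" z]] by simp
  also note tensor_poly_0
  finally show ?thesis by (simp add: tensor_cong_def)
qed

lemma tensor_poly_monom: "tensor_poly E (monom c k) \<doteq> frag_of (E k, c)"
proof -
  have "tensor_poly E (monom c k) \<doteq> (\<Sum>i\<le>k. frag_of (E i, coeff (monom c k) i))"
    by (intro tensor_poly_bound) (rule degree_monom_le)
  also have "\<dots> \<doteq> (\<Sum>i\<le>k. if i = k then frag_of (E k, c) else 0)"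
    by (intro tensor_cong_sum) (auto simp: tensor_zero E)
  finally show ?thesis by simp
qed

text \<open>Splitting off the constant coefficient writes the polynomial as \<open>c + t r\<close>;
  the factor \<open>t\<close> becomes the shift from \<open>k\<close> to \<open>Suc k\<close>, and
  the exponent \<open>c\<close> moves into the complex factor.\<close>

lemma tensor_lincomb:
  "frag_of (lincomb E k cs, y) \<doteq> tensor_poly E (smult y (monom 1 k * Poly (map of_int cs)))"
proof (induction cs arbitrary: k)
  case Nil
  then show ?case using tensor_cong_trans[OF tensor_one tensor_cong_sym[OF tensor_poly_0]] by simp
next
  case (Cons c cs)
  have "frag_of (lincomb E k (c # cs), y) \<doteq> frag_of (E k [^] c, y) + frag_of (lincomb E (Suc k) cs, y)"
    by (simp add: tensor_mult E lincomb_closed)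
  also have "\<dots> \<doteq> frag_of (E k, of_int c * y)
      + tensor_poly E (smult y (monom 1 (Suc k) * Poly (map of_int cs)))"
    by (intro tensor_cong_add Cons.IH tensor_int_pow E)
  also have "\<dots> \<doteq> tensor_poly E (monom (of_int c * y) k)
      + tensor_poly E (smult y (monom 1 (Suc k) * Poly (map of_int cs)))"
    by (intro tensor_cong_add tensor_cong_refl tensor_cong_sym[OF tensor_poly_monom])
  also have "\<dots> \<doteq> tensor_poly E (monom (of_int c * y) k
      + smult y (monom 1 (Suc k) * Poly (map of_int cs)))"
    by (rule tensor_cong_sym[OF tensor_poly_add])
  also have "monom (of_int c * y) k + smult y (monom 1 (Suc k) * Poly (map of_int cs))
      = smult y (monom 1 k * Poly (map of_int (c # cs)))"
    by (subst poly_eq_poly_eq_iff[symmetric], intro ext)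
      (simp add: poly_monom algebra_simps)
  finally show ?case .
qed

text \<open>The relation at index \<open>k\<close>, tensored with \<open>y\<close>, says that
  \<open>p * monom y k\<close> has image zero. Summing over monomials kills the whole ideal
  generated by \<open>p\<close>.\<close>

lemma tensor_poly_relation:
  fixes b :: int and cs :: "int list"
  defines "p \<equiv> [:of_int b:] + [:1, -1:] * Poly (map of_int cs)"
  assumes rel: "\<And>k. lincomb E (Suc k) cs = E k [^] b \<otimes> lincomb E k cs"
  shows "tensor_poly E (p * z) \<doteq> 0"
proof -
  let ?q = "Poly (map of_int cs) :: complex poly"
  have mon: "tensor_poly E (p * monom y k) \<doteq> 0" for y k
  proof -
    have "frag_of (lincomb E (Suc k) cs, y) \<doteq> frag_of (E k [^] b, y) + frag_of (lincomb E k cs, y)"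
      unfolding rel by (simp add: tensor_mult E lincomb_closed)
    also have "\<dots> \<doteq> frag_of (E k, of_int b * y) + frag_of (lincomb E k cs, y)"
      by (intro tensor_cong_add tensor_cong_refl tensor_int_pow E)
    also have "\<dots> \<doteq> tensor_poly E (monom (of_int b * y) k)
        + tensor_poly E (smult y (monom 1 k * ?q))"
      by (intro tensor_cong_add tensor_lincomb tensor_cong_sym[OF tensor_poly_monom])
    finally have 1: "frag_of (lincomb E (Suc k) cs, y) \<doteq> tensor_poly E (monom (of_int b * y) k)
        + tensor_poly E (smult y (monom 1 k * ?q))" .
    have "p * monom y k = monom (of_int b * y) k + smult y (monom 1 k * ?q)
        + - smult y (monom 1 (Suc k) * ?q)"
      by (subst poly_eq_poly_eq_iff[symmetric], intro ext)
        (simp add: p_def poly_monom algebra_simps)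
    also have "tensor_poly E \<dots> \<doteq> tensor_poly E (monom (of_int b * y) k + smult y (monom 1 k * ?q))
        + tensor_poly E (- smult y (monom 1 (Suc k) * ?q))" by (rule tensor_poly_add)
    also have "\<dots> \<doteq> (tensor_poly E (monom (of_int b * y) k) + tensor_poly E (smult y (monom 1 k * ?q)))
        + - tensor_poly E (smult y (monom 1 (Suc k) * ?q))"
      by (intro tensor_cong_add tensor_poly_add tensor_poly_uminus)
    also have "\<dots> \<doteq> frag_of (lincomb E (Suc k) cs, y) + - frag_of (lincomb E (Suc k) cs, y)"
      by (intro tensor_cong_add tensor_cong_sym[OF 1] tensor_cong_uminus tensor_cong_sym[OF tensor_lincomb])
    finally show ?thesis by simp
  qed
  have "p * z = (\<Sum>i\<le>degree z. p * monom (coeff z i) i)"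
    by (subst poly_as_sum_of_monoms[symmetric]) (rule sum_distrib_left)
  then have "tensor_poly E (p * z) \<doteq> (\<Sum>i\<le>degree z. tensor_poly E (p * monom (coeff z i) i))"
    using tensor_poly_sum by simp
  also have "\<dots> \<doteq> (\<Sum>i\<le>degree z. 0)"
    by (intro tensor_cong_sum mon)
  finally show ?thesis by simp
qed

end

end

section \<open>Modules spanned by cyclic orbits, with a dual family of functionals\<close>

text \<open>In the application \<open>E j k\<close> is the class of \<open>h^k e\<^sub>j\<close>.
  The assumptions \<open>gen\<close> and \<open>rel\<close> bound the tensor product from above; by
  \<open>l_E\<close>, \<open>l j \<zeta>\<close> evaluates the \<open>j\<close>-th polynomial at
  \<open>\<zeta>\<close>, which gives the bound from below.\<close>

locale presented_module = comm_group G
  for G :: "('a, 'b) monoid_scheme" (structure) +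
  fixes s :: nat and E :: "nat \<Rightarrow> nat \<Rightarrow> 'a" and b :: "nat \<Rightarrow> int" and cs :: "nat \<Rightarrow> int list"
    and l :: "nat \<Rightarrow> complex \<Rightarrow> 'a \<Rightarrow> complex"
  fixes p :: "nat \<Rightarrow> complex poly"
  defines "p \<equiv> \<lambda>j. [:of_int (b j):] + [:1, -1:] * Poly (map of_int (cs j))"
  assumes E: "\<And>j k. j < s \<Longrightarrow> E j k \<in> carrier G"
    and gen: "carrier G \<subseteq> generate G {E j k | j k. j < s}"
    and rel: "\<And>j k. j < s \<Longrightarrow> lincomb (E j) (Suc k) (cs j) = E j k [^] b j \<otimes> lincomb (E j) k (cs j)"
    and p_rsquarefree: "\<And>j. j < s \<Longrightarrow> rsquarefree (p j)"
    and l_mult: "\<And>j \<zeta> x y. j < s \<Longrightarrow> poly (p j) \<zeta> = 0 \<Longrightarrow> x \<in> carrier G \<Longrightarrow> y \<in> carrier G \<Longrightarrow>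
      l j \<zeta> (x \<otimes> y) = l j \<zeta> x + l j \<zeta> y"
    and l_E: "\<And>j \<zeta> i k. j < s \<Longrightarrow> poly (p j) \<zeta> = 0 \<Longrightarrow> i < s \<Longrightarrow>
      l j \<zeta> (E i k) = (if i = j then \<zeta> ^ k else 0)"
begin

lemma eval_tensor_poly:
  assumes "j < s" "poly (p j) \<zeta> = 0" "i < s"
  shows "tensor_eval (l j \<zeta>) (tensor_poly (E i) z) = (if i = j then poly z \<zeta> else 0)"
  using assms by (simp add: tensor_poly_def frag_eval_sum l_E poly_altdef mult.commute)

lemma frag_of_cong_tensor_poly:
  assumes "a \<in> carrier G"
  shows "\<exists>z. frag_of (a, y) \<doteq> (\<Sum>j<s. tensor_poly (E j) (z j))"
proof -
  from assms gen have "a \<in> generate G {E j k | j k. j < s}" by blast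
  then show ?thesis
  proof (induction arbitrary: y rule: generate.induct)
    case one
    have "(\<Sum>j<s. tensor_poly (E j) 0) \<doteq> (\<Sum>j<s. 0)"
      by (intro tensor_cong_sum tensor_poly_0 E) simp
    then show ?case
      using tensor_cong_trans[OF tensor_one tensor_cong_sym] by (intro exI[of _ "\<lambda>_. 0"]) simp
  next
    have single: "\<exists>z. frag_of (E i k, y) \<doteq> (\<Sum>j<s. tensor_poly (E j) (z j))" if i: "i < s" for i k y
    proof (intro exI)
      define z where "z j = (if j = i then monom y k else 0)" for j
      have "(\<Sum>j<s. tensor_poly (E j) (z j)) \<doteq> (\<Sum>j<s. if j = i then frag_of (E i k, y) else 0)"
        by (intro tensor_cong_sum) (auto simp: z_def intro: tensor_poly_monom tensor_poly_0 E)
      also have "\<dots> = frag_of (E i k, y)" using i by simp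
      finally show "frag_of (E i k, y) \<doteq> (\<Sum>j<s. tensor_poly (E j) (z j))"
        by (rule tensor_cong_sym)
    qed
    {
      case (incl h)
      then show ?case using single by blast
    next
      case (inv h)
      then obtain i k where h: "h = E i k" "i < s" by blast
      \<comment> \<open>The inverse is traded for a sign in the complex factor, where a polynomial
        coefficient can absorb it.\<close>
      obtain z where z: "frag_of (E i k, - y) \<doteq> (\<Sum>j<s. tensor_poly (E j) (z j))"
        using single[OF h(2)] by blast
      have "frag_of (inv h, y) \<doteq> - frag_of (h, y)"
        by (intro tensor_inv) (simp add: h E)
      also have "\<dots> \<doteq> frag_of (h, - y)"
        by (intro tensor_cong_sym[OF tensor_uminus]) (simp add: h E)
      also note z[folded h(1)]
      finally show ?case by blast
    }
  next
    case (eng h1 h2)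
    from eng.IH obtain z1 z2 where z: "frag_of (h1, y) \<doteq> (\<Sum>j<s. tensor_poly (E j) (z1 j))"
      "frag_of (h2, y) \<doteq> (\<Sum>j<s. tensor_poly (E j) (z2 j))" by meson
    have "{E j k | j k. j < s} \<subseteq> carrier G" using E by blast
    then have h: "h1 \<in> carrier G" "h2 \<in> carrier G"
      using eng.hyps generate_in_carrier by blast+
    have "frag_of (h1 \<otimes> h2, y) \<doteq> frag_of (h1, y) + frag_of (h2, y)"
      by (rule tensor_mult[OF h])
    also have "\<dots> \<doteq> (\<Sum>j<s. tensor_poly (E j) (z1 j)) + (\<Sum>j<s. tensor_poly (E j) (z2 j))"
      by (intro tensor_cong_add z)
    also have "\<dots> = (\<Sum>j<s. tensor_poly (E j) (z1 j) + tensor_poly (E j) (z2 j))"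
      by (simp add: sum.distrib)
    also have "\<dots> \<doteq> (\<Sum>j<s. tensor_poly (E j) (z1 j + z2 j))"
      by (intro tensor_cong_sum tensor_cong_sym[OF tensor_poly_add] E) simp
    finally show ?case by (intro exI[of _ "\<lambda>j. z1 j + z2 j"])
  qed
qed

lemma cong_tensor_poly:
  assumes "Poly_Mapping.keys c \<subseteq> carrier G \<times> UNIV"
  shows "\<exists>z. c \<doteq> (\<Sum>j<s. tensor_poly (E j) (z j))"
  using assms
proof (induction c rule: frag_induction)
  case zero
  have "(\<Sum>j<s. tensor_poly (E j) 0) \<doteq> (\<Sum>j<s. 0)"
    by (intro tensor_cong_sum tensor_poly_0 E) simp
  then show ?case by (intro exI[of _ "\<lambda>_. 0"]) (simp add: tensor_cong_sym)
next
  case (one x)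
  then show ?case using frag_of_cong_tensor_poly by (cases x) blast
next
  case (diff c d)
  then obtain z1 z2 where z: "c \<doteq> (\<Sum>j<s. tensor_poly (E j) (z1 j))"
    "d \<doteq> (\<Sum>j<s. tensor_poly (E j) (z2 j))" by blast
  have "c - d \<doteq> (\<Sum>j<s. tensor_poly (E j) (z1 j)) - (\<Sum>j<s. tensor_poly (E j) (z2 j))"
    by (intro tensor_cong_diff z)
  also have "\<dots> = (\<Sum>j<s. tensor_poly (E j) (z1 j) + - tensor_poly (E j) (z2 j))"
    by (simp add: sum_subtractf)
  also have "\<dots> \<doteq> (\<Sum>j<s. tensor_poly (E j) (z1 j) + tensor_poly (E j) (- z2 j))"
    by (intro tensor_cong_sum tensor_cong_add tensor_cong_refl tensor_cong_sym[OF tensor_poly_uminus] E) simp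
  also have "\<dots> \<doteq> (\<Sum>j<s. tensor_poly (E j) (z1 j + - z2 j))"
    by (intro tensor_cong_sum tensor_cong_sym[OF tensor_poly_add] E) simp
  finally show ?case by (intro exI[of _ "\<lambda>j. z1 j + - z2 j"])
qed

lemma eval_cong:
  assumes "j < s" "poly (p j) \<zeta> = 0" "c \<doteq> d"
  shows "tensor_eval (l j \<zeta>) c = tensor_eval (l j \<zeta>) d"
  using tensor_relations_eval_0[OF is_group l_mult[OF assms(1,2)], of "c - d"] assms(3)
  by (simp add: tensor_cong_def)

text \<open>Roots are tagged with the factor they belong to, so that a root shared by several
  \<open>p j\<close> is counted once for each of them. The multiplicities of the Alexander
  polynomial arise in this way.\<close>

definition spectrum :: "(nat \<times> complex) set" where
  "spectrum = (SIGMA j:{..<s}. {\<zeta>. poly (p j) \<zeta> = 0})"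

lemma finite_spectrum: "finite spectrum"
proof -
  have "p j \<noteq> 0" if "j < s" for j
    using p_rsquarefree[OF that] by (simp add: rsquarefree_def)
  then show ?thesis unfolding spectrum_def by (intro finite_SigmaI poly_roots_finite) simp_all
qed

lemma nth_spectrum:
  assumes "set rs = spectrum" "i < length rs"
  shows "fst (rs ! i) < s" "poly (p (fst (rs ! i))) (snd (rs ! i)) = 0"
proof -
  have "rs ! i \<in> spectrum" unfolding assms(1)[symmetric] using assms(2) by (rule nth_mem)
  then show "fst (rs ! i) < s" "poly (p (fst (rs ! i))) (snd (rs ! i)) = 0"
    by (cases "rs ! i"; simp add: spectrum_def)+
qed

text \<open>Modulo the relations every element is a sum of \<open>tensor_poly (E j) (z j)\<close>,
  whose coordinates are the values of the \<open>z j\<close> at the roots of \<open>p j\<close>.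
  Injectivity is then divisibility by a squarefree polynomial, and surjectivity is
  interpolation.\<close>

lemma tensor_coordinates_spectrum:
  assumes "distinct rs" "set rs = spectrum"
  shows "tensor_coordinates G (\<lambda>i. l (fst (rs ! i)) (snd (rs ! i))) (length rs)"
proof (intro tensor_coordinates.intro tensor_coordinates_axioms.intro)
  show "comm_group G" by (rule comm_group_axioms)
  note rs = nth_spectrum[OF assms(2)]
  show "l (fst (rs ! i)) (snd (rs ! i)) (x \<otimes> y)
      = l (fst (rs ! i)) (snd (rs ! i)) x + l (fst (rs ! i)) (snd (rs ! i)) y"
    if "i < length rs" "x \<in> carrier G" "y \<in> carrier G" for i x y
    using that rs[OF that(1)] by (intro l_mult)
  have ev: "tensor_eval (l j \<zeta>) (\<Sum>i<s. tensor_poly (E i) (z i)) = poly (z j) \<zeta>"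
    if "j < s" "poly (p j) \<zeta> = 0" for j \<zeta> z
  proof -
    have "tensor_eval (l j \<zeta>) (\<Sum>i<s. tensor_poly (E i) (z i))
        = (\<Sum>i<s. if i = j then poly (z j) \<zeta> else 0)"
      unfolding frag_eval_sum using that by (intro sum.cong) (auto simp: eval_tensor_poly)
    then show ?thesis using that by simp
  qed
  show "c \<in> tensor_relations G"
    if keys: "Poly_Mapping.keys c \<subseteq> carrier G \<times> UNIV"
      and c0: "\<And>i. i < length rs \<Longrightarrow> tensor_eval (l (fst (rs ! i)) (snd (rs ! i))) c = 0" for c
  proof -
    from cong_tensor_poly[OF keys] obtain z where z: "c \<doteq> (\<Sum>j<s. tensor_poly (E j) (z j))" by blast
    have "tensor_poly (E j) (z j) \<doteq> 0" if j: "j < s" for j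
    proof -
      have "p j dvd z j"
      proof (rule rsquarefree_dvdI[OF p_rsquarefree[OF j]])
        fix \<zeta> assume \<zeta>: "poly (p j) \<zeta> = 0"
        then have "(j, \<zeta>) \<in> set rs" using j assms(2) by (simp add: spectrum_def)
        then obtain i where "i < length rs" "rs ! i = (j, \<zeta>)" by (auto simp: in_set_conv_nth)
        then have "tensor_eval (l j \<zeta>) c = 0" using c0[of i] by simp
        then show "poly (z j) \<zeta> = 0"
          using eval_cong[OF j \<zeta> z] ev[OF j \<zeta>] by simp
      qed
      then obtain w where "z j = p j * w" by (rule dvdE)
      then show ?thesis
        using tensor_poly_relation[of "E j" "cs j" "b j" w] E[OF j] rel[OF j] by (simp add: p_def)
    qed
    then have "(\<Sum>j<s. tensor_poly (E j) (z j)) \<doteq> (\<Sum>j<s. 0)"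
      by (intro tensor_cong_sum) simp
    with z have "c \<doteq> 0" by (auto intro: tensor_cong_trans)
    then show ?thesis by (simp add: tensor_cong_def)
  qed
  show "\<exists>c. Poly_Mapping.keys c \<subseteq> carrier G \<times> UNIV \<and>
      (\<forall>i<length rs. tensor_eval (l (fst (rs ! i)) (snd (rs ! i))) c = g i)" for g
  proof -
    \<comment> \<open>The target \<open>g\<close> is indexed by positions in \<open>rs\<close>;
      \<open>ix\<close> recovers the position of a tagged root, so that \<open>g\<close> becomes a
      prescription of values at the roots.\<close>
    define ix where "ix q = (SOME i. i < length rs \<and> rs ! i = q)" for q
    have ix: "ix (rs ! i) = i" if "i < length rs" for i
    proof -
      have "ix (rs ! i) < length rs \<and> rs ! ix (rs ! i) = rs ! i"
        unfolding ix_def by (rule someI[of _ i]) (use that in simp)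
      then show ?thesis using nth_eq_iff_index_eq[OF assms(1), of "ix (rs ! i)" i] that by blast
    qed
    have "\<exists>z. \<forall>\<zeta>\<in>{\<zeta>. poly (p j) \<zeta> = 0}. poly z \<zeta> = g (ix (j, \<zeta>))" if "j < s" for j
      using p_rsquarefree[OF that]
      by (intro interpolation_exists poly_roots_finite) (simp add: rsquarefree_def)
    then have "\<forall>j. \<exists>z. j < s \<longrightarrow> (\<forall>\<zeta>. poly (p j) \<zeta> = 0 \<longrightarrow> poly z \<zeta> = g (ix (j, \<zeta>)))"
      by auto
    from choice[OF this] obtain z
      where z: "\<And>j \<zeta>. j < s \<Longrightarrow> poly (p j) \<zeta> = 0 \<Longrightarrow> poly (z j) \<zeta> = g (ix (j, \<zeta>))"
      by auto
    let ?c = "\<Sum>j<s. tensor_poly (E j) (z j)"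
    have "Poly_Mapping.keys ?c \<subseteq> carrier G \<times> UNIV"
      using keys_sum[of "\<lambda>j. tensor_poly (E j) (z j)" "{..<s}"] tensor_poly_keys[OF E] by fastforce
    moreover have "tensor_eval (l (fst (rs ! i)) (snd (rs ! i))) ?c = g i" if "i < length rs" for i
      using rs[OF that] z[OF rs[OF that]] ix[OF that] by (simp add: ev)
    ultimately show ?thesis by blast
  qed
qed

theorem tensor_endo_det_poly:
  assumes f: "\<And>x. x \<in> carrier G \<Longrightarrow> f x \<in> carrier G"
    and lf: "\<And>j \<zeta> x. j < s \<Longrightarrow> poly (p j) \<zeta> = 0 \<Longrightarrow> x \<in> carrier G \<Longrightarrow> l j \<zeta> (f x) = \<zeta> * l j \<zeta> x"
  shows "vectorspace.fin_dim class_ring (tensor_complex G)"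
    and "endo_det_poly (tensor_complex G) (tensor_map G (\<lambda>(a, z). (f a, z)))
      = (\<Prod>j<s. \<Prod>\<zeta> | poly (p j) \<zeta> = 0. [:\<zeta>, -1:])"
proof -
  obtain rs where rs: "distinct rs" "set rs = spectrum"
    using finite_distinct_list[OF finite_spectrum] by blast
  interpret T: tensor_coordinates G "\<lambda>i. l (fst (rs ! i)) (snd (rs ! i))" "length rs"
    by (rule tensor_coordinates_spectrum[OF rs])
  show "vectorspace.fin_dim class_ring (tensor_complex G)"
    by (rule T.tensor.fin_dim)
  note rsm = nth_spectrum[OF rs(2)]
  have "endo_det_poly (tensor_complex G) (tensor_map G (\<lambda>(a, z). (f a, z)))
      = (\<Prod>i<length rs. [:snd (rs ! i), -1:])"
    by (rule T.endo_det_poly_tensor_map) (auto intro: f lf rsm)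
  also have "\<dots> = (\<Prod>q\<in>spectrum. [:snd q, -1:])"
    using bij_betw_nth[OF rs(1) HOL.refl HOL.refl] rs(2) by (intro prod.reindex_bij_betw) simp
  also have "\<dots> = (\<Prod>j<s. \<Prod>\<zeta> | poly (p j) \<zeta> = 0. [:\<zeta>, -1:])"
    unfolding spectrum_def
    using p_rsquarefree by (subst prod.Sigma) (auto simp: rsquarefree_def poly_roots_finite case_prod_unfold)
  finally show "endo_det_poly (tensor_complex G) (tensor_map G (\<lambda>(a, z). (f a, z)))
      = (\<Prod>j<s. \<Prod>\<zeta> | poly (p j) \<zeta> = 0. [:\<zeta>, -1:])" .
qed

end

section \<open>Free groups\<close>

definition words :: "'a set \<Rightarrow> 'a word set" where
  "words S = lists (S \<times> UNIV)"

lemma words_simps [simp]: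
  "[] \<in> words S"
  "p # u \<in> words S \<longleftrightarrow> fst p \<in> S \<and> u \<in> words S"
  "u @ v \<in> words S \<longleftrightarrow> u \<in> words S \<and> v \<in> words S"
  by (cases p; auto simp: words_def)+

lemmas free_equiv_intros = free_equiv.intros[folded words_def]

definition word_inv :: "'a word \<Rightarrow> 'a word" where
  "word_inv u = rev (map (\<lambda>(a, e). (a, \<not> e)) u)"

lemma free_equiv_words:
  assumes "free_equiv S u v"
  shows "u \<in> words S" "v \<in> words S"
  using assms by (induction) (auto simp: words_def)

lemma free_equiv_context:
  assumes "free_equiv S u v" "x \<in> words S" "y \<in> words S"
  shows "free_equiv S (x @ u @ y) (x @ v @ y)"
  using assms
proof (induction rule: free_equiv.induct)
  case (cancel u v a e)
  show ?case
    using free_equiv_intros(4)[of "x @ u" S "v @ y" a e] cancel[folded words_def]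
    by simp
next
  case (refl u)
  note refl[folded words_def]
  then show ?case by (intro free_equiv_intros(1)) simp
next
  case (sym u v)
  then show ?case by (blast intro: free_equiv.sym)
next
  case (trans u v w)
  then show ?case by (blast intro: free_equiv.trans)
qed

lemma free_equiv_append:
  assumes "free_equiv S u u'" "free_equiv S v v'"
  shows "free_equiv S (u @ v) (u' @ v')"
proof (rule free_equiv.trans)
  show "free_equiv S (u @ v) (u' @ v)"
    using free_equiv_context[OF assms(1), of "[]" v] free_equiv_words[OF assms(2)] by simp
  show "free_equiv S (u' @ v) (u' @ v')"
    using free_equiv_context[OF assms(2), of u' "[]"] free_equiv_words[OF assms(1)] by simp
qed

lemma free_class_eq_iff:
  assumes "u \<in> words S"
  shows "free_class S u = free_class S v \<longleftrightarrow> free_equiv S u v"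
proof
  assume "free_class S u = free_class S v"
  then show "free_equiv S u v"
    using free_equiv_intros(1)[OF assms] by (auto simp: free_class_def intro: free_equiv.sym)
next
  assume "free_equiv S u v"
  then show "free_class S u = free_class S v"
    unfolding free_class_def by (blast intro: free_equiv.sym free_equiv.trans)
qed

lemma mem_free_class_self: "u \<in> words S \<Longrightarrow> u \<in> free_class S u"
  by (simp add: free_class_def free_equiv_intros(1))

text \<open>The multiplication is a union over all pairs of representatives; it collapses to one
  class because every pair yields the same one.\<close>

lemma free_group_mult:
  assumes "u \<in> words S" "v \<in> words S"
  shows "free_class S u \<otimes>\<^bsub>free_group S\<^esub> free_class S v = free_class S (u @ v)"
proof -
  have "free_class S (u' @ v') = free_class S (u @ v)"
    if "u' \<in> free_class S u" "v' \<in> free_class S v" for u' v'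
  proof -
    have "free_equiv S (u @ v) (u' @ v')"
      using that by (simp add: free_class_def free_equiv_append)
    then show ?thesis
      using assms by (metis words_simps(3) free_class_eq_iff)
  qed
  then have "(\<Union>u'\<in>free_class S u. \<Union>v'\<in>free_class S v. free_class S (u' @ v'))
    = (\<Union>u'\<in>free_class S u. \<Union>v'\<in>free_class S v. free_class S (u @ v))"
    by (metis (no_types, lifting) SUP_cong)
  then show ?thesis
    using mem_free_class_self[OF assms(1)] mem_free_class_self[OF assms(2)]
    by (auto simp: free_group_def)
qed

lemma free_group_carrier: "carrier (free_group S) = free_class S ` words S"
  by (simp add: free_group_def words_def)

lemma free_group_one: "\<one>\<^bsub>free_group S\<^esub> = free_class S []"
  by (simp add: free_group_def)

lemma word_inv_in_words: "u \<in> words S \<Longrightarrow> word_inv u \<in> words S"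
  by (induction u) (auto simp: word_inv_def)

lemma free_equiv_word_inv:
  assumes "u \<in> words S"
  shows "free_equiv S (word_inv u @ u) []"
  using assms
proof (induction u)
  case Nil
  then show ?case by (simp add: word_inv_def free_equiv_intros(1))
next
  case (Cons p u)
  obtain a e where p: "p = (a, e)" by (cases p)
  have "free_equiv S (word_inv u @ [(a, \<not> e), (a, \<not> \<not> e)] @ u) (word_inv u @ u)"
    using Cons.prems p by (intro free_equiv_intros(4) word_inv_in_words) auto
  moreover have "free_equiv S (word_inv u @ u) []"
    using Cons by simp
  ultimately show ?case
    by (simp add: word_inv_def p) (rule free_equiv.trans)
qed

lemma group_free_group: "group (free_group S)"
proof (rule groupI)
  fix x assume "x \<in> carrier (free_group S)"
  then obtain u where u: "u \<in> words S" "x = free_class S u"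
    by (auto simp: free_group_carrier)
  then show "\<exists>y\<in>carrier (free_group S). y \<otimes>\<^bsub>free_group S\<^esub> x = \<one>\<^bsub>free_group S\<^esub>"
    by (intro bexI[of _ "free_class S (word_inv u)"])
      (auto simp: free_group_mult word_inv_in_words free_group_one free_class_eq_iff
        free_equiv_word_inv free_group_carrier)
qed (auto simp: free_group_carrier free_group_one free_group_mult)

context group
begin

fun letter_eval :: "('s \<Rightarrow> 'a) \<Rightarrow> 's \<times> bool \<Rightarrow> 'a" where
  "letter_eval f (a, e) = (if e then f a else inv f a)"

definition word_eval :: "('s \<Rightarrow> 'a) \<Rightarrow> 's word \<Rightarrow> 'a" where
  "word_eval f u = foldr (\<lambda>p y. letter_eval f p \<otimes> y) u \<one>"

lemma word_eval_simps [simp]: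
  "word_eval f [] = \<one>"
  "word_eval f (p # u) = letter_eval f p \<otimes> word_eval f u"
  by (simp_all add: word_eval_def)

lemma letter_eval_closed:
  assumes "f \<in> S \<rightarrow> carrier G" "p \<in> S \<times> UNIV"
  shows "letter_eval f p \<in> carrier G"
  using assms by (cases p) auto

lemma word_eval_closed:
  assumes "f \<in> S \<rightarrow> carrier G" "u \<in> words S"
  shows "word_eval f u \<in> carrier G"
  using assms(2) by (induction u) (auto intro!: letter_eval_closed[OF assms(1)] simp: mem_Times_iff)

lemma word_eval_append:
  assumes "f \<in> S \<rightarrow> carrier G" "u \<in> words S" "v \<in> words S"
  shows "word_eval f (u @ v) = word_eval f u \<otimes> word_eval f v"
  using assms(2)
proof (induction u)
  case Nil
  then show ?case using word_eval_closed[OF assms(1,3)] by simp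
next
  case (Cons p u)
  then have "p \<in> S \<times> UNIV" "u \<in> words S" by (auto simp: mem_Times_iff)
  then show ?case
    using Cons.IH word_eval_closed[OF assms(1,3)] word_eval_closed[OF assms(1)]
      letter_eval_closed[OF assms(1)]
    by (simp add: m_assoc)
qed

lemma word_eval_equiv:
  assumes f: "f \<in> S \<rightarrow> carrier G" and "free_equiv S u v"
  shows "word_eval f u = word_eval f v"
  using assms(2)
proof (induction rule: free_equiv.induct)
  case (cancel u v a e)
  note cancel = cancel[folded words_def]
  then have fa: "f a \<in> carrier G" using f by auto
  have l: "[(a, e), (a, \<not> e)] \<in> words S" using cancel by auto
  have "word_eval f [(a, e), (a, \<not> e)] = \<one>"
    using fa by (cases e) auto
  with l show ?case
    using cancel word_eval_closed[OF f]
    by (simp add: word_eval_append[OF f] del: word_eval_simps append_Cons)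
qed auto

lemma free_group_lift:
  assumes f: "f \<in> S \<rightarrow> carrier G"
  obtains \<phi> where "\<phi> \<in> hom (free_group S) G"
    "\<And>u. u \<in> words S \<Longrightarrow> \<phi> (free_class S u) = word_eval f u"
proof
  define \<phi> where "\<phi> U = word_eval f (SOME u. u \<in> U)" for U
  show *: "\<phi> (free_class S u) = word_eval f u" if "u \<in> words S" for u
  proof -
    have "(SOME v. v \<in> free_class S u) \<in> free_class S u"
      using mem_free_class_self[OF that] by (rule someI)
    then show ?thesis
      unfolding \<phi>_def by (metis (mono_tags) f free_class_def mem_Collect_eq word_eval_equiv)
  qed
  show "\<phi> \<in> hom (free_group S) G"
    by (rule homI)
      (auto simp: free_group_carrier free_group_mult * word_eval_append[OF f]
        word_eval_closed[OF f])
qed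

lemma normal_closure_normal:
  assumes "R \<subseteq> carrier G"
  shows "normal_closure G R \<lhd> G"
  unfolding normal_closure_def
proof (rule normal_invI)
  let ?X = "{N. N \<lhd> G \<and> R \<subseteq> N}"
  \<comment> \<open>The whole group belongs to the family, so the intersection is taken over a
    nonempty set.\<close>
  have "carrier G \<in> ?X" using assms normal_self by simp
  then show "subgroup (\<Inter>?X) G"
    by (intro subgroups_Inter) (auto simp: normal_imp_subgroup)
  show "x \<otimes> h \<otimes> inv x \<in> \<Inter>?X" if "x \<in> carrier G" "h \<in> \<Inter>?X" for x h
    using that by (auto intro: normal.inv_op_closed2)
qed

lemma subset_normal_closure: "R \<subseteq> normal_closure G R"
  by (auto simp: normal_closure_def)

lemma normal_closure_subset: "N \<lhd> G \<Longrightarrow> R \<subseteq> N \<Longrightarrow> normal_closure G R \<subseteq> N"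
  by (auto simp: normal_closure_def)

end

section \<open>Groups graded by the integers\<close>

text \<open>The pair \<open>(k, v)\<close> stands for the affine map \<open>z \<mapsto> \<zeta>\<^sup>k z + v\<close>, and maps are composed from left
  to right.\<close>

definition affine_group :: "complex \<Rightarrow> (int \<times> complex) monoid" where
  "affine_group \<zeta> = \<lparr>carrier = UNIV,
    monoid.mult = (\<lambda>(k, v) (l, w). (k + l, \<zeta> powi l * v + w)), one = (0, 0)\<rparr>"

lemma affine_group_simps [simp]:
  "carrier (affine_group \<zeta>) = UNIV"
  "(k, v) \<otimes>\<^bsub>affine_group \<zeta>\<^esub> (l, w) = (k + l, \<zeta> powi l * v + w)"
  "\<one>\<^bsub>affine_group \<zeta>\<^esub> = (0, 0)"
  by (simp_all add: affine_group_def)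

lemma group_affine_group:
  assumes "\<zeta> \<noteq> 0"
  shows "group (affine_group \<zeta>)"
proof (rule groupI)
  fix x y z
  show "x \<otimes>\<^bsub>affine_group \<zeta>\<^esub> y \<otimes>\<^bsub>affine_group \<zeta>\<^esub> z
      = x \<otimes>\<^bsub>affine_group \<zeta>\<^esub> (y \<otimes>\<^bsub>affine_group \<zeta>\<^esub> z)"
    by (cases x; cases y; cases z) (simp add: power_int_add assms algebra_simps)
  show "\<exists>y\<in>carrier (affine_group \<zeta>). y \<otimes>\<^bsub>affine_group \<zeta>\<^esub> x = \<one>\<^bsub>affine_group \<zeta>\<^esub>"
    by (cases x, intro bexI[of _ "(- fst x, - (\<zeta> powi (- fst x) * snd x))"])
      (auto simp: power_int_minus assms)
  show "\<one>\<^bsub>affine_group \<zeta>\<^esub> \<otimes>\<^bsub>affine_group \<zeta>\<^esub> x = x"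
    by (cases x) simp
qed auto

lemma inv_affine_group:
  assumes "\<zeta> \<noteq> 0"
  shows "inv\<^bsub>affine_group \<zeta>\<^esub> (k, v) = (- k, - (\<zeta> powi (- k) * v))"
  by (rule group.inv_equality[OF group_affine_group[OF assms]])
    (auto simp: power_int_minus assms)

context group
begin

definition conj_by :: "'a \<Rightarrow> 'a \<Rightarrow> 'a" where
  "conj_by c g = inv c \<otimes> g \<otimes> c"

lemma conj_closed [simp]: "c \<in> carrier G \<Longrightarrow> g \<in> carrier G \<Longrightarrow> conj_by c g \<in> carrier G"
  by (simp add: conj_by_def)

lemma conj_one [simp]: "g \<in> carrier G \<Longrightarrow> conj_by \<one> g = g"
  by (simp add: conj_by_def)

lemma conj_of_one [simp]: "c \<in> carrier G \<Longrightarrow> conj_by c \<one> = \<one>"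
  by (simp add: conj_by_def)

lemma mult_inv_cancel:
  assumes "c \<in> carrier G" "g \<in> carrier G"
  shows "c \<otimes> (inv c \<otimes> g) = g" "inv c \<otimes> (c \<otimes> g) = g"
  using assms by (simp_all add: m_assoc[symmetric])

lemma conj_mult:
  assumes "c \<in> carrier G" "g \<in> carrier G" "h \<in> carrier G"
  shows "conj_by c (g \<otimes> h) = conj_by c g \<otimes> conj_by c h"
  using assms by (simp add: conj_by_def m_assoc mult_inv_cancel)

lemma conj_hom: "c \<in> carrier G \<Longrightarrow> conj_by c \<in> hom G G"
  by (rule homI) (simp_all add: conj_mult)

lemma conj_inv: "c \<in> carrier G \<Longrightarrow> g \<in> carrier G \<Longrightarrow> conj_by c (inv g) = inv (conj_by c g)"
  by (simp add: conj_by_def inv_mult_group m_assoc)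

lemma conj_conj:
  assumes "c \<in> carrier G" "d \<in> carrier G" "g \<in> carrier G"
  shows "conj_by d (conj_by c g) = conj_by (c \<otimes> d) g"
  using assms by (simp add: conj_by_def inv_mult_group m_assoc)

lemma conj_int_pow: "c \<in> carrier G \<Longrightarrow> g \<in> carrier G \<Longrightarrow> conj_by c (g [^] (k::int)) = conj_by c g [^] k"
  by (rule hom_int_pow[OF conj_hom]) auto

text \<open>Modulo commutators of conjugates of \<open>e\<close> this is \<open>q(h) e\<close>, where \<open>h\<close> is conjugation by \<open>x\<close> and \<open>q\<close>
  is the polynomial with coefficients \<open>cs\<close>.\<close>

primrec orbit_word :: "'a \<Rightarrow> 'a \<Rightarrow> int list \<Rightarrow> 'a" where
  "orbit_word x e [] = \<one>"
| "orbit_word x e (c # cs) = e [^] c \<otimes> conj_by x (orbit_word x e cs)"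

lemma orbit_word_closed:
  "x \<in> carrier G \<Longrightarrow> e \<in> carrier G \<Longrightarrow> orbit_word x e cs \<in> carrier G"
  by (induction cs) auto

end

lemma hom_orbit_word:
  assumes "group G" "group H" "\<phi> \<in> hom G H" "x \<in> carrier G" "e \<in> carrier G"
  shows "\<phi> (group.orbit_word G x e cs) = group.orbit_word H (\<phi> x) (\<phi> e) cs"
proof -
  interpret G: group G by fact
  interpret H: group H by fact
  interpret group_hom G H \<phi> using assms(3) by unfold_locales
  show ?thesis
    by (induction cs)
      (simp_all add: assms G.orbit_word_closed hom_int_pow G.conj_by_def H.conj_by_def)
qed

text \<open>Conjugation by \<open>(1, 0)\<close> multiplies a translation by \<open>\<zeta>\<close>,
  and powers of a translation multiply it by integers. The orbit word thus follows Horner's scheme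
  for the polynomial with coefficients \<open>cs\<close>.\<close>

lemma affine_orbit_word:
  assumes "\<zeta> \<noteq> 0"
  shows "group.orbit_word (affine_group \<zeta>) (1, 0) (0, v) cs
    = (0, poly (Poly (map of_int cs)) \<zeta> * v)"
proof -
  interpret group "affine_group \<zeta>" by (rule group_affine_group[OF assms])
  have nat: "(0, v) [^]\<^bsub>affine_group \<zeta>\<^esub> (k::nat) = (0, of_nat k * v)" for k
    by (induction k) (simp_all add: algebra_simps)
  have int: "(0, v) [^]\<^bsub>affine_group \<zeta>\<^esub> (k::int) = (0, of_int k * v)" for k
    by (cases k rule: int_cases2)
      (simp_all add: int_pow_int int_pow_neg nat inv_affine_group[OF assms])
  show ?thesis
    by (induction cs) (simp_all add: int conj_by_def inv_affine_group[OF assms] algebra_simps)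
qed

section \<open>The degree homomorphism, its kernel and the monodromy\<close>

locale graded_group = group G
  for G :: "('a, 'b) monoid_scheme" (structure) +
  fixes C :: "'a set" and \<nu> :: "'a \<Rightarrow> int"
  assumes C_carrier: "C \<subseteq> carrier G" and C_nonempty: "C \<noteq> {}"
    and C_generates: "carrier G \<subseteq> generate G C"
    and nu_hom: "\<nu> \<in> hom G integer_group"
    and nu_C: "\<And>c. c \<in> C \<Longrightarrow> \<nu> c = 1"
begin

sublocale nu: group_hom G integer_group \<nu>
  by (simp add: group_hom_def group_hom_axioms_def nu_hom is_group)

lemma nu_mult: "g \<in> carrier G \<Longrightarrow> h \<in> carrier G \<Longrightarrow> \<nu> (g \<otimes> h) = \<nu> g + \<nu> h"
  using nu.hom_mult by simp

lemma nu_inv: "g \<in> carrier G \<Longrightarrow> \<nu> (inv g) = - \<nu> g"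
  using nu.hom_inv by (simp add: inv_integer_group)

lemma nu_conj: "c \<in> carrier G \<Longrightarrow> g \<in> carrier G \<Longrightarrow> \<nu> (conj_by c g) = \<nu> g"
  by (simp add: conj_by_def nu_mult nu_inv)

definition N :: "'a set" where
  "N = {g \<in> carrier G. \<nu> g = 0}"

lemma N_kernel: "N = kernel G integer_group \<nu>"
  by (simp add: N_def kernel_def)

lemma N_carrier: "g \<in> N \<Longrightarrow> g \<in> carrier G"
  by (simp add: N_def)

text \<open>\<open>C_kernel\<close> rests on an arbitrarily chosen homomorphism with value 1 on
  \<open>C\<close>. Since \<open>C\<close> generates, that choice agrees with \<open>\<nu>\<close>
  on the carrier.\<close>

lemma C_kernel_eq: "C_kernel G C = N"
proof -
  let ?P = "\<lambda>\<mu>. \<mu> \<in> hom G integer_group \<and> (\<forall>x\<in>C. \<mu> x = 1)"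
  define \<mu> where "\<mu> = (SOME \<mu>. ?P \<mu>)"
  have "?P \<mu>"
    unfolding \<mu>_def by (rule someI[of ?P \<nu>]) (simp add: nu_hom nu_C)
  then have mu: "\<mu> \<in> hom G integer_group" "\<And>x. x \<in> C \<Longrightarrow> \<mu> x = 1" by auto
  interpret mu: group_hom G integer_group \<mu>
    by (simp add: group_hom_def group_hom_axioms_def mu is_group)
  have "\<mu> g = \<nu> g" if "g \<in> generate G C" for g
    using that
  proof (induction rule: generate.induct)
    case one
    then show ?case using mu.hom_one nu.hom_one by simp
  next
    case (incl h)
    then show ?case by (simp add: mu nu_C)
  next
    case (inv h)
    then have "h \<in> carrier G" using C_carrier by blast
    then show ?case using inv by (simp add: mu nu_C)
  next
    case (eng g h)
    then have "g \<in> carrier G" "h \<in> carrier G"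
      using generate_in_carrier[OF C_carrier] by auto
    then show ?case using eng by simp
  qed
  then have "\<mu> g = \<nu> g" if "g \<in> carrier G" for g using that C_generates by blast
  then show ?thesis
    unfolding C_kernel_def \<mu>_def[symmetric] N_def kernel_def by auto
qed

lemma N_normal: "N \<lhd> G"
  unfolding N_kernel by (rule nu.normal_kernel)

lemma N_subgroup: "subgroup N G"
  using N_normal by (rule normal_imp_subgroup)

definition D :: "'a set" where
  "D = derived G N"

lemma D_normal: "D \<lhd> G"
  unfolding D_def by (rule derived_is_normal[OF N_normal])

lemma D_subset: "D \<subseteq> N"
  unfolding D_def by (rule derived_incl[OF _ N_subgroup]) simp

definition A :: "'a set monoid" where
  "A = G\<lparr>carrier := N\<rparr> Mod D"

lemma A_eq: "C_kernel_ab G C = A"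
  by (simp add: C_kernel_ab_def C_kernel_eq A_def D_def)

lemma group_N: "group (G\<lparr>carrier := N\<rparr>)"
  using N_subgroup by (rule subgroup_imp_group)

lemma D_eq: "D = derived (G\<lparr>carrier := N\<rparr>) (carrier (G\<lparr>carrier := N\<rparr>))"
  using derived_consistent[OF _ N_subgroup, of N] by (simp add: D_def)

lemma D_normal_N: "D \<lhd> G\<lparr>carrier := N\<rparr>"
  unfolding D_eq by (rule group.derived_self_is_normal[OF group_N])

sublocale A: comm_group A
  unfolding A_def D_eq by (rule group.derived_quot_is_comm_group[OF group_N])

definition cls :: "'a \<Rightarrow> 'a set" where
  "cls g = D #> g"

lemma carrier_A: "carrier A = cls ` N"
  by (simp add: A_def carrier_FactGroup cls_def)

lemma cls_closed [simp]: "g \<in> N \<Longrightarrow> cls g \<in> carrier A"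
  by (simp add: carrier_A)

lemma cls_hom: "cls \<in> hom (G\<lparr>carrier := N\<rparr>) A"
proof -
  have "(\<lambda>a. D #>\<^bsub>G\<lparr>carrier := N\<rparr>\<^esub> a) = cls" by (simp add: cls_def fun_eq_iff)
  then show ?thesis
    using normal.r_coset_hom_Mod[OF D_normal_N] by (simp add: A_def)
qed

lemma N_closed [simp]:
  "\<one> \<in> N" "g \<in> N \<Longrightarrow> h \<in> N \<Longrightarrow> g \<otimes> h \<in> N" "g \<in> N \<Longrightarrow> inv g \<in> N"
  "c \<in> carrier G \<Longrightarrow> g \<in> N \<Longrightarrow> conj_by c g \<in> N"
  using N_subgroup by (auto simp: subgroup_def N_def nu_conj)

lemma cls_mult: "g \<in> N \<Longrightarrow> h \<in> N \<Longrightarrow> cls (g \<otimes> h) = cls g \<otimes>\<^bsub>A\<^esub> cls h"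
  using hom_mult[OF cls_hom, of g h] by simp

lemma cls_one: "cls \<one> = \<one>\<^bsub>A\<^esub>"
  using hom_one[OF cls_hom group_N A.is_group] by simp

lemma cls_inv: "g \<in> N \<Longrightarrow> cls (inv g) = inv\<^bsub>A\<^esub> (cls g)"
  by (rule A.inv_equality[symmetric]) (auto simp: cls_mult[symmetric] cls_one N_carrier)

lemma N_int_pow [simp]: "g \<in> N \<Longrightarrow> g [^] (k::int) \<in> N"
  using subgroup_int_pow_closed[OF N_subgroup] by simp

lemma cls_int_pow: "g \<in> N \<Longrightarrow> cls (g [^] (k::int)) = cls g [^]\<^bsub>A\<^esub> k"
  using hom_int_pow[OF cls_hom, of g k] group_N A.is_group
    int_pow_consistent[OF N_subgroup, of g k] by simp

lemma cls_conj_N: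
  assumes "g \<in> N" "h \<in> N"
  shows "cls (conj_by h g) = cls g"
proof -
  have "cls (conj_by h g) = inv\<^bsub>A\<^esub> cls h \<otimes>\<^bsub>A\<^esub> cls g \<otimes>\<^bsub>A\<^esub> cls h"
    using assms by (simp add: conj_by_def cls_mult cls_inv)
  also have "\<dots> = cls g"
    using assms A.m_comm[of "inv\<^bsub>A\<^esub> cls h" "cls g"] by (simp add: A.m_assoc)
  finally show ?thesis .
qed

text \<open>Elements of equal degree differ by a factor in \<open>N\<close>, and conjugation by
  \<open>N\<close> is trivial on the abelianisation. This is why the monodromy is independent of the
  chosen C-generator, and why a central element of degree \<open>n\<close> may stand in for
  \<open>x [^] n\<close>.\<close>

lemma cls_conj_cong:
  assumes "c \<in> carrier G" "d \<in> carrier G" "\<nu> c = \<nu> d" "g \<in> N"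
  shows "cls (conj_by c g) = cls (conj_by d g)"
proof -
  have b: "inv c \<otimes> d \<in> N" using assms by (simp add: N_def nu_mult nu_inv)
  have "conj_by d g = conj_by (inv c \<otimes> d) (conj_by c g)"
    using assms N_carrier by (simp add: conj_conj m_assoc[symmetric])
  then show ?thesis using cls_conj_N[OF _ b, of "conj_by c g"] assms by simp
qed

lemma conj_D: "c \<in> carrier G \<Longrightarrow> g \<in> D \<Longrightarrow> conj_by c g \<in> D"
  using normal.inv_op_closed1[OF D_normal] by (simp add: conj_by_def)

lemma D_carrier: "g \<in> D \<Longrightarrow> g \<in> carrier G"
  using D_subset N_carrier by blast

text \<open>The monodromy is defined elementwise on a coset. Its image is again a full coset because
  \<open>D\<close> is stable under conjugation by \<open>c\<close> and by its inverse.\<close>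

lemma cls_conj_image:
  assumes "c \<in> carrier G" "g \<in> N"
  shows "conj_by c ` cls g = cls (conj_by c g)"
proof
  have g: "g \<in> carrier G" using assms N_carrier by blast
  show "conj_by c ` cls g \<subseteq> cls (conj_by c g)"
    using assms g by (auto simp: cls_def r_coset_def conj_mult D_carrier intro: conj_D)
  show "cls (conj_by c g) \<subseteq> conj_by c ` cls g"
  proof
    fix y assume "y \<in> cls (conj_by c g)"
    then obtain k where k: "k \<in> D" "y = k \<otimes> conj_by c g" by (auto simp: cls_def r_coset_def)
    have "conj_by (inv c) k \<in> D" using assms(1) k(1) by (intro conj_D) auto
    moreover have "y = conj_by c (conj_by (inv c) k \<otimes> g)"
      using assms(1) g k D_carrier[OF k(1)] by (simp add: conj_mult conj_conj)
    ultimately show "y \<in> conj_by c ` cls g" by (auto simp: cls_def r_coset_def)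
  qed
qed

lemma C_monodromy_cls:
  assumes "c \<in> carrier G" "\<nu> c = 1" "g \<in> N"
  shows "C_monodromy G C (cls g) = cls (conj_by c g)"
proof -
  define x where "x = (SOME x. x \<in> C)"
  have "x \<in> C" unfolding x_def using C_nonempty by (simp add: some_in_eq)
  then have x: "x \<in> carrier G" "\<nu> x = 1" using C_carrier nu_C by auto
  have "C_monodromy G C (cls g) = conj_by x ` cls g"
    by (simp add: C_monodromy_def x_def[symmetric] conj_by_def)
  also have "\<dots> = cls (conj_by x g)" by (rule cls_conj_image[OF x(1) assms(3)])
  also have "\<dots> = cls (conj_by c g)" using assms x by (intro cls_conj_cong) auto
  finally show ?thesis .
qed

section \<open>Functionals on \<open>N/N'\<close> from affine representations\<close>

context
  fixes \<zeta> :: complex and \<phi> :: "'a \<Rightarrow> int \<times> complex"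
  assumes zeta: "\<zeta> \<noteq> 0" and phi: "\<phi> \<in> hom G (affine_group \<zeta>)"
    and fst_phi: "\<And>g. g \<in> carrier G \<Longrightarrow> fst (\<phi> g) = \<nu> g"
begin

lemma phi_N: "g \<in> N \<Longrightarrow> \<phi> g = (0, snd (\<phi> g))"
  using fst_phi by (simp add: N_def prod_eq_iff)

text \<open>In degree 0 the linear part is \<open>\<zeta> powi 0 = 1\<close>, so \<open>N\<close>
  acts by translations, and composed translations add.\<close>

lemma snd_phi_mult: "g \<in> N \<Longrightarrow> h \<in> N \<Longrightarrow> snd (\<phi> (g \<otimes> h)) = snd (\<phi> g) + snd (\<phi> h)"
  using hom_mult[OF phi, of g h] phi_N[of g] phi_N[of h] N_carrier
  by (metis affine_group_simps(2) mult_1 power_int_0_right snd_conv)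

lemma snd_phi_one: "snd (\<phi> \<one>) = 0"
  using snd_phi_mult[of \<one> \<one>] by simp

lemma snd_phi_inv: "g \<in> N \<Longrightarrow> snd (\<phi> (inv g)) = - snd (\<phi> g)"
  using snd_phi_mult[of "inv g" g] N_carrier by (simp add: snd_phi_one eq_neg_iff_add_eq_0)

lemma snd_phi_D:
  assumes "g \<in> D"
  shows "snd (\<phi> g) = 0"
proof -
  let ?K = "{g \<in> N. snd (\<phi> g) = 0}"
  have "subgroup ?K G"
    by (rule subgroup.intro) (auto simp: N_carrier snd_phi_mult snd_phi_one snd_phi_inv)
  moreover have "derived_set G N \<subseteq> ?K"
    by (auto simp: snd_phi_mult snd_phi_inv)
  ultimately have "derived G N \<subseteq> ?K"
    unfolding derived_def by (rule generate_subgroup_incl[rotated])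
  then show ?thesis using assms by (auto simp: D_def)
qed

text \<open>Any representative may be chosen: translation parts are additive on \<open>N\<close>,
  hence vanish on its commutator subgroup \<open>D\<close>.\<close>

definition functional :: "'a set \<Rightarrow> complex" where
  "functional K = snd (\<phi> (SOME g. g \<in> K))"

lemma functional_cls:
  assumes "g \<in> N"
  shows "functional (cls g) = snd (\<phi> g)"
proof -
  have "g \<in> cls g"
    unfolding cls_def by (rule rcos_self[OF N_carrier[OF assms] normal_imp_subgroup[OF D_normal]])
  then have "(SOME g'. g' \<in> cls g) \<in> cls g" by (rule someI)
  then obtain k where k: "k \<in> D" "(SOME g'. g' \<in> cls g) = k \<otimes> g"
    by (auto simp: cls_def r_coset_def)
  then show ?thesis
    using assms D_subset by (auto simp: functional_def snd_phi_mult snd_phi_D)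
qed

lemma functional_mult:
  assumes "a \<in> carrier A" "b \<in> carrier A"
  shows "functional (a \<otimes>\<^bsub>A\<^esub> b) = functional a + functional b"
  using assms by (auto simp: carrier_A functional_cls snd_phi_mult simp flip: cls_mult)

text \<open>Conjugating a translation by an affine map rescales it by the linear part. For degree 1
  this makes the functional an eigenvector of the dual monodromy with eigenvalue
  \<open>\<zeta>\<close>.\<close>

lemma snd_phi_conj:
  assumes "c \<in> carrier G" "g \<in> N"
  shows "snd (\<phi> (conj_by c g)) = \<zeta> powi (\<nu> c) * snd (\<phi> g)"
proof -
  interpret phi: group_hom G "affine_group \<zeta>" \<phi>
    by (simp add: group_hom_def group_hom_axioms_def phi is_group group_affine_group[OF zeta])
  have c: "\<phi> c = (\<nu> c, snd (\<phi> c))" using fst_phi[OF assms(1)] by (simp add: prod_eq_iff)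
  have "\<phi> (conj_by c g) = inv\<^bsub>affine_group \<zeta>\<^esub> (\<nu> c, snd (\<phi> c)) \<otimes>\<^bsub>affine_group \<zeta>\<^esub> (0, snd (\<phi> g))
      \<otimes>\<^bsub>affine_group \<zeta>\<^esub> (\<nu> c, snd (\<phi> c))"
    using assms N_carrier[OF assms(2)] c phi_N[OF assms(2)] by (simp add: conj_by_def)
  also have "snd \<dots> = \<zeta> powi (\<nu> c) * snd (\<phi> g)"
    using zeta by (simp add: inv_affine_group power_int_minus algebra_simps)
  finally show ?thesis .
qed

lemma functional_monodromy:
  assumes "a \<in> carrier A"
  shows "functional (C_monodromy G C a) = \<zeta> * functional a"
proof -
  obtain g where g: "g \<in> N" "a = cls g" using assms by (auto simp: carrier_A)
  obtain c where "c \<in> C" using C_nonempty by blast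
  then have c: "c \<in> carrier G" "\<nu> c = 1" using C_carrier nu_C by auto
  show ?thesis
    using g c by (simp add: C_monodromy_cls functional_cls snd_phi_conj)
qed

end

lemma C_monodromy_closed:
  assumes "a \<in> carrier A"
  shows "C_monodromy G C a \<in> carrier A"
proof -
  obtain g where g: "g \<in> N" "a = cls g" using assms by (auto simp: carrier_A)
  obtain c where "c \<in> C" using C_nonempty by blast
  then have c: "c \<in> carrier G" "\<nu> c = 1" using C_carrier nu_C by auto
  show ?thesis using g c by (simp add: C_monodromy_cls)
qed

end

lemma (in group) generate_hom_eqI:
  assumes "group H" "f \<in> hom G H" "g \<in> hom G H" "S \<subseteq> carrier G"
    and eq: "\<And>x. x \<in> S \<Longrightarrow> f x = g x" and "y \<in> generate G S"
  shows "f y = g y"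
proof -
  interpret f: group_hom G H f using assms by (simp add: group_hom_def group_hom_axioms_def is_group)
  interpret g: group_hom G H g using assms by (simp add: group_hom_def group_hom_axioms_def is_group)
  from assms(6) show ?thesis
  proof (induction rule: generate.induct)
    case (inv h)
    then have "h \<in> carrier G" using assms(4) by blast
    then show ?case using eq[OF inv] by simp
  next
    case (eng h1 h2)
    then have "h1 \<in> carrier G" "h2 \<in> carrier G"
      using generate_in_carrier[OF assms(4)] by auto
    then show ?case using eng by simp
  qed (simp_all add: eq)
qed

lemma fst_affine_hom: "fst \<in> hom (affine_group \<zeta>) integer_group"
  by (rule homI) auto

section \<open>From relations and affine representations to the Alexander polynomial\<close>

text \<open>The presentation enters only through its consequences. Generation, the central element
  and \<open>relation\<close> say that \<open>N/N'\<close> is not too large;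
  \<open>affine_rep\<close> says that nothing else collapses.\<close>

locale cyclic_relations = graded_group +
  fixes s n :: nat and x :: 'a and y :: "nat \<Rightarrow> 'a" and z :: 'a
    and b :: "nat \<Rightarrow> int" and cs :: "nat \<Rightarrow> int list"
    and W :: "nat \<Rightarrow> 'a" and p :: "nat \<Rightarrow> complex poly"
  defines "W \<equiv> \<lambda>j. orbit_word x (inv x \<otimes> y j) (cs j)"
    and "p \<equiv> \<lambda>j. [:of_int (b j):] + [:1, -1:] * Poly (map of_int (cs j))"
  assumes x: "x \<in> carrier G" "\<nu> x = 1"
    and y: "\<And>j. j < s \<Longrightarrow> y j \<in> carrier G" "\<And>j. j < s \<Longrightarrow> \<nu> (y j) = 1"
    and xy_generate: "carrier G \<subseteq> generate G (insert x (y ` {..<s}))"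
    and z: "z \<in> carrier G" "\<nu> z = int n" "n > 0"
    and central: "\<And>g. g \<in> carrier G \<Longrightarrow> z \<otimes> g = g \<otimes> z"
    and b: "\<And>j. j < s \<Longrightarrow> b j \<in> {0, 1}"
    and relation: "\<And>j. j < s \<Longrightarrow> W j \<otimes> (if b j = 0 then y j else x) = y j \<otimes> W j"
    and p_rsquarefree: "\<And>j. j < s \<Longrightarrow> rsquarefree (p j)"
    and p_nonzero: "\<And>j. j < s \<Longrightarrow> poly (p j) 0 \<noteq> 0"
    and affine_rep: "\<And>j \<zeta>. j < s \<Longrightarrow> poly (p j) \<zeta> = 0 \<Longrightarrow>
      \<exists>\<phi>\<in>hom G (affine_group \<zeta>). \<phi> x = (1, 0) \<and> (\<forall>i<s. \<phi> (y i) = (1, if i = j then 1 else 0))"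
begin

definition e :: "nat \<Rightarrow> 'a" where
  "e j = inv x \<otimes> y j"

lemma e: "j < s \<Longrightarrow> e j \<in> N"
  by (simp add: e_def N_def x y nu_mult nu_inv)

lemma W_N: "j < s \<Longrightarrow> W j \<in> N"
proof -
  assume j: "j < s"
  have "orbit_word x (e j) c \<in> N" for c
    by (induction c) (auto simp: e[OF j] x)
  then show ?thesis by (simp add: W_def e_def)
qed

definition E :: "nat \<Rightarrow> nat \<Rightarrow> 'a set" where
  "E j k = cls (conj_by (x [^] k) (e j))"

lemma E_closed: "j < s \<Longrightarrow> E j k \<in> carrier A"
  by (simp add: E_def e x)

lemma x_pow_comm: "x \<otimes> x [^] (k::nat) = x [^] k \<otimes> x"
  using nat_pow_Suc2[OF x(1), of k] by simp

text \<open>Each nested conjugation by \<open>x\<close> in the orbit word raises the exponent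
  \<open>k\<close> by one, which matches the shift of the index in \<open>A.lincomb\<close>.\<close>

lemma cls_conj_pow_orbit_word:
  assumes "j < s"
  shows "cls (conj_by (x [^] k) (orbit_word x (e j) c)) = A.lincomb (E j) k c"
proof (induction c arbitrary: k)
  case Nil
  then show ?case by (simp add: x cls_one)
next
  case (Cons a c)
  have ow: "orbit_word x (e j) c \<in> N" for c
    by (induction c) (auto simp: e[OF assms] x)
  have "conj_by (x [^] k) (orbit_word x (e j) (a # c))
      = conj_by (x [^] k) (e j) [^] a \<otimes> conj_by (x [^] Suc k) (orbit_word x (e j) c)"
    using e[OF assms] x ow[of c] N_carrier
    by (simp add: conj_mult conj_int_pow conj_conj x_pow_comm)
  then show ?case
    using e[OF assms] x ow[of c] Cons.IH[of "Suc k"]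
    by (simp add: cls_mult cls_int_pow E_def del: nat_pow_Suc)
qed

text \<open>Substitute \<open>y j = x \<otimes> e j\<close>. If \<open>b j = 0\<close>, the relation
  says that conjugation by \<open>x\<close> turns \<open>W j\<close> into its conjugate
  \<open>e j \<otimes> W j \<otimes> inv (e j)\<close>; if \<open>b j = 1\<close>, into
  \<open>e j \<otimes> W j\<close>. In the abelian quotient both read: \<open>W j\<close> is
  multiplied by \<open>e j\<close> to the power \<open>b j\<close>. Conjugating by
  \<open>x [^] k\<close> moves this to index \<open>k\<close>.\<close>

lemma E_relation:
  assumes j: "j < s"
  shows "A.lincomb (E j) (Suc k) (cs j) = E j k [^]\<^bsub>A\<^esub> b j \<otimes>\<^bsub>A\<^esub> A.lincomb (E j) k (cs j)"
proof -
  note N = e[OF j] W_N[OF j]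
  note carr = N[THEN N_carrier] x(1) y(1)[OF j]
  have y_eq: "y j = x \<otimes> e j" using carr by (simp add: e_def mult_inv_cancel)
  have "conj_by x (W j) = (if b j = 0 then e j \<otimes> W j \<otimes> inv (e j) else e j \<otimes> W j)"
  proof (cases "b j = 0")
    case True
    then have "W j \<otimes> (x \<otimes> e j) = x \<otimes> e j \<otimes> W j" using relation[OF j] y_eq by simp
    then have "inv x \<otimes> (W j \<otimes> (x \<otimes> e j)) \<otimes> inv (e j) = inv x \<otimes> (x \<otimes> e j \<otimes> W j) \<otimes> inv (e j)"
      by simp
    then show ?thesis using True carr by (simp add: conj_by_def m_assoc mult_inv_cancel)
  next
    case False
    then have "W j \<otimes> x = x \<otimes> e j \<otimes> W j" using relation[OF j] y_eq by simp
    then have "inv x \<otimes> (W j \<otimes> x) = inv x \<otimes> (x \<otimes> e j \<otimes> W j)" by simp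
    then show ?thesis using False carr by (simp add: conj_by_def m_assoc mult_inv_cancel)
  qed
  then have "conj_by (x [^] Suc k) (W j)
      = conj_by (x [^] k) (if b j = 0 then e j \<otimes> W j \<otimes> inv (e j) else e j \<otimes> W j)"
    using carr conj_conj[of x "x [^] k" "W j"] by (simp add: x_pow_comm)
  then have "cls (conj_by (x [^] Suc k) (W j))
      = (if b j = 0 then E j k \<otimes>\<^bsub>A\<^esub> cls (conj_by (x [^] k) (W j)) \<otimes>\<^bsub>A\<^esub> inv\<^bsub>A\<^esub> E j k
         else E j k \<otimes>\<^bsub>A\<^esub> cls (conj_by (x [^] k) (W j)))"
    using N carr by (simp add: conj_mult conj_inv cls_mult cls_inv E_def del: nat_pow_Suc)
  also have "\<dots> = E j k [^]\<^bsub>A\<^esub> b j \<otimes>\<^bsub>A\<^esub> cls (conj_by (x [^] k) (W j))"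
  proof -
    have "E j k \<in> carrier A" "cls (conj_by (x [^] k) (W j)) \<in> carrier A"
      using E_closed[OF j] N carr by simp_all
    then show ?thesis using b[OF j]
      by (cases "b j = 0") (simp_all add: A.m_ac A.int_pow_1 A.mult_inv_cancel)
  qed
  finally show ?thesis
    unfolding W_def e_def[symmetric] cls_conj_pow_orbit_word[OF j] .
qed

text \<open>The central element \<open>z\<close> has degree \<open>n > 0\<close>, so conjugation by \<open>x\<close> has finite order on
  \<open>N/N'\<close>; hence no negative powers of it are needed to generate.\<close>

lemma cls_conj_period:
  assumes "g \<in> N"
  shows "cls (conj_by (x [^] (k + int n * m)) g) = cls (conj_by (x [^] (k::int)) g)"
proof -
  have zm: "z [^] m \<otimes> h = h \<otimes> z [^] m" if "h \<in> carrier G" for h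
  proof -
    have "conj_by h (z [^] m) = conj_by h z [^] m" using that z by (simp add: conj_int_pow)
    also have "conj_by h z = z" using that z by (simp add: conj_by_def m_assoc central mult_inv_cancel)
    finally have "inv h \<otimes> z [^] m \<otimes> h = z [^] m" by (simp add: conj_by_def)
    then have "h \<otimes> (inv h \<otimes> z [^] m \<otimes> h) = h \<otimes> z [^] m" by simp
    then show ?thesis using that z by (simp add: m_assoc mult_inv_cancel)
  qed
  have g: "g \<in> carrier G" using assms by (rule N_carrier)
  \<comment> \<open>Both conjugators have degree \<open>k + n m\<close>, so they act alike on
    classes; the factor \<open>z [^] m\<close> is central and acts trivially.\<close>
  have "cls (conj_by (x [^] (k + int n * m)) g) = cls (conj_by (z [^] m \<otimes> x [^] k) g)"
    using x z assms by (intro cls_conj_cong) (simp_all add: nu_mult nu.hom_int_pow)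
  also have "conj_by (z [^] m) g = g"
    using g z by (simp add: conj_by_def m_assoc mult_inv_cancel flip: zm)
  then have "conj_by (z [^] m \<otimes> x [^] k) g = conj_by (x [^] k) g"
    using g x z by (simp flip: conj_conj)
  finally show ?thesis .
qed

definition gens :: "'a set set" where
  "gens = {E j k | j k. j < s}"

lemma E_gens: "j < s \<Longrightarrow> E j k \<in> gens"
  by (auto simp: gens_def)

lemma gens_closed: "gens \<subseteq> carrier A"
  using E_closed by (auto simp: gens_def)

text \<open>The preimage in \<open>N\<close> of the subgroup of \<open>A\<close> generated by
  nonnegative shifts of the \<open>e j\<close>; the aim is that it is all of
  \<open>N\<close>.\<close>

definition S :: "'a set" where
  "S = {g \<in> N. cls g \<in> generate A gens}"

lemma S_subgroup: "subgroup S G"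
proof (rule subgroup.intro)
  show "S \<subseteq> carrier G" by (auto simp: S_def N_carrier)
  show "\<one> \<in> S" by (auto simp: S_def cls_one intro: generate.one)
  show "g \<otimes> h \<in> S" if "g \<in> S" "h \<in> S" for g h
    using that by (auto simp: S_def cls_mult intro: generate.eng)
  show "inv g \<in> S" if "g \<in> S" for g
    using that by (auto simp: S_def cls_inv intro: A.generate_m_inv_closed[OF gens_closed])
qed

lemma E_Suc:
  assumes "j < s" "g \<in> N" "cls g = E j k"
  shows "cls (conj_by x g) = E j (Suc k)"
proof -
  have "cls (conj_by x g) = C_monodromy G C (cls g)"
    by (rule C_monodromy_cls[OF x assms(2), symmetric])
  also have "\<dots> = cls (conj_by x (conj_by (x [^] k) (e j)))"
    unfolding assms(3) E_def using x e[OF assms(1)] by (intro C_monodromy_cls) auto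
  also have "\<dots> = E j (Suc k)"
    using x e[OF assms(1), THEN N_carrier] by (simp add: conj_conj E_def)
  finally show ?thesis .
qed

text \<open>The induction runs over generated classes in \<open>A\<close>, so the claim is made for
  every representative of a class; the monodromy guarantees that the choice is immaterial.\<close>

lemma S_conj: "g \<in> S \<Longrightarrow> conj_by x g \<in> S"
proof -
  have "\<And>g. g \<in> N \<Longrightarrow> cls g = a \<Longrightarrow> cls (conj_by x g) \<in> generate A gens"
    if "a \<in> generate A gens" for a
    using that
  proof (induction rule: generate.induct)
    case one
    then have "cls (conj_by x g) = C_monodromy G C (cls \<one>)"
      using x C_monodromy_cls[of x g] cls_one by simp
    also have "\<dots> = cls (conj_by x \<one>)" using x by (intro C_monodromy_cls) auto
    also have "\<dots> = \<one>\<^bsub>A\<^esub>" using x by (simp add: cls_one)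
    finally show ?case by (simp add: generate.one)
  next
    case (incl h)
    then obtain j k where "h = E j k" "j < s" by (auto simp: gens_def)
    then show ?case using incl E_Suc[of j g k] E_gens by (simp add: generate.incl)
  next
    case (inv h)
    then obtain j k where h: "h = E j k" "j < s" by (auto simp: gens_def)
    \<comment> \<open>Here \<open>g\<close> represents the inverse of a generator, so
      \<open>E_Suc\<close> is applied to \<open>inv g\<close> and the result inverted.\<close>
    have "cls (inv g) = h"
      using inv h E_closed by (simp add: cls_inv)
    then have "cls (conj_by x (inv g)) = E j (Suc k)"
      using h inv by (intro E_Suc) auto
    then have "inv\<^bsub>A\<^esub> cls (conj_by x g) = E j (Suc k)"
      using x inv N_carrier by (simp add: conj_inv cls_inv)
    then have "cls (conj_by x g) = inv\<^bsub>A\<^esub> E j (Suc k)"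
      using x inv by (metis A.inv_inv N_closed(4) cls_closed)
    then show ?case using h E_gens by (simp add: generate.inv)
  next
    case (eng h1 h2)
    then have "h1 \<in> carrier A" "h2 \<in> carrier A"
      using A.generate_in_carrier[OF gens_closed] by auto
    then obtain g1 g2 where g12: "g1 \<in> N" "cls g1 = h1" "g2 \<in> N" "cls g2 = h2"
      by (auto simp: carrier_A)
    have "cls (conj_by x g) = C_monodromy G C (cls (g1 \<otimes> g2))"
      using eng.prems g12 x C_monodromy_cls[of x g] by (simp add: cls_mult)
    also have "\<dots> = cls (conj_by x (g1 \<otimes> g2))"
      using g12 x by (intro C_monodromy_cls) auto
    also have "\<dots> = cls (conj_by x g1) \<otimes>\<^bsub>A\<^esub> cls (conj_by x g2)"
      using g12 x N_carrier by (simp add: conj_mult cls_mult)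
    finally show ?case
      using eng.IH(1)[OF g12(1,2)] eng.IH(2)[OF g12(3,4)] by (auto intro: generate.eng)
  qed
  then show "g \<in> S \<Longrightarrow> conj_by x g \<in> S" using x by (auto simp: S_def)
qed

lemma S_conj_int_pow:
  assumes "g \<in> S"
  shows "conj_by (x [^] (k::int)) g \<in> S"
proof -
  have nat: "conj_by (x [^] (k::nat)) g \<in> S" for k
  proof (induction k)
    case (Suc k)
    have "conj_by (x [^] Suc k) g = conj_by x (conj_by (x [^] k) g)"
      using assms x by (auto simp: S_def N_carrier conj_conj)
    then show ?case using S_conj[OF Suc] by simp
  qed (use assms S_def N_carrier in auto)
  have gN: "g \<in> N" using assms by (simp add: S_def)
  \<comment> \<open>Adding the multiple \<open>n \<bar>k\<bar>\<close> of the period makes the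
    exponent nonnegative, as \<open>n \<ge> 1\<close>.\<close>
  define l where "l = nat (k + int n * \<bar>k\<bar>)"
  have "\<bar>k\<bar> * 1 \<le> \<bar>k\<bar> * int n" using z(3) by (intro mult_left_mono) auto
  then have l: "int l = k + int n * \<bar>k\<bar>" by (simp add: l_def mult.commute)
  have "cls (conj_by (x [^] k) g) = cls (conj_by (x [^] int l) g)"
    unfolding l by (rule cls_conj_period[OF gN, symmetric])
  then show ?thesis
    using nat[of l] gN x by (simp add: S_def int_pow_int)
qed

text \<open>The products of a power of \<open>x\<close> with an element of \<open>S\<close> form a
  subgroup containing \<open>x\<close> and every \<open>y j = x \<otimes> e j\<close>, hence
  everything. In degree 0 the power of \<open>x\<close> disappears.\<close>

lemma N_eq_S: "N \<subseteq> S"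
proof
  define M where "M = {x [^] (k::int) \<otimes> g | k g. g \<in> S}"
  have S_carrier: "g \<in> S \<Longrightarrow> g \<in> carrier G" for g by (auto simp: S_def N_carrier)
  have M_mult: "g \<otimes> h \<in> M" if gh: "g \<in> M" "h \<in> M" for g h
  proof -
    obtain k g' l h' where *: "g = x [^] (k::int) \<otimes> g'" "g' \<in> S" "h = x [^] (l::int) \<otimes> h'" "h' \<in> S"
      using gh by (auto simp: M_def)
    \<comment> \<open>Moving the second power of \<open>x\<close> to the left conjugates
      \<open>g'\<close>; this is where stability of \<open>S\<close> under integer powers of
      \<open>x\<close> is used.\<close>
    have "g \<otimes> h = x [^] (k + l) \<otimes> (conj_by (x [^] l) g' \<otimes> h')"
      using * x S_carrier by (simp add: conj_by_def int_pow_mult m_assoc mult_inv_cancel)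
    moreover have "conj_by (x [^] l) g' \<otimes> h' \<in> S"
      using * S_conj_int_pow S_subgroup by (simp add: subgroup.m_closed)
    ultimately show ?thesis by (auto simp: M_def)
  qed
  have M_inv: "inv g \<in> M" if g: "g \<in> M" for g
  proof -
    obtain k g' where *: "g = x [^] (k::int) \<otimes> g'" "g' \<in> S" using g by (auto simp: M_def)
    have "inv g = x [^] (- k) \<otimes> conj_by (x [^] (- k)) (inv g')"
      using * x S_carrier
      by (simp add: conj_by_def inv_mult_group m_assoc mult_inv_cancel int_pow_neg)
    moreover have "conj_by (x [^] (- k)) (inv g') \<in> S"
      using * S_conj_int_pow S_subgroup by (simp add: subgroup.m_inv_closed)
    ultimately show ?thesis by (auto simp: M_def)
  qed
  have one: "\<one> \<in> S" using S_subgroup by (rule subgroup.one_closed)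
  have xM: "x \<in> M"
    unfolding M_def using one x by (auto intro!: exI[of _ 1] exI[of _ \<one>] simp: int_pow_1)
  have yM: "y j \<in> M" if "j < s" for j
  proof -
    have "cls (e j) = E j 0" using e[OF that] N_carrier by (simp add: E_def)
    then have "e j \<in> S" using e[OF that] E_gens[OF that] by (simp add: S_def generate.incl)
    moreover have "y j = x [^] (1::int) \<otimes> e j"
      using x y[OF that] by (simp add: e_def mult_inv_cancel int_pow_1)
    ultimately show ?thesis by (auto simp: M_def)
  qed
  have "g \<in> M" if "g \<in> generate G (insert x (y ` {..<s}))" for g
    using that
  proof (induction rule: generate.induct)
    case one
    then show ?case using \<open>\<one> \<in> S\<close> by (auto simp: M_def intro!: exI[of _ 0] exI[of _ \<one>])
  qed (use xM yM M_inv M_mult in auto)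
  then have all: "g \<in> M" if "g \<in> carrier G" for g using that xy_generate by blast
  fix g assume g: "g \<in> N"
  then obtain k g' where *: "g = x [^] (k::int) \<otimes> g'" "g' \<in> S"
    using all[OF N_carrier[OF g]] unfolding M_def by blast
  have "\<nu> g = k"
    using * x S_carrier[OF *(2)] by (simp add: nu_mult nu.hom_int_pow S_def N_def)
  then have "g = g'" using g * x S_carrier by (simp add: N_def)
  then show "g \<in> S" using * by simp
qed

lemma carrier_A_generate: "carrier A \<subseteq> generate A gens"
  using N_eq_S by (auto simp: carrier_A S_def)

theorem alexander_polynomial_eq:
  "alexander_polynomial G C = (\<Prod>j<s. \<Prod>\<zeta> | poly (p j) \<zeta> = 0. [:\<zeta>, -1:])"
proof -
  define \<phi> where "\<phi> j \<zeta> = (SOME \<phi>. \<phi> \<in> hom G (affine_group \<zeta>) \<and> \<phi> x = (1, 0) \<and>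
    (\<forall>i<s. \<phi> (y i) = (1, if i = j then 1 else 0)))" for j \<zeta>
  define l where "l j \<zeta> = functional (\<phi> j \<zeta>)" for j \<zeta>
  have phi: "\<phi> j \<zeta> \<in> hom G (affine_group \<zeta>)" "\<phi> j \<zeta> x = (1, 0)"
      "\<And>i. i < s \<Longrightarrow> \<phi> j \<zeta> (y i) = (1, if i = j then 1 else 0)"
    if "j < s" "poly (p j) \<zeta> = 0" for j \<zeta>
    using someI_ex[of "\<lambda>\<phi>. \<phi> \<in> hom G (affine_group \<zeta>) \<and> \<phi> x = (1, 0) \<and>
      (\<forall>i<s. \<phi> (y i) = (1, if i = j then 1 else 0))"] affine_rep[OF that]
    unfolding \<phi>_def[symmetric] by blast+
  have nonzero: "\<zeta> \<noteq> 0" if "j < s" "poly (p j) \<zeta> = 0" for j \<zeta>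
    using p_nonzero[OF that(1)] that(2) by auto
  \<comment> \<open>The linear part of a representation is itself a homomorphism to the integers
    with value 1 on the generators, hence it is the degree.\<close>
  have fst_phi: "fst (\<phi> j \<zeta> g) = \<nu> g" if j: "j < s" "poly (p j) \<zeta> = 0" and g: "g \<in> carrier G" for j \<zeta> g
  proof -
    have "fst \<circ> \<phi> j \<zeta> \<in> hom G integer_group"
      using phi(1)[OF j] fst_affine_hom[of \<zeta>] by (rule Group.hom_compose)
    then have "(fst \<circ> \<phi> j \<zeta>) g = \<nu> g"
      by (rule generate_hom_eqI[OF group_integer_group _ nu_hom, where S = "insert x (y ` {..<s})"])
        (use g xy_generate x y phi[OF j] in auto)
    then show ?thesis by simp
  qed
  interpret M: presented_module A s E b cs l p
  proof (intro presented_module.intro presented_module_axioms.intro)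
    show "comm_group A" by (rule A.comm_group_axioms)
    show "E j k \<in> carrier A" if "j < s" for j k using that by (rule E_closed)
    show "carrier A \<subseteq> generate A {E j k | j k. j < s}"
      using carrier_A_generate by (simp only: gens_def)
    show "A.lincomb (E j) (Suc k) (cs j) = E j k [^]\<^bsub>A\<^esub> b j \<otimes>\<^bsub>A\<^esub> A.lincomb (E j) k (cs j)"
      if "j < s" for j k using that by (rule E_relation)
    show "rsquarefree ([:of_int (b j):] + [:1, -1:] * Poly (map of_int (cs j)) :: complex poly)" if "j < s" for j
      using p_rsquarefree[OF that] by (simp only: p_def)
    show "l j \<zeta> (u \<otimes>\<^bsub>A\<^esub> v) = l j \<zeta> u + l j \<zeta> v"
      if "j < s" "poly ([:of_int (b j):] + [:1, -1:] * Poly (map of_int (cs j))) \<zeta> = 0"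
        "u \<in> carrier A" "v \<in> carrier A" for j \<zeta> u v
    proof -
      have j: "j < s" "poly (p j) \<zeta> = 0" using that by (simp_all only: p_def)
      show ?thesis
        unfolding l_def using functional_mult[OF nonzero[OF j] phi(1)[OF j] fst_phi[OF j] that(3,4)] .
    qed
    show "l j \<zeta> (E i k) = (if i = j then \<zeta> ^ k else 0)"
      if "j < s" "poly ([:of_int (b j):] + [:1, -1:] * Poly (map of_int (cs j))) \<zeta> = 0" "i < s" for j \<zeta> i k
    proof -
      have j: "j < s" "poly (p j) \<zeta> = 0" using that by (simp_all only: p_def)
      note z0 = nonzero[OF j]
      have "l j \<zeta> (E i k) = \<zeta> powi (\<nu> (x [^] k)) * snd (\<phi> j \<zeta> (e i))"
        unfolding l_def E_def using e[OF that(3)] x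
        by (simp add: functional_cls[OF z0 phi(1)[OF j] fst_phi[OF j]]
            snd_phi_conj[OF z0 phi(1)[OF j] fst_phi[OF j]])
      also have "\<nu> (x [^] k) = int k"
        using x by (simp add: nu.hom_nat_pow)
      also have "snd (\<phi> j \<zeta> (e i)) = (if i = j then 1 else 0)"
      proof -
        interpret phi: group_hom G "affine_group \<zeta>" "\<phi> j \<zeta>"
          by (simp add: group_hom_def group_hom_axioms_def phi(1)[OF j] is_group group_affine_group[OF z0])
        show ?thesis
          using x y[OF that(3)] phi(2,3)[OF j] that(3)
          by (simp add: e_def inv_affine_group[OF z0])
      qed
      finally show ?thesis by simp
    qed
  qed (simp only: p_def)
  have lf: "l j \<zeta> (C_monodromy G C a) = \<zeta> * l j \<zeta> a"
    if "j < s" "poly (p j) \<zeta> = 0" "a \<in> carrier A" for j \<zeta> a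
    unfolding l_def
    by (rule functional_monodromy[OF nonzero[OF that(1,2)] phi(1)[OF that(1,2)]
        fst_phi[OF that(1,2)] that(3)])
  note det = M.tensor_endo_det_poly[of "C_monodromy G C", OF C_monodromy_closed]
  show ?thesis
    unfolding alexander_polynomial_def A_eq Let_def using det lf by simp
qed

end

section \<open>C-groups\<close>

lemma (in group) conjugate_eq_iff:
  assumes "a \<in> carrier G" "c \<in> carrier G" "u \<in> carrier G"
  shows "a = inv u \<otimes> c \<otimes> u \<longleftrightarrow> u \<otimes> a = c \<otimes> u"
proof
  assume "a = inv u \<otimes> c \<otimes> u"
  then show "u \<otimes> a = c \<otimes> u" using assms by (simp add: m_assoc mult_inv_cancel)
next
  assume "u \<otimes> a = c \<otimes> u"
  then have "inv u \<otimes> (u \<otimes> a) = inv u \<otimes> (c \<otimes> u)" by simp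
  then show "a = inv u \<otimes> c \<otimes> u" using assms by (simp add: m_assoc mult_inv_cancel)
qed

lemma (in group_hom) hom_image_generate:
  assumes "carrier G = generate G X" "X \<subseteq> carrier G" "h ` carrier G = carrier H"
  shows "carrier H = generate H (h ` X)"
  using generate_img[OF assms(2)] assms(1,3) by simp

lemma free_class_generate:
  assumes "u \<in> words S"
  shows "free_class S u \<in> generate (free_group S) ((\<lambda>a. free_class S [(a, True)]) ` S)"
proof -
  interpret group "free_group S" by (rule group_free_group)
  have inv: "free_class S [(a, False)] = inv\<^bsub>free_group S\<^esub> free_class S [(a, True)]" if "a \<in> S" for a
  proof (rule inv_equality[symmetric])
    show "free_class S [(a, False)] \<otimes>\<^bsub>free_group S\<^esub> free_class S [(a, True)] = \<one>\<^bsub>free_group S\<^esub>"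
      using that free_equiv_word_inv[of "[(a, True)]" S]
      by (simp add: free_group_mult free_group_one free_class_eq_iff word_inv_def)
  qed (use that in \<open>auto simp: free_group_carrier\<close>)
  from assms show ?thesis
  proof (induction u)
    case Nil
    then show ?case by (metis free_group_one generate.one)
  next
    case (Cons q u)
    obtain a t where q: "q = (a, t)" by (cases q)
    have a: "a \<in> S" using Cons.prems by (simp add: q)
    have "free_class S [q] \<in> generate (free_group S) ((\<lambda>a. free_class S [(a, True)]) ` S)"
      using a inv[OF a] by (cases t) (auto simp: q intro: generate.incl generate.inv)
    moreover have "free_class S (q # u) = free_class S [q] \<otimes>\<^bsub>free_group S\<^esub> free_class S u"
      using Cons.prems by (simp add: free_group_mult)
    ultimately show ?case using Cons by (auto intro: generate.eng)
  qed
qed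

locale C_presented =
  fixes n :: nat and l :: "nat \<Rightarrow> nat \<Rightarrow> nat" and w :: "nat \<Rightarrow> nat \<Rightarrow> nat \<Rightarrow> nat word set"
  assumes presentation: "C_presentation n l w"
begin

declare One_nat_def [simp del] atLeastAtMost_iff [simp del]

abbreviation K :: "nat word set set" where
  "K \<equiv> normal_closure (F n) (C_relators n l w)"

abbreviation G :: "nat word set set monoid" where
  "G \<equiv> C_group n l w"

definition quot :: "nat word set \<Rightarrow> nat word set set" where
  "quot g = K #>\<^bsub>F n\<^esub> g"

definition \<gamma> :: "nat \<Rightarrow> nat word set set" where
  "\<gamma> i = quot (F_gen n i)"


lemma w_carrier:
  "i \<in> {1..n} \<Longrightarrow> j \<in> {1..n} \<Longrightarrow> k \<in> {1..l i j} \<Longrightarrow> w i j k \<in> carrier (F n)"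
  using presentation by (simp add: C_presentation_def)

sublocale F: group "F n"
  by (rule group_free_group)

lemma F_gen_carrier: "i \<in> {1..n} \<Longrightarrow> F_gen n i \<in> carrier (F n)"
  by (auto simp: F_gen_def free_group_carrier)

lemma relators_carrier: "C_relators n l w \<subseteq> carrier (F n)"
  using F_gen_carrier w_carrier by (auto simp: C_relators_def)

lemma K_normal: "K \<lhd> F n"
  by (rule F.normal_closure_normal[OF relators_carrier])

sublocale G: group G
  unfolding C_group_def by (rule normal.factorgroup_is_group[OF K_normal])

sublocale quot: group_hom "F n" G quot
  using normal.r_coset_hom_Mod[OF K_normal]
  by (simp add: group_hom_def group_hom_axioms_def C_group_def quot_def[abs_def]
      normal.factorgroup_is_group[OF K_normal])

lemma carrier_G: "carrier G = quot ` carrier (F n)"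
  by (auto simp: C_group_def carrier_FactGroup quot_def)

lemma gamma_carrier: "i \<in> {1..n} \<Longrightarrow> \<gamma> i \<in> carrier G"
  by (simp add: \<gamma>_def F_gen_carrier)

lemma quot_K: "g \<in> K \<Longrightarrow> quot g = \<one>\<^bsub>G\<^esub>"
  using normal_imp_subgroup[OF K_normal] F.coset_join2[of g K] subgroup.mem_carrier
  by (fastforce simp: quot_def C_group_def)

lemma gamma_relation:
  assumes "i \<in> {1..n}" "j \<in> {1..n}" "k \<in> {1..l i j}"
  shows "\<gamma> i = inv\<^bsub>G\<^esub> quot (w i j k) \<otimes>\<^bsub>G\<^esub> \<gamma> j \<otimes>\<^bsub>G\<^esub> quot (w i j k)"
proof -
  let ?r = "inv\<^bsub>F n\<^esub> w i j k \<otimes>\<^bsub>F n\<^esub> F_gen n j \<otimes>\<^bsub>F n\<^esub> w i j k"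
  have "inv\<^bsub>F n\<^esub> F_gen n i \<otimes>\<^bsub>F n\<^esub> ?r \<in> C_relators n l w"
    using assms by (auto simp: C_relators_def)
  then have "inv\<^bsub>F n\<^esub> F_gen n i \<otimes>\<^bsub>F n\<^esub> ?r \<in> K"
    using F.subset_normal_closure by blast
  then have "quot (inv\<^bsub>F n\<^esub> F_gen n i \<otimes>\<^bsub>F n\<^esub> ?r) = \<one>\<^bsub>G\<^esub>" by (rule quot_K)
  then have "inv\<^bsub>G\<^esub> \<gamma> i \<otimes>\<^bsub>G\<^esub> quot ?r = \<one>\<^bsub>G\<^esub>"
    using assms w_carrier by (simp add: \<gamma>_def F_gen_carrier)
  then have "\<gamma> i \<otimes>\<^bsub>G\<^esub> (inv\<^bsub>G\<^esub> \<gamma> i \<otimes>\<^bsub>G\<^esub> quot ?r) = \<gamma> i"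
    using assms gamma_carrier by simp
  then have "\<gamma> i = quot ?r"
    using G.mult_inv_cancel(1)[of "\<gamma> i" "quot ?r"] assms w_carrier F_gen_carrier gamma_carrier
    by simp
  then show ?thesis
    using assms w_carrier by (simp add: \<gamma>_def F_gen_carrier)
qed

text \<open>The universal property of the presentation. The relations are required in the
  inverse-free form obtained by multiplying by the conjugator, which the affine group verifies by
  direct computation.\<close>

lemma lift:
  assumes "group H" and \<phi>: "\<phi> \<in> hom (F n) H"
    and rel: "\<And>i j k. i \<in> {1..n} \<Longrightarrow> j \<in> {1..n} \<Longrightarrow> k \<in> {1..l i j} \<Longrightarrow>
      \<phi> (w i j k) \<otimes>\<^bsub>H\<^esub> \<phi> (F_gen n i) = \<phi> (F_gen n j) \<otimes>\<^bsub>H\<^esub> \<phi> (w i j k)"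
  obtains \<psi> where "\<psi> \<in> hom G H" "\<And>g. g \<in> carrier (F n) \<Longrightarrow> \<psi> (quot g) = \<phi> g"
proof -
  interpret H: group H by fact
  interpret \<phi>: group_hom "F n" H \<phi>
    by (simp add: group_hom_def group_hom_axioms_def \<phi> assms(1) F.is_group)
  have "C_relators n l w \<subseteq> kernel (F n) H \<phi>"
  proof
    fix r assume "r \<in> C_relators n l w"
    then obtain i j k where ijk: "i \<in> {1..n}" "j \<in> {1..n}" "k \<in> {1..l i j}" and
      r: "r = inv\<^bsub>F n\<^esub> F_gen n i \<otimes>\<^bsub>F n\<^esub> (inv\<^bsub>F n\<^esub> w i j k \<otimes>\<^bsub>F n\<^esub> F_gen n j \<otimes>\<^bsub>F n\<^esub> w i j k)"
      by (auto simp: C_relators_def)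
    note c = w_carrier[OF ijk] F_gen_carrier[OF ijk(1)] F_gen_carrier[OF ijk(2)]
    have "\<phi> (F_gen n i) = inv\<^bsub>H\<^esub> \<phi> (w i j k) \<otimes>\<^bsub>H\<^esub> \<phi> (F_gen n j) \<otimes>\<^bsub>H\<^esub> \<phi> (w i j k)"
      using rel[OF ijk] c by (simp add: H.conjugate_eq_iff)
    then have "\<phi> r = inv\<^bsub>H\<^esub> \<phi> (F_gen n i) \<otimes>\<^bsub>H\<^esub> \<phi> (F_gen n i)"
      using c by (simp add: r)
    then show "r \<in> kernel (F n) H \<phi>"
      using c by (simp add: kernel_def r)
  qed
  then have K: "K \<subseteq> kernel (F n) H \<phi>"
    by (intro F.normal_closure_subset \<phi>.normal_kernel)
  obtain \<psi> where psi: "\<psi> \<in> hom (F n Mod K) H"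
    "\<And>g. g \<in> carrier (F n) \<Longrightarrow> \<psi> (K #>\<^bsub>F n\<^esub> g) = \<phi> g"
  proof (rule FactGroup_universal[OF \<phi> K_normal])
    fix g h assume gh: "g \<in> carrier (F n)" "h \<in> carrier (F n)"
      and "K #>\<^bsub>F n\<^esub> g = K #>\<^bsub>F n\<^esub> h"
    then have "g \<in> K #>\<^bsub>F n\<^esub> h"
      using F.rcos_self[OF _ normal_imp_subgroup[OF K_normal]] by blast
    then obtain k where "k \<in> K" "g = k \<otimes>\<^bsub>F n\<^esub> h" by (auto simp: r_coset_def)
    then show "\<phi> g = \<phi> h" using K gh by (auto simp: kernel_def)
  qed (use that in blast)
  then show thesis using that by (simp add: C_group_def quot_def)
qed

lemma carrier_F_generate: "carrier (F n) = generate (F n) (F_gen n ` {1..n})"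
proof
  show "carrier (F n) \<subseteq> generate (F n) (F_gen n ` {1..n})"
    using free_class_generate[of _ "{1..n}"] by (auto simp: free_group_carrier F_gen_def)
  show "generate (F n) (F_gen n ` {1..n}) \<subseteq> carrier (F n)"
    using F_gen_carrier by (intro F.generate_incl) auto
qed

lemma carrier_G_generate: "carrier G = generate G (\<gamma> ` {1..n})"
  using quot.hom_image_generate[OF carrier_F_generate _ carrier_G[symmetric]] F_gen_carrier
  by (simp add: \<gamma>_def image_image image_subset_iff)

lemma C_generators_eq:
  "C_generators n l w = {inv\<^bsub>G\<^esub> g \<otimes>\<^bsub>G\<^esub> \<gamma> i \<otimes>\<^bsub>G\<^esub> g | g i. g \<in> carrier G \<and> i \<in> {1..n}}"
  by (simp add: C_generators_def \<gamma>_def quot_def)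

lemma gamma_C: "i \<in> {1..n} \<Longrightarrow> \<gamma> i \<in> C_generators n l w"
  unfolding C_generators_eq
  by (intro CollectI exI[of _ "\<one>\<^bsub>G\<^esub>"] exI[of _ i]) (simp add: gamma_carrier del: atLeastAtMost_iff)

text \<open>All relations are conjugations, so they hold trivially once every generator is sent to
  1. The last clause makes the degree of the full product computable from its word.\<close>

lemma degree_hom:
  obtains \<nu> where "\<nu> \<in> hom G integer_group" "\<And>i. i \<in> {1..n} \<Longrightarrow> \<nu> (\<gamma> i) = 1"
    "\<And>u. u \<in> words {1..n} \<Longrightarrow>
      \<nu> (quot (free_class {1..n} u)) = group.word_eval integer_group (\<lambda>_. 1) u"
proof -
  interpret Z: group integer_group by simp
  obtain \<phi> where phi: "\<phi> \<in> hom (F n) integer_group"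
    "\<And>u. u \<in> words {1..n} \<Longrightarrow> \<phi> (free_class {1..n} u) = Z.word_eval (\<lambda>_. 1) u"
    using Z.free_group_lift[of "\<lambda>_. 1" "{1..n}"] by auto
  have "\<phi> (F_gen n i) = 1" if "i \<in> {1..n}" for i
    using that phi(2)[of "[(i, True)]"] by (simp add: F_gen_def)
  moreover obtain \<psi> where "\<psi> \<in> hom G integer_group" "\<And>g. g \<in> carrier (F n) \<Longrightarrow> \<psi> (quot g) = \<phi> g"
    by (rule lift[OF group_integer_group phi(1)]) (simp_all add: calculation del: atLeastAtMost_iff)
  ultimately show thesis
    using that[of \<psi>] phi(2) F_gen_carrier by (simp add: \<gamma>_def free_group_carrier)
qed

end

section \<open>Separable factors of integer polynomials\<close>

abbreviation complex_of_int_poly :: "int poly \<Rightarrow> complex poly" where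
  "complex_of_int_poly \<equiv> map_poly of_int"

lemma poly_complex_of_int_poly_1: "poly (complex_of_int_poly p) 1 = of_int (poly p 1)"
  using of_int_hom.poly_map_poly[of p 1] by simp

text \<open>Gauss's lemma: contents are multiplicative, so \<open>c\<close> divides the content of
  the cofactor and can be cancelled.\<close>

lemma primitive_dvd_smultD:
  fixes p q :: "int poly"
  assumes "content p = 1" "c \<noteq> 0" "p dvd smult c q"
  shows "p dvd q"
proof -
  obtain k where k: "smult c q = p * k" using assms(3) by (rule dvdE)
  have "normalize c * content q = content k"
    using arg_cong[OF k, of content] assms(1) by (simp add: content_mult)
  then have "[:c:] dvd k"
    by (metis const_poly_dvd_iff_dvd_content dvd_triv_left normalize_dvd_iff)
  then obtain k' where "k = smult c k'" by auto
  then have "smult c q = smult c (p * k')" using k by simp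
  then have "q = p * k'" using assms(2) by (simp add: smult_cancel)
  then show ?thesis by simp
qed

text \<open>Integer polynomials admit no Bezout identity in general, only one up to the constant
  \<open>c\<close>. Take a nonzero element \<open>A\<close> of least degree in the ideal of
  \<open>P\<close> and \<open>T\<close>: \<open>D\<close> is its primitive part, \<open>c\<close>
  its content, and pseudo-division by \<open>A\<close> replaces Euclidean division.\<close>

lemma exists_common_divisor_poly:
  fixes P T :: "int poly"
  assumes "P \<noteq> 0"
  obtains D c U V where "content D = 1" "D dvd P" "D dvd T" "c \<noteq> 0" "smult c D = U * P + V * T"
proof -
  define I where "I = {U * P + V * T | U V. True}"
  have "\<exists>A. A \<in> I \<and> A \<noteq> 0"
    unfolding I_def using assms by (metis (mono_tags, lifting) add.right_neutral lambda_one mem_Collect_eq mult_zero_left)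
  then obtain A where A: "A \<in> I" "A \<noteq> 0" and min: "\<And>B. B \<in> I \<Longrightarrow> B \<noteq> 0 \<Longrightarrow> degree A \<le> degree B"
    using ex_has_least_nat[of "\<lambda>A. A \<in> I \<and> A \<noteq> 0" _ degree] by blast
  define D where "D = primitive_part A"
  have DA: "smult (content A) D = A" and D: "content D = 1"
    using A(2) by (simp_all add: D_def)
  obtain U0 V0 where A_eq: "A = U0 * P + V0 * T" using A(1) by (auto simp: I_def)
  have dvd: "D dvd B" if B: "B \<in> I" for B
  proof -
    obtain q r where qr: "pseudo_divmod B A = (q, r)" by (cases "pseudo_divmod B A")
    define k where "k = coeff A (degree A) ^ (Suc (degree B) - degree A)"
    note pd = pseudo_divmod[OF A(2) qr, folded k_def]
    have "k \<noteq> 0" using A(2) by (simp add: k_def)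
    obtain U1 V1 where "B = U1 * P + V1 * T" using B by (auto simp: I_def)
    then have "r = (smult k U1 - q * U0) * P + (smult k V1 - q * V0) * T"
      using pd(1) unfolding A_eq by (simp add: algebra_simps smult_add_right)
    then have "r \<in> I" by (auto simp: I_def)
    then have "r = 0" using min pd(2) by force
    then have "smult k B = D * smult (content A) q"
      using pd(1) DA by (metis add.right_neutral mult_smult_left mult_smult_right)
    then have "D dvd smult k B" by (rule dvdI)
    then show ?thesis by (rule primitive_dvd_smultD[OF D \<open>k \<noteq> 0\<close>])
  qed
  have "P = 1 * P + 0 * T" "T = 0 * P + 1 * T" by simp_all
  then have "P \<in> I" "T \<in> I" unfolding I_def by blast+
  then have "D dvd P" "D dvd T" using dvd by auto
  moreover have "content A \<noteq> 0" using A(2) by simp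
  ultimately show ?thesis using that[of D "content A" U0 V0] D DA A_eq by simp
qed

lemma rsquarefree_dvd_power_minus_1:
  fixes p :: "complex poly"
  assumes "d > 0" "p dvd monom 1 d - 1"
  shows "rsquarefree p"
  unfolding rsquarefree_roots
proof (intro allI notI)
  fix x assume x: "poly p x = 0 \<and> poly (pderiv p) x = 0"
  obtain q where q: "monom 1 d - 1 = p * q" using assms(2) by (rule dvdE)
  have "poly (monom 1 d - 1) x = 0" unfolding q using x by simp
  then have "x ^ d = 1" by (simp add: poly_monom)
  moreover have "poly (pderiv (monom 1 d - 1)) x = 0" unfolding q using x by (simp add: pderiv_mult)
  then have "x ^ (d - 1) = 0" using assms(1) by (simp add: pderiv_diff pderiv_monom poly_monom)
  ultimately show False using assms(1) by (auto simp: power_0_left)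
qed

lemma lead_coeff_unit_dvd:
  fixes p q :: "int poly"
  assumes "p dvd q" "\<bar>lead_coeff q\<bar> = 1"
  shows "\<bar>lead_coeff p\<bar> = 1"
proof -
  obtain r where "q = p * r" using assms(1) by (rule dvdE)
  then have "\<bar>lead_coeff p\<bar> * \<bar>lead_coeff r\<bar> = 1"
    using assms(2) by (simp add: lead_coeff_mult abs_mult)
  then show ?thesis by (metis abs_dvd_iff dvd_triv_left zdvd1_eq)
qed

text \<open>The part of \<open>P\<close> common with \<open>t\<^sup>d - 1\<close> is its radical, because \<open>t\<^sup>d - 1\<close> is separable.\<close>

lemma exists_radical:
  fixes P :: "int poly"
  assumes P: "\<bar>lead_coeff P\<bar> = 1" and d: "d > 0"
    and roots: "\<And>z. poly (complex_of_int_poly P) z = 0 \<Longrightarrow> z ^ d = 1"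
  obtains D where "D dvd P" "\<bar>lead_coeff D\<bar> = 1" "rsquarefree (complex_of_int_poly D)"
    "\<And>z. poly (complex_of_int_poly P) z = 0 \<Longrightarrow> poly (complex_of_int_poly D) z = 0"
proof -
  have "P \<noteq> 0" using P by auto
  then obtain D c U V where D: "content D = 1" "D dvd P" "D dvd monom 1 d - 1" "c \<noteq> 0"
    and eq: "smult c D = U * P + V * (monom 1 d - 1)"
    by (rule exists_common_divisor_poly)
  show thesis
  proof
    show "D dvd P" by fact
    show "\<bar>lead_coeff D\<bar> = 1" by (rule lead_coeff_unit_dvd[OF D(2) P])
    have "complex_of_int_poly D dvd complex_of_int_poly (monom 1 d - 1)"
      using D(3) by (rule of_int_poly_hom.hom_dvd)
    then show "rsquarefree (complex_of_int_poly D)"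
      by (intro rsquarefree_dvd_power_minus_1[OF d]) (simp add: hom_distribs)
    fix z assume z: "poly (complex_of_int_poly P) z = 0"
    \<comment> \<open>At a root of \<open>P\<close> the Bezout identity has right-hand side 0, since
      both \<open>P\<close> and \<open>t^d - 1\<close> vanish there.\<close>
    have "smult (of_int c) (complex_of_int_poly D)
        = complex_of_int_poly U * complex_of_int_poly P + complex_of_int_poly V * (monom 1 d - 1)"
      using arg_cong[OF eq, of complex_of_int_poly] by (simp add: hom_distribs)
    then have "of_int c * poly (complex_of_int_poly D) z = 0"
      using z roots[OF z] by (simp add: poly_monom flip: poly_smult)
    then show "poly (complex_of_int_poly D) z = 0" using D(4) by simp
  qed
qed

lemma sum_powers_root_of_unity:
  fixes z :: "'a::field"
  assumes "z \<noteq> 1" "z ^ n = 1"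
  shows "(\<Sum>i<n. z ^ i) = 0"
  using assms geometric_sum[of z n] by simp

text \<open>A root of unity whose order is not a prime power satisfies \<open>1 - \<zeta> | 1\<close>: if its order is
  \<open>a b\<close> with \<open>a\<close>, \<open>b\<close> coprime, then \<open>1 - \<zeta>\<close> divides both \<open>a\<close> and \<open>b\<close>.\<close>

lemma exists_annihilator_value_1:
  fixes z :: complex
  assumes "coprime a b" "z ^ a \<noteq> 1" "z ^ b \<noteq> 1" "z ^ (a * b) = 1"
  obtains E :: "int poly" where "poly E 1 = 1" "poly (complex_of_int_poly E) z = 0"
proof -
  obtain u v where uv: "u * int a + v * int b = 1"
    using bezout_int[of "int a" "int b"] assms(1) by auto
  \<comment> \<open>The first sum is \<open>(t^(ab) - 1) / (t^b - 1)\<close>: it vanishes at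
    \<open>z\<close> because \<open>z^b \<noteq> 1\<close>, and its value at 1 is \<open>a\<close>.
    The second is the same with \<open>a\<close> and \<open>b\<close> exchanged, so the Bezout
    coefficients make the value at 1 equal to 1.\<close>
  define E where "E = smult u (\<Sum>i<a. monom 1 (b * i)) + smult v (\<Sum>i<b. monom (1::int) (a * i))"
  show thesis
  proof
    show "poly E 1 = 1" using uv by (simp add: E_def poly_sum poly_monom)
    have "(\<Sum>i<a. (z ^ b) ^ i) = 0" "(\<Sum>i<b. (z ^ a) ^ i) = 0"
      using sum_powers_root_of_unity[of "z ^ b" a] sum_powers_root_of_unity[of "z ^ a" b] assms
      by (auto simp: mult.commute power_mult[symmetric])
    then show "poly (complex_of_int_poly E) z = 0"
      by (simp add: E_def hom_distribs poly_sum poly_monom power_mult)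
  qed
qed

lemma coprime_factorization_not_prime_power:
  fixes n :: nat
  assumes "n > 0" "\<And>p k. prime p \<Longrightarrow> n \<noteq> p ^ k"
  obtains a b where "n = a * b" "coprime a b" "a > 1" "b > 1"
proof -
  \<comment> \<open>The exponent 0 is allowed, so 1 counts as a prime power and is excluded.\<close>
  have "n \<noteq> 1" using assms(2)[of 2 0] by auto
  then obtain p where p: "prime p" "p dvd n" using prime_factor_nat[OF \<open>n \<noteq> 1\<close>] by auto
  define k where "k = multiplicity p n"
  obtain b where b: "n = p ^ k * b" "\<not> p dvd b"
    using multiplicity_decompose'[of n p] p assms(1) prime_gt_1_nat[OF p(1)] unfolding k_def by auto
  have "k > 0" using p assms(1) by (simp add: k_def prime_multiplicity_gt_zero_iff)
  then have "p ^ k > 1" using prime_gt_1_nat[OF p(1)] by (intro one_less_power)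
  moreover have "coprime (p ^ k) b"
    using b(2) p(1) by (simp add: prime_imp_coprime)
  moreover have "b \<noteq> 0" "b \<noteq> 1" using b(1) assms(1) assms(2)[OF p(1), of k] by auto
  ultimately show thesis using that[of "p ^ k" b] b(1) by simp
qed

lemma exists_primitive_order:
  fixes z :: complex
  assumes "z ^ d = 1" "d > 0"
  obtains n where "primitive_root_of_unity n z"
proof -
  define n where "n = (LEAST n. 0 < n \<and> z ^ n = 1)"
  have "0 < n \<and> z ^ n = 1"
    unfolding n_def by (rule LeastI[of _ d]) (use assms in simp)
  moreover have "z ^ e \<noteq> 1" if "0 < e" "e < n" for e
    using not_less_Least[of e "\<lambda>n. 0 < n \<and> z ^ n = 1"] that unfolding n_def by blast
  ultimately show thesis using that[of n] by (simp add: primitive_root_of_unity_def)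
qed

text \<open>Multiplying annihilators of all roots gives an integer polynomial \<open>F\<close> with
  \<open>F(1) = 1\<close> that the separable \<open>D\<close> divides over the complex numbers. As
  the leading coefficient of \<open>D\<close> is a unit, the division already takes place over the
  integers up to sign, so \<open>D(1)\<close> divides a unit. With \<open>k = 0\<close>, the last
  hypothesis also covers the root 1.\<close>

lemma value_at_1_unit:
  fixes D :: "int poly"
  assumes D: "\<bar>lead_coeff D\<bar> = 1" "rsquarefree (complex_of_int_poly D)" and d: "d > 0"
    and roots: "\<And>z. poly (complex_of_int_poly D) z = 0 \<Longrightarrow> z ^ d = 1"
    and npp: "\<And>p k z. prime p \<Longrightarrow> primitive_root_of_unity (p ^ k) z \<Longrightarrow>
      poly (complex_of_int_poly D) z \<noteq> 0"
  shows "\<bar>poly D 1\<bar> = 1"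
proof -
  let ?R = "{z. poly (complex_of_int_poly D) z = 0}"
  have D0: "D \<noteq> 0" using D(1) by auto
  then have fin: "finite ?R" by (intro poly_roots_finite) simp
  have "\<exists>E. poly E 1 = 1 \<and> poly (complex_of_int_poly E) z = 0" if "z \<in> ?R" for z
  proof -
    obtain n where n: "primitive_root_of_unity n z"
      using exists_primitive_order[OF roots d] \<open>z \<in> ?R\<close> by blast
    then have "n > 0" by (simp add: primitive_root_of_unity_def)
    moreover have "n \<noteq> p ^ k" if "prime p" for p k
      using npp[OF that, of k z] n \<open>z \<in> ?R\<close> by auto
    ultimately obtain a b where ab: "n = a * b" "coprime a b" "a > 1" "b > 1"
      using coprime_factorization_not_prime_power by blast
    then have "a < n" "b < n" by auto
    then have "z ^ a \<noteq> 1" "z ^ b \<noteq> 1" "z ^ (a * b) = 1"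
      using n ab by (auto simp: primitive_root_of_unity_def)
    then show ?thesis using exists_annihilator_value_1[OF ab(2)] by metis
  qed
  then obtain E where E: "\<And>z. z \<in> ?R \<Longrightarrow> poly (E z) 1 = 1"
    "\<And>z. z \<in> ?R \<Longrightarrow> poly (complex_of_int_poly (E z)) z = 0" by metis
  define F where "F = (\<Prod>z\<in>?R. E z)"
  have F1: "poly F 1 = 1" using E(1) by (simp add: F_def poly_prod)
  have dvdC: "complex_of_int_poly D dvd complex_of_int_poly F"
  proof (rule rsquarefree_dvdI[OF D(2)])
    fix z assume "poly (complex_of_int_poly D) z = 0"
    then show "poly (complex_of_int_poly F) z = 0"
      using E(2) fin by (auto simp: F_def of_int_poly_hom.hom_prod poly_prod)
  qed
  obtain q r where qr: "pseudo_divmod F D = (q, r)" by (cases "pseudo_divmod F D")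
  define k where "k = coeff D (degree D) ^ (Suc (degree F) - degree D)"
  note pd = pseudo_divmod[OF D0 qr, folded k_def]
  have k: "\<bar>k\<bar> = 1" using D(1) by (simp add: k_def power_abs)
  have "smult (of_int k) (complex_of_int_poly F) - complex_of_int_poly D * complex_of_int_poly q
      = complex_of_int_poly r"
    using arg_cong[OF pd(1), of complex_of_int_poly] by (simp add: hom_distribs)
  then have "complex_of_int_poly D dvd complex_of_int_poly r"
    using dvdC by (metis dvd_diff dvd_smult dvd_triv_left)
  \<comment> \<open>A remainder of smaller degree than \<open>D\<close> but divisible by
    \<open>D\<close> must vanish.\<close>
  then have "r = 0"
    using pd(2) dvd_imp_degree_le[of "complex_of_int_poly D" "complex_of_int_poly r"] by force
  then have "k = poly D 1 * poly q 1"
    using arg_cong[OF pd(1), of "\<lambda>p. poly p 1"] F1 by simp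
  then have "\<bar>poly D 1\<bar> * \<bar>poly q 1\<bar> = 1" using k by (simp add: abs_mult)
  then show ?thesis by (metis abs_dvd_iff dvd_triv_left zdvd1_eq)
qed


text \<open>The sign of a factor is spent on its value at 1, which must match a conjugation
  relation; the leading coefficient is therefore only fixed up to sign.\<close>

definition good_factor :: "nat \<Rightarrow> int poly \<Rightarrow> bool" where
  "good_factor d p \<longleftrightarrow> \<bar>lead_coeff p\<bar> = 1 \<and> rsquarefree (complex_of_int_poly p) \<and>
    poly p 1 \<in> {0, 1} \<and> (\<forall>z. poly (complex_of_int_poly p) z = 0 \<longrightarrow> z ^ d = 1)"

text \<open>Dividing by the radical lowers the multiplicity of every root by exactly one, and this
  preserves the comparison with the root 1. If 1 is a root, its multiplicity drops together with the
  others, while non-roots stay at 0; if it is not, all roots of prime power order are already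
  absent.\<close>

lemma good_factorization:
  fixes P :: "int poly"
  assumes "\<bar>lead_coeff P\<bar> = 1" and d: "d > 0"
    and "\<And>z. poly (complex_of_int_poly P) z = 0 \<Longrightarrow> z ^ d = 1"
    and "\<And>p k z. prime p \<Longrightarrow> primitive_root_of_unity (p ^ k) z \<Longrightarrow>
      order z (complex_of_int_poly P) \<le> order 1 (complex_of_int_poly P)"
  shows "\<exists>Ps. (\<forall>p\<in>set Ps. good_factor d p) \<and> (P = prod_list Ps \<or> P = - prod_list Ps)"
  using assms(1,3,4)
proof (induction "degree P" arbitrary: P rule: less_induct)
  case less
  note lead = less.prems(1) and roots = less.prems(2) and mult = less.prems(3)
  show ?case
  proof (cases "degree P = 0")
    case True
    then obtain c where "P = [:c:]" by (rule degree_eq_zeroE)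
    then have "P = 1 \<or> P = - 1" using lead by (auto simp: abs_if one_pCons split: if_splits)
    then show ?thesis by (intro exI[of _ "[]"]) auto
  next
    case False
    have P0: "P \<noteq> 0" using lead by auto
    obtain D0 where D0: "D0 dvd P" "\<bar>lead_coeff D0\<bar> = 1" "rsquarefree (complex_of_int_poly D0)"
      "\<And>z. poly (complex_of_int_poly P) z = 0 \<Longrightarrow> poly (complex_of_int_poly D0) z = 0"
      using exists_radical[OF lead d roots] by blast
    have D0_roots: "poly (complex_of_int_poly P) z = 0" if "poly (complex_of_int_poly D0) z = 0" for z
      using that dvd_trans[OF _ of_int_poly_hom.hom_dvd[OF D0(1)], of "[:-z, 1:]"]
      by (simp add: poly_eq_0_iff_dvd)
    have val: "poly D0 1 = 0 \<or> \<bar>poly D0 1\<bar> = 1"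
    proof (cases "poly D0 1 = 0")
      case False
      then have "poly (complex_of_int_poly P) 1 \<noteq> 0"
        using D0(4)[of 1] poly_complex_of_int_poly_1[of D0] by auto
      then have "order 1 (complex_of_int_poly P) = 0" by (rule order_0I)
      then have "order z (complex_of_int_poly P) = 0"
        if "prime p" "primitive_root_of_unity (p ^ k) z" for p k z using mult[OF that] by simp
      then have "poly (complex_of_int_poly D0) z \<noteq> 0"
        if "prime p" "primitive_root_of_unity (p ^ k) z" for p k z
        using that D0_roots[of z] P0 by (auto simp: order_root)
      then have "\<bar>poly D0 1\<bar> = 1"
        by (intro value_at_1_unit[OF D0(2,3) d]) (auto intro: roots D0_roots)
      then show ?thesis ..
    qed simp
    define D where "D = (if poly D0 1 = -1 then - D0 else D0)"
    have D: "D dvd P" "\<bar>lead_coeff D\<bar> = 1" "rsquarefree (complex_of_int_poly D)"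
      using D0 by (auto simp: D_def hom_distribs rsquarefree_def)
    have D_roots: "poly (complex_of_int_poly D) z = 0 \<longleftrightarrow> poly (complex_of_int_poly P) z = 0" for z
      using D0(4)[of z] D0_roots[of z] by (auto simp: D_def hom_distribs)
    have good: "good_factor d D"
      using D val roots unfolding good_factor_def D_roots by (auto simp: D_def)
    obtain Q where Q: "P = D * Q" using D(1) by (rule dvdE)
    have DQ: "D \<noteq> 0" "Q \<noteq> 0" using P0 Q by auto
    \<comment> \<open>A nonconstant \<open>P\<close> has a root, which \<open>D\<close> shares; so
      \<open>D\<close> is nonconstant and the degree of the cofactor really drops.\<close>
    have "\<not> constant (poly (complex_of_int_poly P))"
      using False by (simp add: constant_degree)
    then obtain z0 where "poly (complex_of_int_poly P) z0 = 0"
      using fundamental_theorem_of_algebra by blast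
    then have "poly (complex_of_int_poly D) z0 = 0" by (simp add: D_roots)
    then have "degree D \<noteq> 0"
      using DQ(1) by (auto simp: hom_distribs elim!: degree_eq_zeroE)
    then have deg: "degree Q < degree P" using DQ by (simp add: Q degree_mult_eq)
    have ordP: "order z (complex_of_int_poly P)
        = (if poly (complex_of_int_poly P) z = 0 then 1 else 0) + order z (complex_of_int_poly Q)" for z
    proof -
      have "order z (complex_of_int_poly P)
          = order z (complex_of_int_poly D) + order z (complex_of_int_poly Q)"
        using DQ by (simp add: Q hom_distribs order_mult)
      moreover have "order z (complex_of_int_poly D)
          = (if poly (complex_of_int_poly P) z = 0 then 1 else 0)"
        using rsquarefree_root_order[OF D(3), of z] DQ(1) order_0I D_roots[of z] by auto
      ultimately show ?thesis by simp
    qed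
    have "\<exists>Ps. (\<forall>p\<in>set Ps. good_factor d p) \<and> (Q = prod_list Ps \<or> Q = - prod_list Ps)"
    proof (rule less.hyps[OF deg])
      show "\<bar>lead_coeff Q\<bar> = 1" by (rule lead_coeff_unit_dvd[OF _ lead]) (simp add: Q)
      show "z ^ d = 1" if "poly (complex_of_int_poly Q) z = 0" for z
        using that by (intro roots) (simp add: Q hom_distribs)
      fix p k z assume "prime (p::nat)" "primitive_root_of_unity (p ^ k) z"
      note * = mult[OF this]
      show "order z (complex_of_int_poly Q) \<le> order 1 (complex_of_int_poly Q)"
      proof (cases "poly (complex_of_int_poly P) 1 = 0")
        case True
        show ?thesis
        proof (cases "poly (complex_of_int_poly P) z = 0")
          case False
          then show ?thesis using order_0I[OF False] ordP[of z] by simp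
        qed (use * ordP[of z] ordP[of 1] True in simp)
      next
        case False
        then show ?thesis using * order_0I[OF False] ordP[of z] by simp
      qed
    qed
    then obtain Ps where Ps: "\<forall>p\<in>set Ps. good_factor d p" "Q = prod_list Ps \<or> Q = - prod_list Ps"
      by blast
    then show ?thesis
      using good by (intro exI[of _ "D # Ps"]) (auto simp: Q)
  qed
qed

lemma prod_linear_eq:
  assumes "good_factor d p"
  shows "(\<Prod>z | poly (complex_of_int_poly p) z = 0. [:z, -1:]) = complex_of_int_poly p \<or>
    (\<Prod>z | poly (complex_of_int_poly p) z = 0. [:z, -1:]) = - complex_of_int_poly p"
proof -
  let ?R = "{z. poly (complex_of_int_poly p) z = 0}"
  have "(\<Prod>z\<in>?R. [:z, -1:]) = (\<Prod>z\<in>?R. - [:-z, 1:] :: complex poly)" by simp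
  also have "\<dots> = (-1) ^ card ?R * (\<Prod>z\<in>?R. [:-z, 1:])"
    by (rule prod_uminus)
  finally have 1: "(\<Prod>z\<in>?R. [:z, -1:]) = (-1) ^ card ?R * (\<Prod>z\<in>?R. [:-z, 1:])" .
  have "lead_coeff p = 1 \<or> lead_coeff p = -1" using assms by (auto simp: good_factor_def abs_if split: if_splits)
  moreover have "smult (of_int (lead_coeff p)) (\<Prod>z\<in>?R. [:-z, 1:]) = complex_of_int_poly p"
    using complex_poly_decompose_rsquarefree[of "complex_of_int_poly p"] assms
    by (simp add: good_factor_def)
  ultimately have "(\<Prod>z\<in>?R. [:-z, 1:]) = complex_of_int_poly p \<or>
      (\<Prod>z\<in>?R. [:-z, 1:]) = - complex_of_int_poly p"
    by (auto simp: minus_equation_iff)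
  then show ?thesis
    unfolding 1 by (cases "even (card ?R)") auto
qed

lemma lead_coeff_sign_mult:
  fixes p q :: "complex poly"
  assumes "p \<noteq> 0" "q \<noteq> 0" "lead_coeff p = (-1) ^ degree p" "lead_coeff q = (-1) ^ degree q"
  shows "lead_coeff (p * q) = (-1) ^ degree (p * q)"
proof -
  have "lead_coeff (p * q) = lead_coeff p * lead_coeff q"
    by (rule lead_coeff_mult)
  also have "\<dots> = (-1) ^ (degree p + degree q)"
    by (simp only: assms(3,4) power_add)
  also have "degree p + degree q = degree (p * q)"
    using assms(1,2) by (simp add: degree_mult_eq)
  finally show ?thesis .
qed

text \<open>The factors are known only up to sign, but a product of factors
  \<open>\<zeta> - t\<close> has leading coefficient -1 to the power of its degree. The
  normalisation of \<open>P\<close> is the same, so the overall sign must be right.\<close>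

theorem good_factorization_linear_factors:
  fixes P :: "int poly"
  assumes lead: "lead_coeff P = (-1) ^ degree P"
    and roots: "\<And>z. poly (complex_of_int_poly P) z = 0 \<Longrightarrow> \<exists>n>0. z ^ n = 1"
    and mult: "\<And>p k z. prime p \<Longrightarrow> primitive_root_of_unity (p ^ k) z \<Longrightarrow>
      order z (complex_of_int_poly P) \<le> order 1 (complex_of_int_poly P)"
  obtains d Ps where "d > 0" "\<And>p. p \<in> set Ps \<Longrightarrow> good_factor d p"
    "(\<Prod>p\<leftarrow>Ps. \<Prod>z | poly (complex_of_int_poly p) z = 0. [:z, -1:]) = complex_of_int_poly P"
proof -
  have lead1: "\<bar>lead_coeff P\<bar> = 1" by (simp add: lead power_abs)
  then have P0: "P \<noteq> 0" by auto
  let ?R = "{z. poly (complex_of_int_poly P) z = 0}"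
  have fin: "finite ?R" using P0 by (intro poly_roots_finite) simp
  have "\<forall>z. \<exists>n. z \<in> ?R \<longrightarrow> 0 < n \<and> z ^ n = 1" using roots by auto
  from choice[OF this] obtain N :: "complex \<Rightarrow> nat"
    where N: "\<And>z. z \<in> ?R \<Longrightarrow> N z > 0" "\<And>z. z \<in> ?R \<Longrightarrow> z ^ N z = 1" by auto
  \<comment> \<open>A common exponent for all roots; a product of individual exponents is enough,
    minimality plays no part in the construction.\<close>
  define d where "d = (\<Prod>z\<in>?R. N z)"
  have d: "d > 0" unfolding d_def using N(1) by (intro prod_pos) simp
  have zd: "z ^ d = 1" if "poly (complex_of_int_poly P) z = 0" for z
  proof -
    have "N z dvd d" unfolding d_def using fin that by (intro dvd_prodI) auto
    then show ?thesis using N(2)[of z] that by (auto simp: power_mult elim!: dvdE)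
  qed
  have "\<exists>Ps. (\<forall>p\<in>set Ps. good_factor d p) \<and> (P = prod_list Ps \<or> P = - prod_list Ps)"
    by (rule good_factorization[OF lead1 d zd mult])
  then obtain Ps where Ps: "\<forall>p\<in>set Ps. good_factor d p" "P = prod_list Ps \<or> P = - prod_list Ps"
    by blast
  define X where "X = (\<Prod>p\<leftarrow>Ps. \<Prod>z | poly (complex_of_int_poly p) z = 0. [:z, -1:])"
  have lc: "lead_coeff X = (-1) ^ degree X" unfolding X_def
  proof (induction Ps)
    case (Cons p Ps)
    let ?Y = "\<Prod>z | poly (complex_of_int_poly p) z = 0. [:z, -1:]"
    let ?Z = "\<Prod>p\<leftarrow>Ps. \<Prod>z | poly (complex_of_int_poly p) z = 0. [:z, -1:]"
    have "degree ?Y = card {z. poly (complex_of_int_poly p) z = 0}"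
      by (simp add: degree_prod_sum_eq)
    moreover have "lead_coeff ?Y = (\<Prod>z | poly (complex_of_int_poly p) z = 0. lead_coeff [:z, -1:])"
      by (rule lead_coeff_prod)
    ultimately have "lead_coeff ?Y = (-1) ^ degree ?Y"
      by simp
    moreover have "?Y \<noteq> 0" by (cases "finite {z. poly (complex_of_int_poly p) z = 0}") auto
    moreover have "?Z \<noteq> 0"
    proof
      assume Z0: "?Z = 0"
      show False using Cons unfolding Z0 by simp
    qed
    ultimately have "lead_coeff (?Y * ?Z) = (-1) ^ degree (?Y * ?Z)"
      using Cons lead_coeff_sign_mult by blast
    then show ?case by simp
  qed simp
  have "X = complex_of_int_poly (prod_list Ps) \<or> X = - complex_of_int_poly (prod_list Ps)"
    unfolding X_def using Ps(1)
  proof (induction Ps)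
    case (Cons p Ps)
    then have "good_factor d p" by simp
    from prod_linear_eq[OF this] Cons show ?case
      by (auto simp: hom_distribs)
  qed simp
  then have X: "X = complex_of_int_poly P \<or> X = - complex_of_int_poly P"
    using Ps(2) by (auto simp: hom_distribs)
  then have "degree X = degree P" by auto
  then have "lead_coeff X = lead_coeff (complex_of_int_poly P)" using lc lead by simp
  then have "X = complex_of_int_poly P" using X P0 by auto
  then show thesis using that[OF d, of Ps] Ps(1) unfolding X_def by blast
qed

section \<open>The realisation\<close>

lemma word_eval_affine_const:
  assumes "\<zeta> \<noteq> 0" "\<And>i. i \<in> set L \<Longrightarrow> f i = (1, v)"
  shows "group.word_eval (affine_group \<zeta>) f (map (\<lambda>i. (i, True)) L)
    = (int (length L), v * (\<Sum>i<length L. \<zeta> ^ i))"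
proof -
  interpret group "affine_group \<zeta>" by (rule group_affine_group[OF assms(1)])
  show ?thesis
    using assms(2)
  proof (induction L)
    case (Cons a L)
    then show ?case by (simp add: algebra_simps)
  qed simp
qed

text \<open>The product of blocks of \<open>d\<close> equal generators is central: each block sum
  \<open>v (1 + \<zeta> + \<dots> + \<zeta>\<^sup>d\<^sup>-\<^sup>1)\<close> is fixed by \<open>\<zeta>\<close>.\<close>

lemma word_eval_affine_blocks:
  assumes "\<zeta> \<noteq> 0" "\<zeta> ^ d = 1" "d > 0"
    and f: "\<And>i. f i = (1, g ((i - 1) div d))"
  shows "\<exists>v. group.word_eval (affine_group \<zeta>) f (map (\<lambda>i. (i, True)) [1..<r * d + 1]) = (int (r * d), v)
    \<and> \<zeta> * v = v"
proof (induction r)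
  interpret group "affine_group \<zeta>" by (rule group_affine_group[OF assms(1)])
  case 0
  then show ?case by simp
next
  interpret group "affine_group \<zeta>" by (rule group_affine_group[OF assms(1)])
  case (Suc r)
  then obtain v where v: "word_eval f (map (\<lambda>i. (i, True)) [1..<r * d + 1]) = (int (r * d), v)"
    "\<zeta> * v = v" by blast
  define B where "B = [r * d + 1..<r * d + 1 + d]"
  have fB: "f i = (1, g r)" if "i \<in> set B" for i
  proof -
    from that have "r * d \<le> i - 1" "i - 1 < r * d + d" by (auto simp: B_def)
    then have "(i - 1) div d = r"
      by (intro div_nat_eqI) (simp_all add: algebra_simps)
    then show ?thesis using f by simp
  qed
  have "length B = d" by (simp add: B_def)
  then have B: "word_eval f (map (\<lambda>i. (i, True)) B) = (int d, g r * (\<Sum>i<d. \<zeta> ^ i))"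
    using word_eval_affine_const[OF assms(1) fB, of B] by simp
  have split: "[1..<Suc r * d + 1] = [1..<r * d + 1] @ B"
    unfolding B_def using upt_add_eq_append[of 1 "r * d + 1" d] by (simp add: algebra_simps)
  have w: "map (\<lambda>i. (i, True)) L \<in> words UNIV" for L :: "nat list"
    by (induction L) auto
  have "word_eval f (map (\<lambda>i. (i, True)) [1..<Suc r * d + 1])
      = (int (r * d), v) \<otimes>\<^bsub>affine_group \<zeta>\<^esub> (int d, g r * (\<Sum>i<d. \<zeta> ^ i))"
    unfolding split map_append
    using word_eval_append[of f UNIV, OF _ w w] v(1) B by simp
  \<comment> \<open>Appending a block multiplies the earlier translation by
    \<open>\<zeta>^d = 1\<close>, so the translations of the blocks simply add.\<close>
  also have "\<dots> = (int (Suc r * d), v + g r * (\<Sum>i<d. \<zeta> ^ i))"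
    using assms(2) by (simp add: algebra_simps)
  finally have eq: "word_eval f (map (\<lambda>i. (i, True)) [1..<Suc r * d + 1])
      = (int (Suc r * d), v + g r * (\<Sum>i<d. \<zeta> ^ i))" .
  have "(\<zeta> - 1) * (\<Sum>i<d. \<zeta> ^ i) = 0"
    using power_diff_1_eq[of \<zeta> d] assms(2) by simp
  then have "\<zeta> * (\<Sum>i<d. \<zeta> ^ i) = (\<Sum>i<d. \<zeta> ^ i)" by (simp add: algebra_simps)
  then have "\<zeta> * (v + g r * (\<Sum>i<d. \<zeta> ^ i)) = v + g r * (\<Sum>i<d. \<zeta> ^ i)"
    using v(2) by (auto simp: algebra_simps)
  with eq show ?case by blast
qed

locale realization =
  fixes d :: nat and Ps :: "int poly list"
  assumes d: "d > 0" and good: "\<And>P. P \<in> set Ps \<Longrightarrow> good_factor d P"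
begin

definition s :: nat where "s = length Ps"

definition n :: nat where "n = Suc s * d"

text \<open>Indices start at 1. Block 0 consists of \<open>d\<close> copies of \<open>x\<close>, and
  block \<open>Suc j\<close> of \<open>d\<close> copies of \<open>y\<^sub>j\<close>.\<close>

definition block :: "nat \<Rightarrow> nat" where "block i = (i - 1) div d"

definition b :: "nat \<Rightarrow> int" where "b j = poly (Ps ! j) 1"

definition q :: "nat \<Rightarrow> int poly" where
  "q j = (SOME q. Ps ! j = [:b j:] + [:1, -1:] * q)"

abbreviation cs :: "nat \<Rightarrow> int list" where "cs j \<equiv> coeffs (q j)"

definition p :: "nat \<Rightarrow> complex poly" where "p j = complex_of_int_poly (Ps ! j)"

definition full_product :: "nat word set" where
  "full_product = free_class {1..n} (map (\<lambda>j. (j, True)) [1..<n + 1])"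

text \<open>The word \<open>W\<^sub>j\<close> for an index \<open>i\<close> in block
  \<open>Suc j\<close>, which explains the subtraction of 1. In block 0 the truncated subtraction
  has no meaning; \<open>conjugators\<close> admits these words only for nonzero blocks.\<close>

definition gen_word :: "nat \<Rightarrow> nat word set" where
  "gen_word i = group.orbit_word (F n) (F_gen n 1) (inv\<^bsub>F n\<^esub> F_gen n 1 \<otimes>\<^bsub>F n\<^esub> F_gen n i) (cs (block i - 1))"

text \<open>The Hurwitz condition asks for the full product to come first when \<open>i = j\<close>; the conjugator \<open>\<one>\<close>
  identifies all generators of a block.\<close>

definition conjugators :: "nat \<Rightarrow> nat \<Rightarrow> nat word set list" where
  "conjugators i j =
    (if i = j then [full_product] else []) @
    (if block i = block j then [\<one>\<^bsub>F n\<^esub>] else []) @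
    (if i = j \<and> block i \<noteq> 0 \<and> b (block i - 1) = 0 then [gen_word i] else []) @
    (if i = 1 \<and> block j \<noteq> 0 \<and> b (block j - 1) = 1 then [gen_word j] else [])"

definition l :: "nat \<Rightarrow> nat \<Rightarrow> nat" where "l i j = length (conjugators i j)"

definition w :: "nat \<Rightarrow> nat \<Rightarrow> nat \<Rightarrow> nat word set" where "w i j k = conjugators i j ! (k - 1)"

lemma w_conjugators: "k \<in> {1..l i j} \<Longrightarrow> w i j k \<in> set (conjugators i j)"
  by (auto simp: w_def l_def intro!: nth_mem)

lemma conjugators_w: "u \<in> set (conjugators i j) \<Longrightarrow> \<exists>k\<in>{1..l i j}. w i j k = u"
  unfolding in_set_conv_nth w_def l_def
  by (elim exE conjE, rule_tac x = "Suc i" for i in bexI) auto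

lemma good_nth: "j < s \<Longrightarrow> good_factor d (Ps ! j)"
  by (simp add: s_def good)

lemma b: "j < s \<Longrightarrow> b j \<in> {0, 1}"
  using good_nth[of j] by (simp add: good_factor_def b_def)

text \<open>Since \<open>b j\<close> is the value at 1, the difference is divisible by
  \<open>t - 1\<close>; the factor is taken as \<open>1 - t\<close> to match the form of the
  relation.\<close>

lemma q: "Ps ! j = [:b j:] + [:1, -1:] * q j"
proof -
  have "poly (Ps ! j - [:b j:]) 1 = 0" by (simp add: b_def)
  then have "[:-1, 1:] dvd Ps ! j - [:b j:]" by (simp only: poly_eq_0_iff_dvd)
  then obtain r where "Ps ! j - [:b j:] = [:-1, 1:] * r" by (rule dvdE)
  then have "Ps ! j = [:b j:] + [:-1, 1:] * r" by (simp add: algebra_simps)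
  also have "\<dots> = [:b j:] + [:1, -1:] * (- r)" by simp
  finally show ?thesis unfolding q_def by (rule someI)
qed

lemma p_eq: "p j = [:of_int (b j):] + [:1, -1:] * Poly (map of_int (cs j))"
proof -
  have "p j = complex_of_int_poly ([:b j:] + [:1, -1:] * q j)"
    by (simp only: p_def q[symmetric])
  also have "\<dots> = complex_of_int_poly [:b j:] + complex_of_int_poly [:1, -1:] * complex_of_int_poly (q j)"
    by (simp only: of_int_poly_hom.hom_add of_int_poly_hom.hom_mult)
  also have "complex_of_int_poly [:1, -1:] = [:1, -1:]" by (simp add: of_int_hom.map_poly_pCons_hom)
  also have "complex_of_int_poly [:b j:] = [:of_int (b j):]" by (simp add: of_int_hom.map_poly_pCons_hom)
  also have "complex_of_int_poly (q j) = Poly (map of_int (cs j))" by (rule map_poly_def)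
  finally show ?thesis .
qed

lemma p_root: "j < s \<Longrightarrow> poly (p j) \<zeta> = 0 \<Longrightarrow> \<zeta> ^ d = 1"
  using good_nth[of j] by (simp add: good_factor_def p_def)

lemma p_root_nonzero: "j < s \<Longrightarrow> poly (p j) \<zeta> = 0 \<Longrightarrow> \<zeta> \<noteq> 0"
  using p_root[of j \<zeta>] d by (auto simp: power_0_left)

declare One_nat_def [simp del] atLeastAtMost_iff [simp del]

lemma one_n: "1 \<in> {1..n}"
  using d by (simp add: n_def atLeastAtMost_iff Suc_leI One_nat_def)

lemma map_gens_words: "set L \<subseteq> S \<Longrightarrow> map (\<lambda>j. (j, True)) L \<in> words S"
  by (induction L) auto

lemma product_word: "map (\<lambda>j. (j, True)) [1..<n + 1] \<in> words {1..n}"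
  by (rule map_gens_words) (auto simp: atLeastAtMost_iff)

lemma F_gen_F: "i \<in> {1..n} \<Longrightarrow> F_gen n i \<in> carrier (F n)"
  by (auto simp: F_gen_def free_group_carrier)

lemma gen_word_F: "i \<in> {1..n} \<Longrightarrow> gen_word i \<in> carrier (F n)"
  unfolding gen_word_def using F_gen_F[OF one_n] F_gen_F[of i]
  by (intro group.orbit_word_closed[OF group_free_group])
    (auto simp: group.inv_closed[OF group_free_group] group.is_monoid[OF group_free_group]
      intro!: monoid.m_closed)

lemma conjugators_carrier:
  assumes "i \<in> {1..n}" "j \<in> {1..n}" "u \<in> set (conjugators i j)"
  shows "u \<in> carrier (F n)"
  using assms gen_word_F[of i] gen_word_F[of j] product_word
  by (auto simp: conjugators_def full_product_def free_group_carrier free_group_one split: if_splits)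

lemma C_presentation: "C_presentation n l w"
  unfolding C_presentation_def using w_conjugators conjugators_carrier one_n
  by (auto simp: atLeastAtMost_iff)

lemma hurwitz: "hurwitz_C_presentation n l w"
  unfolding hurwitz_C_presentation_def using C_presentation
  by (auto simp: l_def w_def conjugators_def full_product_def)

sublocale C_presented n l w
  by unfold_locales (rule C_presentation)

lemma conjugators_relation:
  assumes "i \<in> {1..n}" "j \<in> {1..n}" "u \<in> set (conjugators i j)"
  shows "quot u \<otimes>\<^bsub>G\<^esub> \<gamma> i = \<gamma> j \<otimes>\<^bsub>G\<^esub> quot u"
proof -
  obtain k where "k \<in> {1..l i j}" "w i j k = u" using conjugators_w[OF assms(3)] by blast
  then show ?thesis
    using gamma_relation[OF assms(1,2)] assms conjugators_carrier[OF assms] gamma_carrier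
    by (metis G.conjugate_eq_iff quot.hom_closed)
qed

lemma gamma_block:
  assumes "i \<in> {1..n}" "j \<in> {1..n}" "block i = block j"
  shows "\<gamma> i = \<gamma> j"
proof -
  have "\<one>\<^bsub>F n\<^esub> \<in> set (conjugators i j)" using assms(3) by (simp add: conjugators_def)
  from conjugators_relation[OF assms(1,2) this] show ?thesis
    using assms gamma_carrier by simp
qed

text \<open>The first index of block \<open>Suc j\<close>; block 0 is represented by the index
  1.\<close>

definition rep :: "nat \<Rightarrow> nat" where "rep j = Suc j * d + 1"

lemma rep: "j < s \<Longrightarrow> rep j \<in> {1..n}" "block (rep j) = Suc j" "block 1 = 0"
proof -
  assume "j < s"
  then have "Suc j * d + d \<le> Suc s * d" by (metis Suc_leI add.commute mult_Suc mult_le_mono1 Suc_le_mono)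
  then show "rep j \<in> {1..n}" using d by (simp add: rep_def n_def atLeastAtMost_iff)
qed (use d in \<open>simp_all add: rep_def block_def\<close>)

lemma block_le: "i \<in> {1..n} \<Longrightarrow> block i \<le> s"
proof -
  assume "i \<in> {1..n}"
  then have "i - 1 < Suc s * d" by (auto simp: n_def atLeastAtMost_iff)
  then show ?thesis unfolding block_def using d by (simp add: div_less_iff_less_mult less_Suc_eq_le[symmetric])
qed

lemma affine_word_product:
  assumes "\<zeta> \<noteq> 0" "\<zeta> ^ d = 1" "\<And>i. f i = (1, g (block i))"
  obtains v where "group.word_eval (affine_group \<zeta>) f (map (\<lambda>i. (i, True)) [1..<n + 1]) = (int n, v)"
    "\<zeta> * v = v"
  using word_eval_affine_blocks[OF assms(1,2) d, of f g "Suc s"] assms(3)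
  by (auto simp: n_def block_def)

text \<open>Generators of block \<open>Suc j\<close> act with translation 1, all others with
  translation 0. A word \<open>gen_word\<close> of any other block then becomes trivial, being an
  orbit word of the identity; for block \<open>Suc j\<close> the relation is precisely that
  \<open>p j\<close> vanishes at \<open>\<zeta>\<close>.\<close>

lemma affine_rep:
  assumes j: "j < s" "poly (p j) \<zeta> = 0"
  obtains \<psi> where "\<psi> \<in> hom G (affine_group \<zeta>)"
    "\<And>i. i \<in> {1..n} \<Longrightarrow> \<psi> (\<gamma> i) = (1, if block i = Suc j then 1 else 0)"
proof -
  note z0 = p_root_nonzero[OF j] and zd = p_root[OF j]
  interpret A: group "affine_group \<zeta>" by (rule group_affine_group[OF z0])
  define \<delta> :: "nat \<Rightarrow> complex" where "\<delta> i = (if block i = Suc j then 1 else 0)" for i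
  obtain \<phi> where phi: "\<phi> \<in> hom (F n) (affine_group \<zeta>)"
    "\<And>u. u \<in> words {1..n} \<Longrightarrow> \<phi> (free_class {1..n} u) = A.word_eval (\<lambda>i. (1, \<delta> i)) u"
    using A.free_group_lift[of "\<lambda>i. (1, \<delta> i)" "{1..n}"] by auto
  interpret phi: group_hom "F n" "affine_group \<zeta>" \<phi>
    by (simp add: group_hom_def group_hom_axioms_def phi(1) F.is_group A.is_group)
  have phi_gen: "\<phi> (F_gen n i) = (1, \<delta> i)" if "i \<in> {1..n}" for i
    using that phi(2)[of "[(i, True)]"] by (simp add: F_gen_def)
  obtain v where v: "\<phi> full_product = (int n, v)" "\<zeta> * v = v"
    using affine_word_product[OF z0 zd, of "\<lambda>i. (1, \<delta> i)" "\<lambda>t. if t = Suc j then 1 else 0"]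
      phi(2)[OF product_word] by (auto simp: \<delta>_def full_product_def)
  have zn: "\<zeta> ^ n = 1"
    using zd unfolding n_def mult.commute[of _ d] power_mult by simp
  have gw: "\<phi> (gen_word i) = (0, poly (Poly (map of_int (cs (block i - 1)))) \<zeta> * \<delta> i)"
    if i: "i \<in> {1..n}" for i
  proof -
    have "\<delta> 1 = 0" by (simp add: \<delta>_def rep(3))
    then have "\<phi> (gen_word i) = A.orbit_word (1, 0) (0, \<delta> i) (cs (block i - 1))"
      unfolding gen_word_def using F_gen_F[OF one_n] F_gen_F[OF i] phi_gen[OF one_n] phi_gen[OF i]
      by (subst hom_orbit_word[OF F.is_group A.is_group phi(1)]) (simp_all add: inv_affine_group[OF z0])
    then show ?thesis by (simp add: affine_orbit_word[OF z0])
  qed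
  have p_val: "of_int (b j) + (1 - \<zeta>) * poly (Poly (map of_int (cs j))) \<zeta> = 0"
    using j(2) unfolding p_eq by (simp add: algebra_simps)
  have rel: "\<phi> u \<otimes>\<^bsub>affine_group \<zeta>\<^esub> \<phi> (F_gen n i) = \<phi> (F_gen n k) \<otimes>\<^bsub>affine_group \<zeta>\<^esub> \<phi> u"
    if ik: "i \<in> {1..n}" "k \<in> {1..n}" and u: "u \<in> set (conjugators i k)" for i k u
  proof -
    note gens = phi_gen[OF ik(1)] phi_gen[OF ik(2)]
    from u consider "i = k" "u = full_product" | "block i = block k" "u = \<one>\<^bsub>F n\<^esub>"
      | "i = k" "block i \<noteq> 0" "b (block i - 1) = 0" "u = gen_word i"
      | "i = 1" "block k \<noteq> 0" "b (block k - 1) = 1" "u = gen_word k"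
      by (auto simp: conjugators_def split: if_splits)
    then show ?thesis
    proof cases
      case 1
      \<comment> \<open>The maps \<open>(n, v)\<close> and \<open>(1, \<delta>)\<close> commute
        because \<open>\<zeta> v = v\<close> and \<open>\<zeta>^n = 1\<close>.\<close>
      then show ?thesis by (simp add: gens v zn)
    next
      case 2
      then show ?thesis by (simp add: gens \<delta>_def)
    next
      case 3
      \<comment> \<open>If \<open>\<delta> i = 0\<close> both sides vanish; otherwise
        \<open>block i = Suc j\<close> and \<open>p_val\<close> reads
        \<open>(1 - \<zeta>) q(\<zeta>) = 0\<close>.\<close>
      have "\<zeta> * (poly (Poly (map of_int (cs (block i - 1)))) \<zeta> * \<delta> i)
          = poly (Poly (map of_int (cs (block i - 1)))) \<zeta> * \<delta> i"
        using 3(3) p_val by (auto simp: \<delta>_def algebra_simps)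
      then show ?thesis using 3 gens gw[OF ik(2)] by auto
    next
      case 4
      have "\<delta> 1 = 0" by (simp add: \<delta>_def rep(3))
      \<comment> \<open>In block \<open>Suc j\<close> this is \<open>p_val\<close> with
        \<open>b j = 1\<close>, that is, \<open>\<zeta> q(\<zeta>) = 1 + q(\<zeta>)\<close>.\<close>
      moreover have "\<zeta> * (poly (Poly (map of_int (cs (block k - 1)))) \<zeta> * \<delta> k)
          = \<delta> k + poly (Poly (map of_int (cs (block k - 1)))) \<zeta> * \<delta> k"
        using 4(3) p_val by (auto simp: \<delta>_def algebra_simps)
      ultimately show ?thesis using 4 gens gw[OF ik(2)] by auto
    qed
  qed
  obtain \<psi> where psi: "\<psi> \<in> hom G (affine_group \<zeta>)" "\<And>g. g \<in> carrier (F n) \<Longrightarrow> \<psi> (quot g) = \<phi> g"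
    by (rule lift[OF A.is_group phi(1) rel[OF _ _ w_conjugators]]) (assumption+, blast)
  show thesis
    by (rule that[OF psi(1)]) (simp add: \<gamma>_def psi(2) F_gen_F phi_gen \<delta>_def)
qed

text \<open>Here \<open>\<gamma> 1\<close> plays \<open>x\<close>, \<open>\<gamma> (rep j)\<close>
  plays \<open>y\<^sub>j\<close>, and the full product is the central element of degree
  \<open>n\<close>: the Hurwitz relations make it commute with each generator, hence with the whole
  group.\<close>

theorem alexander_polynomial_realization:
  "alexander_polynomial G (C_generators n l w)
    = (\<Prod>P\<leftarrow>Ps. \<Prod>\<zeta> | poly (complex_of_int_poly P) \<zeta> = 0. [:\<zeta>, -1:])"
proof -
  obtain \<nu> where nu: "\<nu> \<in> hom G integer_group" "\<And>i. i \<in> {1..n} \<Longrightarrow> \<nu> (\<gamma> i) = 1"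
    "\<And>u. u \<in> words {1..n} \<Longrightarrow>
      \<nu> (quot (free_class {1..n} u)) = group.word_eval integer_group (\<lambda>_. 1) u"
    by (rule degree_hom) blast
  interpret Z: group integer_group by simp
  interpret nu: group_hom G integer_group \<nu>
    by (simp add: group_hom_def group_hom_axioms_def nu(1) G.is_group)
  interpret gg: graded_group G "C_generators n l w" \<nu>
  proof
    show "C_generators n l w \<subseteq> carrier G"
      by (auto simp: C_generators_eq gamma_carrier)
    show "C_generators n l w \<noteq> {}" using gamma_C[OF one_n] by blast
    have "\<gamma> ` {1..n} \<subseteq> C_generators n l w" using gamma_C by blast
    then show "carrier G \<subseteq> generate G (C_generators n l w)"
      using carrier_G_generate G.mono_generate by blast
    show "\<nu> \<in> hom G integer_group" by (rule nu(1))
    show "\<nu> c = 1" if "c \<in> C_generators n l w" for c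
      using that by (auto simp: C_generators_eq gamma_carrier nu(2))
  qed
  have central: "quot full_product \<otimes>\<^bsub>G\<^esub> g = g \<otimes>\<^bsub>G\<^esub> quot full_product" if "g \<in> carrier G" for g
  proof -
    have fp: "quot full_product \<in> carrier G"
      using product_word by (simp add: full_product_def free_group_carrier)
    have "\<gamma> ` {1..n} \<subseteq> carrier G" using gamma_carrier by blast
    note gc = G.generate_in_carrier[OF this]
    have comm: "quot full_product \<otimes>\<^bsub>G\<^esub> \<gamma> i = \<gamma> i \<otimes>\<^bsub>G\<^esub> quot full_product" if "i \<in> {1..n}" for i
      by (rule conjugators_relation[OF that that]) (simp add: conjugators_def)
    have "g \<in> generate G (\<gamma> ` {1..n})" using that carrier_G_generate by simp
    then show ?thesis
    proof (induction rule: generate.induct)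
      case one
      then show ?case using fp by simp
    next
      case (incl h)
      then show ?case using comm by blast
    next
      case (inv h)
      then obtain i where i: "i \<in> {1..n}" "h = \<gamma> i" by blast
      have h: "h \<in> carrier G" using i gamma_carrier by simp
      have "quot full_product \<otimes>\<^bsub>G\<^esub> inv\<^bsub>G\<^esub> h
          = inv\<^bsub>G\<^esub> h \<otimes>\<^bsub>G\<^esub> (h \<otimes>\<^bsub>G\<^esub> quot full_product) \<otimes>\<^bsub>G\<^esub> inv\<^bsub>G\<^esub> h"
        using h fp by (simp add: G.m_assoc G.mult_inv_cancel)
      also have "h \<otimes>\<^bsub>G\<^esub> quot full_product = quot full_product \<otimes>\<^bsub>G\<^esub> h"
        using comm[OF i(1)] i(2) by simp
      also have "inv\<^bsub>G\<^esub> h \<otimes>\<^bsub>G\<^esub> (quot full_product \<otimes>\<^bsub>G\<^esub> h) \<otimes>\<^bsub>G\<^esub> inv\<^bsub>G\<^esub> h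
          = inv\<^bsub>G\<^esub> h \<otimes>\<^bsub>G\<^esub> quot full_product"
        using h fp by (simp add: G.m_assoc)
      finally show ?case .
    next
      case (eng h1 h2)
      have h: "h1 \<in> carrier G" "h2 \<in> carrier G" using eng.hyps gc by auto
      have "quot full_product \<otimes>\<^bsub>G\<^esub> (h1 \<otimes>\<^bsub>G\<^esub> h2) = (quot full_product \<otimes>\<^bsub>G\<^esub> h1) \<otimes>\<^bsub>G\<^esub> h2"
        using h fp by (simp add: G.m_assoc)
      also have "\<dots> = h1 \<otimes>\<^bsub>G\<^esub> (quot full_product \<otimes>\<^bsub>G\<^esub> h2)"
        using eng.IH(1) h fp by (simp add: G.m_assoc)
      also have "\<dots> = h1 \<otimes>\<^bsub>G\<^esub> h2 \<otimes>\<^bsub>G\<^esub> quot full_product"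
        using eng.IH(2) h fp by (simp add: G.m_assoc)
      finally show ?case .
    qed
  qed
  have nu_product: "\<nu> (quot full_product) = int n"
  proof -
    have "Z.word_eval (\<lambda>_. 1) (map (\<lambda>j. (j, True)) L) = int (length L)" for L :: "nat list"
      by (induction L) simp_all
    then show ?thesis using nu(3)[OF product_word] by (simp add: full_product_def)
  qed
  have quot_word: "quot (gen_word (rep j)) = G.orbit_word (\<gamma> 1) (inv\<^bsub>G\<^esub> \<gamma> 1 \<otimes>\<^bsub>G\<^esub> \<gamma> (rep j)) (cs j)"
    if "j < s" for j
    unfolding gen_word_def
    using F_gen_F[OF one_n] F_gen_F[OF rep(1)[OF that]] rep(2)[of j]
    by (subst hom_orbit_word[OF F.is_group G.is_group quot.homh]) (simp_all add: \<gamma>_def)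
  interpret cr: cyclic_relations G "C_generators n l w" \<nu> s n "\<gamma> 1" "\<lambda>j. \<gamma> (rep j)"
    "quot full_product" b cs "\<lambda>j. G.orbit_word (\<gamma> 1) (inv\<^bsub>G\<^esub> \<gamma> 1 \<otimes>\<^bsub>G\<^esub> \<gamma> (rep j)) (cs j)" p
  proof (intro cyclic_relations.intro cyclic_relations_axioms.intro)
    show "graded_group G (C_generators n l w) \<nu>" by (rule gg.graded_group_axioms)
    show "\<gamma> 1 \<in> carrier G" "\<nu> (\<gamma> 1) = 1" using gamma_carrier one_n nu(2) by auto
    show "\<gamma> (rep j) \<in> carrier G" "\<nu> (\<gamma> (rep j)) = 1" if "j < s" for j
      using gamma_carrier rep(1)[OF that] nu(2) by auto
    show "carrier G \<subseteq> generate G (insert (\<gamma> 1) ((\<lambda>j. \<gamma> (rep j)) ` {..<s}))"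
    proof -
      have "\<gamma> i \<in> insert (\<gamma> 1) ((\<lambda>j. \<gamma> (rep j)) ` {..<s})" if i: "i \<in> {1..n}" for i
      proof (cases "block i")
        case 0
        then have "\<gamma> i = \<gamma> 1" using gamma_block[OF i one_n] rep(3) by simp
        then show ?thesis by simp
      next
        case (Suc t)
        then have "t < s" using block_le[OF i] by simp
        then have "\<gamma> i = \<gamma> (rep t)" using gamma_block[OF i rep(1)] Suc rep(2)[of t] by simp
        then show ?thesis using \<open>t < s\<close> by blast
      qed
      then have "\<gamma> ` {1..n} \<subseteq> insert (\<gamma> 1) ((\<lambda>j. \<gamma> (rep j)) ` {..<s})" by blast
      then show ?thesis using carrier_G_generate G.mono_generate by blast
    qed
    show "quot full_product \<in> carrier G"
      using product_word by (simp add: full_product_def free_group_carrier)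
    show "\<nu> (quot full_product) = int n" by (rule nu_product)
    show "n > 0" using d by (simp add: n_def)
    show "quot full_product \<otimes>\<^bsub>G\<^esub> g = g \<otimes>\<^bsub>G\<^esub> quot full_product" if "g \<in> carrier G" for g
      using that by (rule central)
    show "b j \<in> {0, 1}" if "j < s" for j using that by (rule b)
    show "G.orbit_word (\<gamma> 1) (inv\<^bsub>G\<^esub> \<gamma> 1 \<otimes>\<^bsub>G\<^esub> \<gamma> (rep j)) (cs j) \<otimes>\<^bsub>G\<^esub> (if b j = 0 then \<gamma> (rep j) else \<gamma> 1)
        = \<gamma> (rep j) \<otimes>\<^bsub>G\<^esub> G.orbit_word (\<gamma> 1) (inv\<^bsub>G\<^esub> \<gamma> 1 \<otimes>\<^bsub>G\<^esub> \<gamma> (rep j)) (cs j)"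
      if j: "j < s" for j
    proof (cases "b j = 0")
      case True
      then have "gen_word (rep j) \<in> set (conjugators (rep j) (rep j))"
        using rep(2)[of j] by (simp add: conjugators_def)
      from conjugators_relation[OF rep(1)[OF j] rep(1)[OF j] this] show ?thesis
        using True by (simp add: quot_word[OF j])
    next
      case False
      then have "gen_word (rep j) \<in> set (conjugators 1 (rep j))"
        using rep(2)[of j] b[OF j] by (simp add: conjugators_def)
      from conjugators_relation[OF one_n rep(1)[OF j] this] show ?thesis
        using False by (simp add: quot_word[OF j])
    qed
    show "rsquarefree ([:of_int (b j):] + [:1, -1:] * Poly (map of_int (cs j)) :: complex poly)"
      if "j < s" for j
      using good_nth[OF that] by (simp only: p_eq[symmetric] good_factor_def p_def)
    show "poly ([:of_int (b j):] + [:1, -1:] * Poly (map of_int (cs j))) (0::complex) \<noteq> 0"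
      if "j < s" for j
      using p_root_nonzero[OF that, of 0] by (auto simp only: p_eq[symmetric])
    show "\<exists>\<phi>\<in>hom G (affine_group \<zeta>). \<phi> (\<gamma> 1) = (1, 0) \<and>
        (\<forall>i<s. \<phi> (\<gamma> (rep i)) = (1, if i = j then 1 else 0))"
      if j: "j < s" and z: "poly ([:of_int (b j):] + [:1, -1:] * Poly (map of_int (cs j))) \<zeta> = 0" for j \<zeta>
    proof -
      have "poly (p j) \<zeta> = 0" using z by (simp only: p_eq)
      from affine_rep[OF j this] obtain \<psi> where psi: "\<psi> \<in> hom G (affine_group \<zeta>)"
        "\<And>i. i \<in> {1..n} \<Longrightarrow> \<psi> (\<gamma> i) = (1, if block i = Suc j then 1 else 0)" by blast
      then show ?thesis
        using one_n rep by (intro bexI[of _ \<psi>]) auto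
    qed
  qed (rule eq_reflection, rule ext, simp only: p_eq)+
  have "alexander_polynomial G (C_generators n l w) = (\<Prod>j<s. \<Prod>\<zeta> | poly (p j) \<zeta> = 0. [:\<zeta>, -1:])"
    by (rule cr.alexander_polynomial_eq)
  also have "\<dots> = (\<Prod>P\<leftarrow>Ps. \<Prod>\<zeta> | poly (complex_of_int_poly P) \<zeta> = 0. [:\<zeta>, -1:])"
    by (simp add: prod.list_conv_set_nth s_def p_def atLeast0LessThan)
  finally show ?thesis .
qed

lemma hurwitz_C_group: "hurwitz_C_group G (C_generators n l w)"
  unfolding hurwitz_C_group_def
proof (intro conjI exI)
  show "(\<lambda>x. x) \<in> iso G G" by (rule iso_set_refl)
  show "(\<lambda>x. x) ` C_generators n l w = C_generators n l w" by simp
qed (rule G.is_group hurwitz)+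

end

theorem theorem0p2:
  fixes m :: nat and a :: "nat \<Rightarrow> int" and P :: "int poly"
  assumes P: "P = Polynomial.monom ((-1) ^ m) m + (\<Sum>i<m. Polynomial.monom (a i) i)"
    and roots: "\<And>z::complex. poly (map_poly of_int P) z = 0 \<Longrightarrow> \<exists>n>0. z ^ n = 1"
    and mult: "\<And>(p::nat) (k::nat) \<zeta>. prime p \<Longrightarrow> primitive_root_of_unity (p ^ k) \<zeta> \<Longrightarrow>
      Polynomial.order \<zeta> (map_poly of_int P) \<le> Polynomial.order 1 (map_poly of_int P :: complex poly)"
  shows "\<exists>(G :: nat word set set monoid) C.
    hurwitz_C_group G C \<and> alexander_polynomial G C = map_poly of_int P"
proof -
  have c: "coeff P i = (if i = m then (-1) ^ m else if i < m then a i else 0)" for i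
    by (auto simp: P coeff_sum if_distrib sum.delta)
  have deg: "degree P = m"
  proof (rule antisym)
    show "degree P \<le> m" by (rule degree_le) (auto simp: c)
    show "m \<le> degree P" by (rule le_degree) (simp add: c)
  qed
  \<comment> \<open>This sign is the leading coefficient of \<open>det (h - t Id)\<close> in
    dimension \<open>m\<close>, so the result is \<open>P\<close> itself and not
    \<open>- P\<close>.\<close>
  have lead: "lead_coeff P = (-1) ^ degree P" by (simp add: deg c)
  obtain d Ps where "d > 0" "\<And>p. p \<in> set Ps \<Longrightarrow> good_factor d p"
    and eq: "(\<Prod>p\<leftarrow>Ps. \<Prod>z | poly (complex_of_int_poly p) z = 0. [:z, -1:]) = complex_of_int_poly P"
    by (rule good_factorization_linear_factors[OF lead roots mult]) (assumption+, blast)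
  then interpret realization d Ps by unfold_locales
  show ?thesis
    using hurwitz_C_group alexander_polynomial_realization eq by auto
qed

end
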